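(* Let $A,B\in\mathbb{B}(\mathscr{H})$ be positive operators and let $m,m',M,M'$ be positive real numbers satisfying either one of the following conditions: (1) $0<m\le B\le m'<M'\le A\le M$; (2) $0<m\le A\le m'<M'\le B\le M$. Let $1\le\alpha\le2$ and $p\ge 2\alpha$. Then for every positive unital linear map $\Phi:\mathbb{B}(\mathscr{H})\to\mathbb{B}(\mathscr{K})$ and every $0\le\nu\le 1$, $$\Phi^{p}\big(A\nabla_\nu B+2rMm(A^{-1}\nabla B^{-1}-A^{-1}\sharp B^{-1})\big)\le\frac{\Big(K(\sqrt{h'})^{-\frac{r_1\alpha}{2}}K(h)^{\frac{\alpha}{2}}(M^{\alpha}+m^{\alpha})\Big)^{\frac{2p}{\alpha}}}{16M^{p}m^{p}}\,\Phi^{p}(A\sharp_\nu B)$$ and $$\Phi^{p}\big(A\nabla_\nu B+2rMm(A^{-1}\nabla B^{-1}-A^{-1}\sharp B^{-1})\big)\le\frac{\Big(K(\sqrt{h'})^{-\frac{r_1\alpha}{2}}K(h)^{\frac{\alpha}{2}}(M^{\alpha}+m^{\alpha})\Big)^{\frac{2p}{\alpha}}}{16M^{p}m^{p}}\,\big(\Phi(A)\sharp_\nu\Phi(B)\big)^{p},$$ where $r=\min\{\nu,1-\nu\}$, $r_1=\min\{2r,1-2r\}$, $h=\frac{M}{m}$, $h'=\frac{M'}{m'}$.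
   Context: $\mathscr{H}$ and $\mathscr{K}$ are complex Hilbert spaces; $\mathbb{B}(\mathscr{H})$ is the $C^*$-algebra of bounded linear operators on $\mathscr{H}$ with identity $I$. For self-adjoint $X,Y$, $X\le Y$ means $Y-X$ is positive, i.e. $\langle (Y-X)x,x\rangle\ge 0$ for all $x$. A scalar $c$ in an operator inequality stands for $cI$. A linear map $\Phi$ is positive if $\Phi(X)\ge0$ whenever $X\ge0$, and unital if $\Phi(I)=I$. $\Phi^{p}(X)$ denotes $(\Phi(X))^{p}$ (functional calculus). For positive invertible $X,Y$ and $0\le\nu\le1$: $X\nabla_\nu Y=(1-\nu)X+\nu Y$ and $X\sharp_\nu Y=X^{1/2}(X^{-1/2}YX^{-1/2})^{\nu}X^{1/2}$; $\nabla$ and $\sharp$ denote $\nabla_{1/2}$ and $\sharp_{1/2}$. The Kantorovich constant is $K(t)=\frac{(1+t)^2}{4t}$ for $t>0$. *)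

theory Defs
  imports
    "HOL-Analysis.Analysis"
    "HOL-Computational_Algebra.Polynomial"
    "HOL-Library.Nonpos_Ints"
begin

section \<open>Complex Hilbert spaces\<close>

class complex_vector = real_vector +
  fixes scaleC :: "complex \<Rightarrow> 'a \<Rightarrow> 'a"  (infixr \<open>*\<^sub>C\<close> 75)
  assumes scaleC_add_right: "c *\<^sub>C (x + y) = c *\<^sub>C x + c *\<^sub>C y"
    and scaleC_add_left: "(c + d) *\<^sub>C x = c *\<^sub>C x + d *\<^sub>C x"
    and scaleC_scaleC: "c *\<^sub>C (d *\<^sub>C x) = (c * d) *\<^sub>C x"
    and scaleC_of_real: "complex_of_real r *\<^sub>C x = r *\<^sub>R x"

text \<open>The inner product is linear in the first argument. Positive definiteness is
  part of \<open>cinner_self\<close>.\<close>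

class complex_inner_space = complex_vector + real_normed_vector +
  fixes cinner :: "'a \<Rightarrow> 'a \<Rightarrow> complex"
  assumes cinner_add_left: "cinner (x + y) z = cinner x z + cinner y z"
    and cinner_scaleC_left: "cinner (c *\<^sub>C x) y = c * cinner x y"
    and cinner_commute: "cinner y x = cnj (cinner x y)"
    and cinner_self: "cinner x x = complex_of_real ((norm x)\<^sup>2)"

class complex_hilbert_space = complex_inner_space + complete_space

lemma scaleC_zero_right [simp]: "c *\<^sub>C (0::'a::complex_vector) = 0"
  using scaleC_add_right [of c 0 "0::'a"] by simp

lemma scaleC_minus_right: "c *\<^sub>C (- x) = - (c *\<^sub>C (x::'a::complex_vector))"
  using scaleC_add_right [of c x "- x"] by (simp add: minus_unique)

lemma scaleC_diff_right: "c *\<^sub>C (x - y) = c *\<^sub>C x - c *\<^sub>C (y::'a::complex_vector)"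
  using scaleC_add_right [of c x "- y"] by (simp add: scaleC_minus_right)

lemma scaleC_scaleR_commute: "c *\<^sub>C (r *\<^sub>R x) = r *\<^sub>R (c *\<^sub>C (x::'a::complex_vector))"
  by (simp add: scaleC_of_real [symmetric] scaleC_scaleC mult.commute)

lemma cinner_zero_left [simp]: "cinner 0 (y::'a::complex_inner_space) = 0"
  using cinner_add_left [of 0 0 y] by simp

lemma cinner_minus_left: "cinner (- x) y = - cinner x (y::'a::complex_inner_space)"
  using cinner_add_left [of x "- x" y] by (simp add: minus_unique)

lemma cinner_add_right: "cinner x (y + z) = cinner x y + cinner x (z::'a::complex_inner_space)"
  by (simp add: cinner_commute [of x] cinner_add_left)

lemma cinner_scaleC_right: "cinner x (c *\<^sub>C y) = cnj c * cinner x (y::'a::complex_inner_space)"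
  by (simp add: cinner_commute [of x] cinner_scaleC_left)

lemma norm_scaleC: "norm (c *\<^sub>C x) = cmod c * norm (x::'a::complex_inner_space)"
proof -
  have "complex_of_real ((norm (c *\<^sub>C x))\<^sup>2) = (c * cnj c) * complex_of_real ((norm x)\<^sup>2)"
    by (simp only: cinner_self [symmetric] cinner_scaleC_left cinner_scaleC_right ac_simps)
  also have "\<dots> = complex_of_real ((cmod c * norm x)\<^sup>2)"
    by (simp add: complex_norm_square [symmetric] power_mult_distrib)
  finally have "(norm (c *\<^sub>C x))\<^sup>2 = (cmod c * norm x)\<^sup>2"
    using of_real_eq_iff by blast
  then show ?thesis
    by (simp add: power2_eq_iff_nonneg)
qed

section \<open>Bounded operators\<close>

text \<open>\<open>bounded_linear\<close> only provides real linearity.\<close>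

typedef (overloaded) 'a bop =
  "{T :: 'a::complex_inner_space \<Rightarrow> 'a. bounded_linear T \<and> (\<forall>c x. T (c *\<^sub>C x) = c *\<^sub>C T x)}"
  morphisms bop_apply Bop
  by (rule exI [of _ "\<lambda>x. x"]) simp

setup_lifting type_definition_bop

lemma bounded_linear_bop: "bounded_linear (bop_apply T)"
  using bop_apply [of T] by simp

lemma bop_apply_scaleC: "bop_apply T (c *\<^sub>C x) = c *\<^sub>C bop_apply T x"
  using bop_apply [of T] by simp

lemma bop_eqI: "(\<And>x. bop_apply S x = bop_apply T x) \<Longrightarrow> S = T"
  by (metis bop_apply_inject ext)

instantiation bop :: (complex_inner_space)
  "{real_normed_vector, complex_vector, ring, monoid_mult, real_normed_algebra}"
begin

lift_definition zero_bop :: "'a bop" is "\<lambda>_. 0"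
  by simp

lift_definition one_bop :: "'a bop" is "\<lambda>x. x"
  by simp

lift_definition plus_bop :: "'a bop \<Rightarrow> 'a bop \<Rightarrow> 'a bop" is "\<lambda>S T x. S x + T x"
  by (auto simp: bounded_linear_add scaleC_add_right)

lift_definition uminus_bop :: "'a bop \<Rightarrow> 'a bop" is "\<lambda>T x. - T x"
  by (auto simp: bounded_linear_minus scaleC_minus_right)

lift_definition minus_bop :: "'a bop \<Rightarrow> 'a bop \<Rightarrow> 'a bop" is "\<lambda>S T x. S x - T x"
  by (simp add: bounded_linear_sub scaleC_diff_right)

lift_definition times_bop :: "'a bop \<Rightarrow> 'a bop \<Rightarrow> 'a bop" is "\<lambda>S T x. S (T x)"
  by (auto simp: bounded_linear_compose)

lift_definition scaleR_bop :: "real \<Rightarrow> 'a bop \<Rightarrow> 'a bop" is "\<lambda>r T x. r *\<^sub>R T x"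
  by (auto simp: bounded_linear_const_scaleR scaleC_scaleR_commute)

lift_definition scaleC_bop :: "complex \<Rightarrow> 'a bop \<Rightarrow> 'a bop" is "\<lambda>c T x. c *\<^sub>C T x"
proof -
  fix c :: complex and T :: "'a \<Rightarrow> 'a"
  assume T: "bounded_linear T \<and> (\<forall>c x. T (c *\<^sub>C x) = c *\<^sub>C T x)"
  have "bounded_linear (\<lambda>x::'a. c *\<^sub>C x)"
    by (rule bounded_linear_intro [where K = "cmod c"])
      (simp_all add: scaleC_add_right scaleC_scaleR_commute norm_scaleC mult.commute)
  with T show "bounded_linear (\<lambda>x. c *\<^sub>C T x) \<and> (\<forall>d x. c *\<^sub>C T (d *\<^sub>C x) = d *\<^sub>C c *\<^sub>C T x)"
    by (simp add: bounded_linear_compose scaleC_scaleC mult.commute)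
qed

lift_definition norm_bop :: "'a bop \<Rightarrow> real" is onorm .

definition dist_bop :: "'a bop \<Rightarrow> 'a bop \<Rightarrow> real" where
  "dist_bop S T = norm (S - T)"

definition sgn_bop :: "'a bop \<Rightarrow> 'a bop" where
  "sgn_bop T = inverse (norm T) *\<^sub>R T"

definition uniformity_bop :: "('a bop \<times> 'a bop) filter" where
  "uniformity_bop = (INF e\<in>{0<..}. principal {(S, T). dist S T < e})"

definition open_bop :: "'a bop set \<Rightarrow> bool" where
  "open_bop U = (\<forall>S\<in>U. \<forall>\<^sub>F (S', T) in uniformity. S' = S \<longrightarrow> T \<in> U)"

instance
proof
  fix R S T :: "'a bop" and a b :: real and c d :: complex
  show "R + S + T = R + (S + T)" by transfer (simp add: add.assoc)
  show "S + T = T + S" by transfer (simp add: add.commute)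
  show "0 + T = T" by transfer simp
  show "- T + T = 0" by transfer simp
  show "S - T = S + - T" by transfer simp
  show "a *\<^sub>R (S + T) = a *\<^sub>R S + a *\<^sub>R T" by transfer (simp add: scaleR_add_right)
  show "(a + b) *\<^sub>R T = a *\<^sub>R T + b *\<^sub>R T" by transfer (simp add: scaleR_add_left)
  show "a *\<^sub>R b *\<^sub>R T = (a * b) *\<^sub>R T" by transfer simp
  show "1 *\<^sub>R T = T" by transfer simp
  show "dist S T = norm (S - T)" by (rule dist_bop_def)
  show "sgn T = inverse (norm T) *\<^sub>R T" by (rule sgn_bop_def)
  show "uniformity = (INF e\<in>{0<..}. principal {(S, T :: 'a bop). dist S T < e})"
    by (rule uniformity_bop_def)
  show "open U = (\<forall>S\<in>U. \<forall>\<^sub>F (S', T) in uniformity. S' = S \<longrightarrow> T \<in> U)" for U :: "'a bop set"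
    by (rule open_bop_def)
  show "(norm T = 0) = (T = 0)" by transfer (auto simp: onorm_eq_0 fun_eq_iff)
  show "norm (S + T) \<le> norm S + norm T" by transfer (auto intro: onorm_triangle)
  show "norm (a *\<^sub>R T) = \<bar>a\<bar> * norm T" by transfer (auto intro: onorm_scaleR)
  show "c *\<^sub>C (S + T) = c *\<^sub>C S + c *\<^sub>C T" by transfer (simp add: scaleC_add_right)
  show "(c + d) *\<^sub>C T = c *\<^sub>C T + d *\<^sub>C T" by transfer (simp add: scaleC_add_left)
  show "c *\<^sub>C d *\<^sub>C T = (c * d) *\<^sub>C T" by transfer (simp add: scaleC_scaleC)
  show "complex_of_real a *\<^sub>C T = a *\<^sub>R T" by transfer (simp add: scaleC_of_real)
  show "R * S * T = R * (S * T)" by transfer simp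
  show "(R + S) * T = R * T + S * T" by transfer simp
  show "R * (S + T) = R * S + R * T"
    by transfer (simp add: bounded_linear.linear linear_add)
  show "1 * T = T" by transfer simp
  show "T * 1 = T" by transfer simp
  show "a *\<^sub>R S * T = a *\<^sub>R (S * T)" by transfer simp
  show "S * a *\<^sub>R T = a *\<^sub>R (S * T)"
    by transfer (simp add: bounded_linear.linear linear_scale)
  show "norm (S * T) \<le> norm S * norm T"
    by transfer (use onorm_compose in \<open>auto simp: o_def\<close>)
qed

end

section \<open>Positivity and the operator order\<close>

text \<open>On a complex space \<open>\<langle>T x, x\<rangle> \<ge> 0\<close> for all \<open>x\<close> already forces \<open>T\<close> to be
  self-adjoint.\<close>

definition positive_op :: "'a::complex_inner_space bop \<Rightarrow> bool" where
  "positive_op T \<longleftrightarrow> (\<forall>x. cinner (bop_apply T x) x \<in> \<real>\<^sub>\<ge>\<^sub>0)"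

lemma bop_zero_if_form_zero:
  fixes T :: "'a::complex_inner_space bop"
  assumes form: "\<And>x. cinner (bop_apply T x) x = 0"
  shows "T = 0"
proof -
  interpret T: bounded_linear "bop_apply T" by (rule bounded_linear_bop)
  have "bop_apply T x = 0" for x
  proof -
    define y where "y = bop_apply T x"
    have 1: "cinner (bop_apply T x) y + cinner (bop_apply T y) x = 0"
      using form [of "x + y"] form [of x] form [of y]
      by (simp add: T.add cinner_add_left cinner_add_right add.commute)
    have "cinner (bop_apply T x) (\<i> *\<^sub>C y) + cinner (bop_apply T (\<i> *\<^sub>C y)) x = 0"
      using form [of "x + \<i> *\<^sub>C y"] form [of x] form [of "\<i> *\<^sub>C y"]
      by (simp add: T.add cinner_add_left cinner_add_right add.commute)
    then have "\<i> * (cinner (bop_apply T y) x - cinner (bop_apply T x) y) = 0"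
      by (simp add: bop_apply_scaleC cinner_scaleC_left cinner_scaleC_right right_diff_distrib)
    with 1 have "cinner (bop_apply T x) y = 0"
      by simp
    then show ?thesis
      by (simp add: y_def cinner_self)
  qed
  then show ?thesis
    by (intro bop_eqI) (simp add: zero_bop.rep_eq)
qed

instantiation bop :: (complex_inner_space) order
begin

definition less_eq_bop :: "'a bop \<Rightarrow> 'a bop \<Rightarrow> bool" where
  "X \<le> Y \<longleftrightarrow> positive_op (Y - X)"

definition less_bop :: "'a bop \<Rightarrow> 'a bop \<Rightarrow> bool" where
  "X < Y \<longleftrightarrow> X \<le> Y \<and> \<not> Y \<le> (X :: 'a bop)"

instance
proof
  fix X Y Z :: "'a bop"
  show "X < Y \<longleftrightarrow> X \<le> Y \<and> \<not> Y \<le> X" by (rule less_bop_def)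
  show "X \<le> X" by (simp add: less_eq_bop_def positive_op_def zero_bop.rep_eq)
  show "X \<le> Z" if "X \<le> Y" "Y \<le> Z"
  proof -
    have "bop_apply (Z - X) x = bop_apply (Y - X) x + bop_apply (Z - Y) x" for x
      by (simp add: minus_bop.rep_eq)
    then show ?thesis
      using that by (simp add: less_eq_bop_def positive_op_def cinner_add_left)
  qed
  show "X = Y" if "X \<le> Y" "Y \<le> X"
  proof -
    have "cinner (bop_apply (Y - X) x) x = 0" for x
    proof -
      have "bop_apply (X - Y) x = - bop_apply (Y - X) x"
        by (simp add: minus_bop.rep_eq)
      then have "cinner (bop_apply (Y - X) x) x \<in> \<real>\<^sub>\<ge>\<^sub>0" "- cinner (bop_apply (Y - X) x) x \<in> \<real>\<^sub>\<ge>\<^sub>0"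
        using that by (auto simp: less_eq_bop_def positive_op_def cinner_minus_left
            dest!: spec [where x = x])
      then show ?thesis
        by (auto simp: complex_nonneg_Reals_iff complex_eq_iff)
    qed
    then have "Y - X = 0"
      by (rule bop_zero_if_form_zero)
    then show ?thesis
      by simp
  qed
qed

end

section \<open>Functional calculus and operator means\<close>

definition invertible_op :: "'a::complex_inner_space bop \<Rightarrow> bool" where
  "invertible_op T \<longleftrightarrow> (\<exists>S. S * T = 1 \<and> T * S = 1)"

definition inverse_op :: "'a::complex_inner_space bop \<Rightarrow> 'a bop" where
  "inverse_op T = (THE S. S * T = 1 \<and> T * S = 1)"

definition spectrum :: "'a::complex_inner_space bop \<Rightarrow> complex set" where
  "spectrum T = {z. \<not> invertible_op (T - z *\<^sub>C 1)}"

definition poly_op :: "real poly \<Rightarrow> 'a::complex_inner_space bop \<Rightarrow> 'a bop" where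
  "poly_op q T = (\<Sum>i\<le>degree q. coeff q i *\<^sub>R T ^ i)"

text \<open>Continuous functional calculus: for self-adjoint \<open>T\<close> (whose spectrum is real) and \<open>f\<close>
  continuous on the spectrum of \<open>T\<close>, the operator \<open>f(T)\<close> is the norm limit of \<open>q\<^sub>n(T)\<close> for any
  real polynomials \<open>q\<^sub>n\<close> converging to \<open>f\<close> uniformly on the spectrum. Such \<open>q\<^sub>n\<close> exist by
  Weierstrass' theorem, so the limit is unique. The value is unspecified for other \<open>f\<close>, \<open>T\<close>.\<close>

definition func_calc :: "(real \<Rightarrow> real) \<Rightarrow> 'a::complex_inner_space bop \<Rightarrow> 'a bop" where
  "func_calc f T = (THE S. \<forall>q :: nat \<Rightarrow> real poly.
     uniform_limit {t. complex_of_real t \<in> spectrum T} (\<lambda>n. poly (q n)) f sequentially \<longrightarrow>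
     (\<lambda>n. poly_op (q n) T) \<longlonglongrightarrow> S)"

text \<open>Since \<open>0 powr a = 0\<close> for every \<open>a\<close>, exponents \<open>a \<le> 0\<close> are meaningful only for positive
  invertible operators.\<close>

definition op_powr :: "'a::complex_inner_space bop \<Rightarrow> real \<Rightarrow> 'a bop"  (infixr \<open>powr\<^sub>o\<close> 80) where
  "T powr\<^sub>o a = func_calc (\<lambda>t. t powr a) T"

definition arith_mean :: "real \<Rightarrow> 'a::complex_inner_space bop \<Rightarrow> 'a bop \<Rightarrow> 'a bop" where
  "arith_mean \<nu> X Y = (1 - \<nu>) *\<^sub>R X + \<nu> *\<^sub>R Y"

definition geom_mean :: "real \<Rightarrow> 'a::complex_inner_space bop \<Rightarrow> 'a bop \<Rightarrow> 'a bop" where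
  "geom_mean \<nu> X Y =
     X powr\<^sub>o (1/2) * (X powr\<^sub>o (-1/2) * Y * X powr\<^sub>o (-1/2)) powr\<^sub>o \<nu> * X powr\<^sub>o (1/2)"

definition kantorovich :: "real \<Rightarrow> real" where
  "kantorovich t = (1 + t)\<^sup>2 / (4 * t)"

section \<open>Positive unital linear maps\<close>

definition linear_op_map ::
    "('a::complex_inner_space bop \<Rightarrow> 'b::complex_inner_space bop) \<Rightarrow> bool" where
  "linear_op_map \<Phi> \<longleftrightarrow>
     (\<forall>X Y. \<Phi> (X + Y) = \<Phi> X + \<Phi> Y) \<and> (\<forall>c X. \<Phi> (c *\<^sub>C X) = c *\<^sub>C \<Phi> X)"

definition positive_op_map ::
    "('a::complex_inner_space bop \<Rightarrow> 'b::complex_inner_space bop) \<Rightarrow> bool" where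
  "positive_op_map \<Phi> \<longleftrightarrow> (\<forall>X. 0 \<le> X \<longrightarrow> 0 \<le> \<Phi> X)"

definition unital_op_map ::
    "('a::complex_inner_space bop \<Rightarrow> 'b::complex_inner_space bop) \<Rightarrow> bool" where
  "unital_op_map \<Phi> \<longleftrightarrow> \<Phi> 1 = 1"

end

theory Submission
  imports Defs "HOL-Computational_Algebra.Fundamental_Theorem_Algebra"
begin

text \<open>
  Put \<open>s = M + m\<close>, \<open>\<kappa> = K(\<surd>h')\<^bsup>r\<^sub>1\<^esup>\<close>, let \<open>X\<close> be the operator \<open>\<Phi>(\<dots>)\<close> on the left-hand sides and let \<open>Y\<close> be
  \<open>\<Phi>(A \<sharp>\<^sub>\<nu> B)\<close> or \<open>\<Phi>(A) \<sharp>\<^sub>\<nu> \<Phi>(B)\<close>. Everything follows from the single inequality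
  \<open>X + M m \<kappa> Y\<^sup>-\<^sup>1 \<le> s\<close>.

  To obtain it, write \<open>t + M m / t \<le> s\<close> on \<open>[m, M]\<close> as \<open>A + M m A\<^sup>-\<^sup>1 \<le> s\<close>, and likewise for \<open>B\<close>. A Young
  inequality with Kantorovich constant (\<open>Young_kantorovich_separated\<close>) bounds
  \<open>A\<^sup>-\<^sup>1 \<nabla>\<^sub>\<nu> B\<^sup>-\<^sup>1\<close> from below by \<open>2 r (A\<^sup>-\<^sup>1 \<nabla> B\<^sup>-\<^sup>1 - A\<^sup>-\<^sup>1 \<sharp> B\<^sup>-\<^sup>1) + \<kappa> (A \<sharp>\<^sub>\<nu> B)\<^sup>-\<^sup>1\<close>; the constant
  \<open>\<kappa>\<close> is available because the gap between \<open>m'\<close> and \<open>M'\<close> keeps the relative operator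
  \<open>A\<^sup>1\<^sup>/\<^sup>2 B\<^sup>-\<^sup>1 A\<^sup>1\<^sup>/\<^sup>2\<close> away from \<open>1\<close>. Now apply \<open>\<Phi>\<close> and use Choi's inequality
  \<open>\<Phi>(T)\<^sup>-\<^sup>1 \<le> \<Phi>(T\<^sup>-\<^sup>1)\<close> (\<open>inverse_map_le_map_inverse\<close>). Ando's inequality
  \<open>\<Phi>(A \<sharp>\<^sub>\<nu> B) \<le> \<Phi>(A) \<sharp>\<^sub>\<nu> \<Phi>(B)\<close> (\<open>map_geom_mean_le\<close>) passes to the second choice of \<open>Y\<close>. Both inequalities
  rest on the fact that a positive map is 2-positive on the commutative algebra generated by one
  self-adjoint operator (\<open>map_two_positive\<close>).

  To exploit it, put \<open>Z = M m \<kappa> Y\<^sup>-\<^sup>1\<close>, so that \<open>X\<close> and \<open>Z\<close> lie between \<open>m\<close> and \<open>M\<close> and \<open>X + Z \<le> s\<close>.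
  Taking expectations in a unit vector reduces \<open>X\<^sup>\<alpha> + Z\<^sup>\<alpha> \<le> \<rho>\<close> with \<open>\<rho> = K(h)\<^sup>\<alpha>\<^sup>/\<^sup>2 (M\<^sup>\<alpha> + m\<^sup>\<alpha>)\<close> to convexity of
  \<open>t\<^sup>\<alpha>\<close> and to a scalar Kantorovich inequality (\<open>powr_add_powr_le\<close>). For \<open>q = p/2 \<ge> \<alpha>\<close> the operators
  \<open>X\<^sup>q / \<rho>\<^bsup>q/\<alpha>\<^esup>\<close> and \<open>Z\<^sup>q / \<rho>\<^bsup>q/\<alpha>\<^esup>\<close> then still have sum at most \<open>1\<close>, since \<open>X\<^sup>\<alpha> / \<rho> \<le> 1\<close> makes its higher powers
  smaller. The inequality \<open>\<parallel>U V\<parallel> \<le> 1/4\<close> of Bhatia and Kittaneh for \<open>U, V \<ge> 0\<close> with \<open>U + V \<le> 1\<close> gives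
  \<open>\<parallel>X\<^sup>q Z\<^sup>q\<parallel> \<le> \<rho>\<^bsup>2q/\<alpha>\<^esup> / 4\<close>, which is the same as \<open>X\<^sup>p \<le> (\<rho>\<^bsup>4q/\<alpha>\<^esup> / 16) Z\<^sup>-\<^sup>p\<close>, and \<open>Z\<^sup>-\<^sup>p = (M m \<kappa>)\<^sup>-\<^sup>p Y\<^sup>p\<close>.

  Three steps need the top of the spectrum of a self-adjoint operator to behave like an eigenvalue:
  positivity of \<open>q(T)\<close> for polynomials \<open>q \<ge> 0\<close> on the spectrum (hence the functional calculus), the
  midpoint step in Ando's inequality, and the Bhatia-Kittaneh inequality. They share the lemma
  \<open>le_scalar_descent\<close>.
\<close>

section \<open>The real inner product and self-adjoint operators\<close>

text \<open>The real part of the inner product is a real inner product with the same norm. It suffices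
  for the operator order: for self-adjoint operators the form \<open>\<langle>T x, x\<rangle>\<close> is real.\<close>

definition rinner :: "'a::complex_inner_space \<Rightarrow> 'a \<Rightarrow> real" where
  "rinner x y = Re (cinner x y)"

lemma rinner_commute: "rinner x y = rinner y x"
  by (simp add: rinner_def cinner_commute [of x y])

lemma rinner_add_left: "rinner (x + y) z = rinner x z + rinner y z"
  by (simp add: rinner_def cinner_add_left)

lemma rinner_add_right: "rinner z (x + y) = rinner z x + rinner z y"
  by (simp add: rinner_def cinner_add_right)

lemma rinner_scaleR_left: "rinner (r *\<^sub>R x) z = r * rinner x z"
  by (simp add: rinner_def cinner_scaleC_left flip: scaleC_of_real)

lemma rinner_scaleR_right: "rinner z (r *\<^sub>R x) = r * rinner z x"
  by (metis rinner_commute rinner_scaleR_left)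

lemma rinner_minus_left: "rinner (- x) z = - rinner x z"
  using rinner_scaleR_left [of "-1" x z] by simp

lemma rinner_minus_right: "rinner z (- x) = - rinner z x"
  by (metis rinner_commute rinner_minus_left)

lemma rinner_diff_left: "rinner (x - y) z = rinner x z - rinner y z"
  using rinner_add_left [of x "- y" z] by (simp add: rinner_minus_left)

lemma rinner_diff_right: "rinner z (x - y) = rinner z x - rinner z y"
  by (metis rinner_commute rinner_diff_left)

lemma rinner_zero [simp]: "rinner 0 x = 0" "rinner x 0 = 0"
  using rinner_scaleR_left [of 0 x x] rinner_scaleR_right [of x 0 x] by simp_all

lemmas rinner_simps = rinner_add_left rinner_add_right rinner_diff_left rinner_diff_right
  rinner_minus_left rinner_minus_right rinner_scaleR_left rinner_scaleR_right

lemma rinner_self: "rinner x x = (norm x)\<^sup>2"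
  by (simp add: rinner_def cinner_self del: of_real_power)

lemma rinner_sum_left: "rinner (sum f I) y = (\<Sum>i\<in>I. rinner (f i) y)"
  by (induction I rule: infinite_finite_induct) (simp_all add: rinner_add_left)

lemma rinner_le_norm: "rinner x y \<le> norm x * norm y"
proof (cases "x = 0 \<or> y = 0")
  case False
  have "0 \<le> rinner (norm y *\<^sub>R x - norm x *\<^sub>R y) (norm y *\<^sub>R x - norm x *\<^sub>R y)"
    unfolding rinner_self by (rule zero_le_power2)
  also have "\<dots> = 2 * (norm x * norm y) * (norm x * norm y - rinner x y)"
    unfolding rinner_simps
    by (simp add: rinner_self rinner_commute [of y x] power2_eq_square algebra_simps)
  finally show ?thesis
    using False by (simp add: zero_le_mult_iff mult_le_0_iff)
qed auto

lemma abs_rinner_le_norm: "\<bar>rinner x y\<bar> \<le> norm x * norm y"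
  using rinner_le_norm [of x y] rinner_le_norm [of "- x" y] by (simp add: rinner_minus_left)

lemmas bop_rep_eqs = zero_bop.rep_eq one_bop.rep_eq plus_bop.rep_eq uminus_bop.rep_eq
  minus_bop.rep_eq times_bop.rep_eq scaleR_bop.rep_eq scaleC_bop.rep_eq

lemma bop_apply_linear [simp]:
  "bop_apply T 0 = 0" "bop_apply T (x + y) = bop_apply T x + bop_apply T y"
  "bop_apply T (x - y) = bop_apply T x - bop_apply T y" "bop_apply T (- x) = - bop_apply T x"
  "bop_apply T (r *\<^sub>R x) = r *\<^sub>R bop_apply T x"
proof -
  interpret T: bounded_linear "bop_apply T" by (rule bounded_linear_bop)
  show "bop_apply T 0 = 0" "bop_apply T (x + y) = bop_apply T x + bop_apply T y"
    "bop_apply T (x - y) = bop_apply T x - bop_apply T y" "bop_apply T (- x) = - bop_apply T x"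
    "bop_apply T (r *\<^sub>R x) = r *\<^sub>R bop_apply T x"
    by (simp_all add: T.zero T.add T.diff T.neg T.scaleR)
qed

lemma bop_apply_mult: "bop_apply (S * T) x = bop_apply S (bop_apply T x)"
  by (simp add: times_bop.rep_eq)

lemma norm_bop_apply: "norm (bop_apply T x) \<le> norm T * norm x"
  by (simp add: norm_bop.rep_eq onorm bounded_linear_bop)

lemma norm_bop_le: "0 \<le> b \<Longrightarrow> (\<And>x. norm (bop_apply T x) \<le> b * norm x) \<Longrightarrow> norm T \<le> b"
  by (simp add: norm_bop.rep_eq onorm_bound)

definition qform :: "'a::complex_inner_space bop \<Rightarrow> 'a \<Rightarrow> real" where
  "qform T x = rinner (bop_apply T x) x"

lemma qform_simps:
  "qform (S + T) x = qform S x + qform T x" "qform (S - T) x = qform S x - qform T x"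
  "qform (- T) x = - qform T x" "qform (r *\<^sub>R T) x = r * qform T x"
  "qform 0 x = 0" "qform 1 x = (norm x)\<^sup>2"
  by (simp_all add: qform_def bop_rep_eqs rinner_simps rinner_self)

lemma abs_qform_le: "\<bar>qform T x\<bar> \<le> norm T * (norm x)\<^sup>2"
proof -
  have "\<bar>qform T x\<bar> \<le> norm (bop_apply T x) * norm x"
    unfolding qform_def by (rule abs_rinner_le_norm)
  also have "\<dots> \<le> norm T * norm x * norm x"
    by (intro mult_right_mono norm_bop_apply) simp
  finally show ?thesis by (simp add: power2_eq_square)
qed

definition selfadj :: "'a::complex_inner_space bop \<Rightarrow> bool" where
  "selfadj T \<longleftrightarrow> (\<forall>x y. rinner (bop_apply T x) y = rinner x (bop_apply T y))"

lemma selfadjD: "selfadj T \<Longrightarrow> rinner (bop_apply T x) y = rinner x (bop_apply T y)"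
  by (simp add: selfadj_def)

lemma selfadj_intros [simp, intro]:
  "selfadj 0" "selfadj 1" "selfadj S \<Longrightarrow> selfadj T \<Longrightarrow> selfadj (S + T)"
  "selfadj S \<Longrightarrow> selfadj T \<Longrightarrow> selfadj (S - T)" "selfadj S \<Longrightarrow> selfadj (- S)"
  "selfadj S \<Longrightarrow> selfadj (r *\<^sub>R S)"
  by (simp_all add: selfadj_def bop_rep_eqs rinner_simps)

lemma selfadj_mult: "selfadj S \<Longrightarrow> selfadj T \<Longrightarrow> S * T = T * S \<Longrightarrow> selfadj (S * T)"
  unfolding selfadj_def by (metis times_bop.rep_eq)

lemma selfadj_conj: "selfadj S \<Longrightarrow> selfadj T \<Longrightarrow> selfadj (S * T * S)"
  unfolding selfadj_def by (metis times_bop.rep_eq)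

lemma selfadj_power: "selfadj T \<Longrightarrow> selfadj (T ^ n)"
  by (induction n) (auto intro: selfadj_mult simp: power_commutes)

lemma selfadj_sum: "(\<And>i. i \<in> I \<Longrightarrow> selfadj (f i)) \<Longrightarrow> selfadj (sum f I)"
  by (induction I rule: infinite_finite_induct) auto

text \<open>A sesquilinear form is determined by its diagonal, so a real diagonal makes the form
  Hermitian; conversely the imaginary part of the diagonal is recovered from the real inner
  product by pairing with \<open>\<i> x\<close>.\<close>

lemma positive_op_iff: "positive_op T \<longleftrightarrow> selfadj T \<and> (\<forall>x. 0 \<le> qform T x)"
proof
  assume pos: "positive_op T"
  then have nonneg: "0 \<le> qform T x" and real: "Im (cinner (bop_apply T x) x) = 0" for x
    by (auto simp: positive_op_def qform_def rinner_def complex_nonneg_Reals_iff)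
  have "rinner (bop_apply T x) y = rinner x (bop_apply T y)" for x y
  proof -
    have "Im (cinner (bop_apply T (x + \<i> *\<^sub>C y)) (x + \<i> *\<^sub>C y))
        = rinner (bop_apply T y) x - rinner (bop_apply T x) y"
      using real [of x] real [of y]
      by (simp add: cinner_add_left cinner_add_right bop_apply_scaleC cinner_scaleC_left
          cinner_scaleC_right rinner_def)
    then show ?thesis
      unfolding real by (simp add: rinner_commute [of x])
  qed
  with nonneg show "selfadj T \<and> (\<forall>x. 0 \<le> qform T x)"
    by (simp add: selfadj_def)
next
  assume T: "selfadj T \<and> (\<forall>x. 0 \<le> qform T x)"
  have "Im (cinner (bop_apply T x) x) = 0" for x
  proof -
    have "Re (cinner (bop_apply T x) (\<i> *\<^sub>C x)) = Re (cinner x (bop_apply T (\<i> *\<^sub>C x)))"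
      using T by (simp add: selfadj_def flip: rinner_def)
    then show ?thesis
      by (simp add: bop_apply_scaleC cinner_scaleC_right cinner_commute [of x])
  qed
  with T show "positive_op T"
    by (auto simp: positive_op_def qform_def rinner_def complex_nonneg_Reals_iff)
qed

lemma bop_le_iff: "X \<le> Y \<longleftrightarrow> selfadj (Y - X) \<and> (\<forall>x. qform X x \<le> qform Y x)"
  by (simp add: less_eq_bop_def positive_op_iff qform_simps)

lemma bop_leI:
  assumes "selfadj X" "selfadj Y" "\<And>x. qform X x \<le> qform Y x"
  shows "X \<le> Y"
  using assms by (auto simp: bop_le_iff)

lemma qform_mono: "X \<le> Y \<Longrightarrow> qform X x \<le> qform Y x"
  by (simp add: bop_le_iff)

lemma bop_nonneg_iff: "0 \<le> T \<longleftrightarrow> selfadj T \<and> (\<forall>x. 0 \<le> qform T x)"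
  by (simp add: bop_le_iff qform_simps)

lemma selfadj_of_nonneg: "0 \<le> T \<Longrightarrow> selfadj T"
  by (simp add: bop_nonneg_iff)

lemma bop_diff_nonneg_iff: "0 \<le> Y - X \<longleftrightarrow> X \<le> (Y :: 'a::complex_inner_space bop)"
  by (simp add: less_eq_bop_def)

instance bop :: (complex_inner_space) ordered_real_vector
proof
  fix X Y Z :: "'a bop" and a b :: real
  show "Z + X \<le> Z + Y" if "X \<le> Y"
    using that by (simp add: less_eq_bop_def)
  show "a *\<^sub>R X \<le> a *\<^sub>R Y" if "X \<le> Y" "0 \<le> a"
    using that by (auto simp: bop_le_iff qform_simps mult_left_mono simp flip: scaleR_diff_right)
  show "a *\<^sub>R X \<le> b *\<^sub>R X" if "a \<le> b" "0 \<le> X"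
    using that
    by (auto simp: bop_le_iff qform_simps mult_right_mono simp flip: scaleR_diff_left)
qed

lemma bop_zero_le_one [simp]: "0 \<le> (1 :: 'a::complex_inner_space bop)"
  by (simp add: bop_nonneg_iff qform_simps)

lemma selfadj_of_ge: "m *\<^sub>R 1 \<le> T \<Longrightarrow> selfadj T"
  using selfadj_intros(3) [of "T - m *\<^sub>R 1" "m *\<^sub>R 1"] by (simp add: bop_le_iff)

lemma selfadj_of_le: "T \<le> m *\<^sub>R 1 \<Longrightarrow> selfadj T"
  using selfadj_intros(4) [of "m *\<^sub>R 1" "m *\<^sub>R 1 - T"] by (simp add: bop_le_iff)

lemma selfadj_le_norm: "selfadj T \<Longrightarrow> T \<le> norm T *\<^sub>R 1"
  using abs_qform_le [of T] by (intro bop_leI) (simp_all add: qform_simps abs_le_iff)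

lemma scalar_bop_mono: "a \<le> b \<Longrightarrow> a *\<^sub>R 1 \<le> b *\<^sub>R (1 :: 'a::complex_inner_space bop)"
  by (rule scaleR_right_mono) auto

lemma qform_conj: "selfadj S \<Longrightarrow> qform (S * T * S) x = qform T (bop_apply S x)"
  by (simp add: qform_def bop_rep_eqs selfadjD)

lemma qform_square: "selfadj S \<Longrightarrow> qform (S * S) x = (norm (bop_apply S x))\<^sup>2"
  by (simp add: qform_def bop_rep_eqs selfadjD rinner_self)

lemma conj_mono:
  assumes "selfadj S" "X \<le> Y"
  shows "S * X * S \<le> S * Y * S"
proof -
  have "selfadj (S * (Y - X) * S)"
    using assms by (intro selfadj_conj) (simp_all add: bop_le_iff)
  then have "selfadj (S * Y * S - S * X * S)"
    by (simp add: algebra_simps)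
  then show ?thesis
    using assms by (simp add: bop_le_iff qform_conj)
qed

lemma square_nonneg: "selfadj S \<Longrightarrow> 0 \<le> S * S"
  by (simp add: bop_nonneg_iff qform_square selfadj_mult)

lemma norm_le_of_square_le:
  assumes "selfadj S" "S * S \<le> N\<^sup>2 *\<^sub>R 1" "0 \<le> N"
  shows "norm S \<le> N"
proof (rule norm_bop_le [OF \<open>0 \<le> N\<close>])
  fix x
  have "(norm (bop_apply S x))\<^sup>2 \<le> (N * norm x)\<^sup>2"
    using qform_mono [OF assms(2), of x] assms(1)
    by (simp add: qform_square qform_simps power_mult_distrib)
  then show "norm (bop_apply S x) \<le> N * norm x"
    by (rule power2_le_imp_le) (simp add: assms)
qed

text \<open>Evaluate the form of \<open>P\<close> at \<open>x - N\<^sup>-\<^sup>1 P x\<close>, where it is nonnegative.\<close>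

lemma norm_apply_le_qform:
  assumes "0 \<le> P" "P \<le> N *\<^sub>R 1" "0 < N"
  shows "(norm (bop_apply P x))\<^sup>2 \<le> N * qform P x"
proof -
  have P: "selfadj P" "\<And>y. 0 \<le> qform P y"
    using assms(1) by (simp_all add: bop_nonneg_iff)
  define y where "y = bop_apply P x"
  have "qform P y \<le> N * (norm y)\<^sup>2"
    using qform_mono [OF assms(2), of y] by (simp add: qform_simps)
  moreover have "0 \<le> N\<^sup>2 * qform P (x - (1 / N) *\<^sub>R y)"
    by (simp add: P)
  moreover have "N\<^sup>2 * qform P (x - (1 / N) *\<^sub>R y) = N\<^sup>2 * qform P x - 2 * N * (norm y)\<^sup>2 + qform P y"
  proof -
    have "rinner (bop_apply P y) x = (norm y)\<^sup>2"
      by (simp add: selfadjD [OF P(1)] y_def rinner_self)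
    moreover have "rinner (bop_apply P x) y = (norm y)\<^sup>2"
      by (simp add: y_def rinner_self)
    ultimately show ?thesis
      using \<open>0 < N\<close>
      by (simp add: qform_def rinner_simps right_diff_distrib)
        (simp add: field_simps power2_eq_square)
  qed
  ultimately have "N * (norm y)\<^sup>2 \<le> N * (N * qform P x)"
    by (simp add: power2_eq_square)
  then show ?thesis
    using \<open>0 < N\<close> by (simp add: y_def)
qed

text \<open>The previous estimate for \<open>S + N\<close>, which lies between \<open>0\<close> and \<open>2 N\<close>.\<close>

lemma norm_le_of_bounds:
  fixes S :: "'a::complex_inner_space bop"
  assumes "- (N *\<^sub>R 1) \<le> S" "S \<le> N *\<^sub>R 1" "0 \<le> N"
  shows "norm S \<le> N"
proof (cases "N = 0")
  case True
  with assms have "S \<le> 0" "0 \<le> S" by simp_all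
  then have "S = 0" by (rule order_antisym)
  with True show ?thesis by simp
next
  case False
  have S: "selfadj S" using assms(2) by (rule selfadj_of_le)
  show ?thesis
  proof (rule norm_bop_le [OF \<open>0 \<le> N\<close>])
    fix x
    have "0 \<le> S + N *\<^sub>R 1"
      using assms(1) by (metis neg_le_iff_le minus_minus diff_minus_eq_add bop_diff_nonneg_iff)
    moreover have "S + N *\<^sub>R 1 \<le> (2 * N) *\<^sub>R 1"
    proof -
      have "S + N *\<^sub>R 1 \<le> N *\<^sub>R 1 + N *\<^sub>R 1"
        using assms(2) by (rule add_right_mono)
      then show ?thesis by (simp flip: scaleR_add_left)
    qed
    ultimately have "(norm (bop_apply (S + N *\<^sub>R 1) x))\<^sup>2 \<le> 2 * N * qform (S + N *\<^sub>R 1) x"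
      using False assms(3) by (intro norm_apply_le_qform) auto
    also have "\<dots> = 2 * N * qform S x + 2 * N\<^sup>2 * (norm x)\<^sup>2"
      by (simp add: qform_simps power2_eq_square algebra_simps)
    finally have "(norm (bop_apply (S + N *\<^sub>R 1) x))\<^sup>2 \<le> 2 * N * qform S x + 2 * N\<^sup>2 * (norm x)\<^sup>2" .
    moreover have "(norm (bop_apply (S + N *\<^sub>R 1) x))\<^sup>2
        = (norm (bop_apply S x))\<^sup>2 + 2 * N * qform S x + N\<^sup>2 * (norm x)\<^sup>2"
      unfolding rinner_self [symmetric] bop_rep_eqs rinner_simps qform_def
      by (simp add: rinner_commute [of x "bop_apply S x"] power2_eq_square algebra_simps)
    ultimately have "(norm (bop_apply S x))\<^sup>2 \<le> (N * norm x)\<^sup>2"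
      by (simp add: power_mult_distrib)
    then show "norm (bop_apply S x) \<le> N * norm x"
      by (rule power2_le_imp_le) (simp add: assms)
  qed
qed

lemma qform_tendsto: "T \<longlonglongrightarrow> S \<Longrightarrow> (\<lambda>n. qform (T n) x) \<longlonglongrightarrow> qform S x"
proof -
  assume T: "T \<longlonglongrightarrow> S"
  show ?thesis
  proof (rule LIM_zero_cancel, rule tendsto_rabs_zero_cancel, rule real_tendsto_sandwich)
    show "\<forall>\<^sub>F n in sequentially. 0 \<le> \<bar>qform (T n) x - qform S x\<bar>" by simp
    show "\<forall>\<^sub>F n in sequentially. \<bar>qform (T n) x - qform S x\<bar> \<le> norm (T n - S) * (norm x)\<^sup>2"
      using abs_qform_le [of "T n - S" x for n] by (auto simp: qform_simps)
    show "(\<lambda>n. norm (T n - S) * (norm x)\<^sup>2) \<longlonglongrightarrow> 0"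
      using T by (auto intro!: tendsto_mult_left_zero tendsto_norm_zero LIM_zero)
  qed simp
qed

lemma rinner_apply_tendsto:
  "T \<longlonglongrightarrow> S \<Longrightarrow> (\<lambda>n. rinner (bop_apply (T n) x) y) \<longlonglongrightarrow> rinner (bop_apply S x) y"
proof -
  assume T: "T \<longlonglongrightarrow> S"
  show ?thesis
  proof (rule LIM_zero_cancel, rule tendsto_rabs_zero_cancel, rule real_tendsto_sandwich)
    show "\<forall>\<^sub>F n in sequentially. 0 \<le> \<bar>rinner (bop_apply (T n) x) y - rinner (bop_apply S x) y\<bar>"
      by simp
    have "\<bar>rinner (bop_apply (T n) x) y - rinner (bop_apply S x) y\<bar>
        \<le> norm (T n - S) * norm x * norm y" for n
    proof -
      have "\<bar>rinner (bop_apply (T n - S) x) y\<bar> \<le> norm (bop_apply (T n - S) x) * norm y"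
        by (rule abs_rinner_le_norm)
      also have "\<dots> \<le> norm (T n - S) * norm x * norm y"
        by (intro mult_right_mono norm_bop_apply) simp
      finally show ?thesis by (simp add: bop_rep_eqs rinner_simps)
    qed
    then show "\<forall>\<^sub>F n in sequentially. \<bar>rinner (bop_apply (T n) x) y - rinner (bop_apply S x) y\<bar>
        \<le> norm (T n - S) * norm x * norm y"
      by simp
    show "(\<lambda>n. norm (T n - S) * norm x * norm y) \<longlonglongrightarrow> 0"
      using T by (auto intro!: tendsto_mult_left_zero tendsto_norm_zero LIM_zero)
  qed simp
qed

lemma selfadj_limit:
  assumes "T \<longlonglongrightarrow> S" "\<And>n. selfadj (T n)"
  shows "selfadj S"
  unfolding selfadj_def
proof (intro allI)
  fix x y
  have "(\<lambda>n. rinner (bop_apply (T n) x) y) \<longlonglongrightarrow> rinner (bop_apply S x) y"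
    using assms(1) by (rule rinner_apply_tendsto)
  moreover have "rinner (bop_apply (T n) x) y = rinner (bop_apply (T n) y) x" for n
    using selfadjD [OF assms(2)] rinner_commute by metis
  then have "(\<lambda>n. rinner (bop_apply (T n) x) y) \<longlonglongrightarrow> rinner x (bop_apply S y)"
    using rinner_apply_tendsto [OF assms(1), of y x]
    by (simp only: rinner_commute [of x "bop_apply S y"])
  ultimately show "rinner (bop_apply S x) y = rinner x (bop_apply S y)"
    by (rule LIMSEQ_unique)
qed

lemma bop_nonneg_limit:
  fixes S :: "'a::complex_inner_space bop"
  assumes "T \<longlonglongrightarrow> S" "\<And>n. 0 \<le> T n"
  shows "0 \<le> S"
  using assms selfadj_limit [of T S]
  by (auto simp: bop_nonneg_iff intro: LIMSEQ_le_const [OF qform_tendsto])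

lemma qform_sum: "qform (sum f I) x = (\<Sum>i\<in>I. qform (f i) x)"
  by (induction I rule: infinite_finite_induct) (simp_all add: qform_simps)

text \<open>The least upper bound of the spectrum of a self-adjoint operator is an approximate
  eigenvalue. Hence an upper bound \<open>\<beta>\<close> for \<open>S\<close> can be lowered as long as \<open>\<beta> - S\<close> is bounded
  below, and if that is the case for all \<open>\<beta> > \<mu>\<close>, the descent only stops at \<open>\<mu>\<close>.\<close>

lemma le_scalar_descent:
  fixes S :: "'a::complex_inner_space bop"
  assumes S: "selfadj S"
    and step: "\<And>\<beta>. \<mu> < \<beta> \<Longrightarrow> S \<le> \<beta> *\<^sub>R 1 \<Longrightarrow>
      \<exists>\<kappa>>0. \<forall>x. \<kappa> * norm x \<le> norm (bop_apply (\<beta> *\<^sub>R 1 - S) x)"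
  shows "S \<le> \<mu> *\<^sub>R 1"
proof (rule ccontr)
  assume contra: "\<not> S \<le> \<mu> *\<^sub>R 1"
  define L where "L = {\<beta>. S \<le> \<beta> *\<^sub>R 1}"
  have "\<beta> > \<mu>" if "\<beta> \<in> L" for \<beta>
    using that contra scalar_bop_mono [of \<beta> \<mu>] unfolding L_def
    by (meson mem_Collect_eq not_le order_trans)
  then have bdd: "bdd_below L"
    by (meson bdd_below.I less_imp_le)
  have "norm S \<in> L"
    by (simp add: L_def S selfadj_le_norm)
  then have ne: "L \<noteq> {}" by auto
  \<comment> \<open>The infimum is attained, because each inequality between quadratic forms is closed.\<close>
  have "S \<le> Inf L *\<^sub>R 1"
  proof (rule bop_leI)
    fix x
    show "qform S x \<le> qform (Inf L *\<^sub>R 1) x"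
    proof (cases "x = 0")
      case False
      have "qform S x / (norm x)\<^sup>2 \<le> Inf L"
      proof (rule cInf_greatest [OF ne])
        fix \<beta> assume "\<beta> \<in> L"
        then have "qform S x \<le> \<beta> * (norm x)\<^sup>2"
          using qform_mono [of S "\<beta> *\<^sub>R 1" x] by (simp add: L_def qform_simps)
        then show "qform S x / (norm x)\<^sup>2 \<le> \<beta>"
          using False by (simp add: divide_simps)
      qed
      then show ?thesis
        using False by (simp add: divide_simps qform_simps)
    qed (simp add: qform_def)
  qed (use S in auto)
  then have Inf_mem: "Inf L \<in> L" and le: "S \<le> Inf L *\<^sub>R 1" by (simp_all add: L_def)
  have "Inf L > \<mu>" using Inf_mem \<open>\<And>\<beta>. \<beta> \<in> L \<Longrightarrow> \<beta> > \<mu>\<close> by blast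
  from step [OF this le] obtain \<kappa> where \<kappa>: "\<kappa> > 0"
    "\<And>x. \<kappa> * norm x \<le> norm (bop_apply (Inf L *\<^sub>R 1 - S) x)" by blast
  define P where "P = Inf L *\<^sub>R 1 - S"
  define N where "N = norm P + 1"
  have N: "N > 0" by (simp add: N_def add_nonneg_pos)
  have P: "0 \<le> P" using le by (simp add: P_def)
  have "P \<le> norm P *\<^sub>R 1" using P by (intro selfadj_le_norm selfadj_of_nonneg)
  also have "\<dots> \<le> N *\<^sub>R 1" by (rule scalar_bop_mono) (simp add: N_def)
  finally have PN: "P \<le> N *\<^sub>R 1" .
  \<comment> \<open>Being bounded below, \<open>P\<close> is even at least \<open>\<kappa>\<^sup>2 / N\<close>, so the infimum can be lowered.\<close>
  have "S \<le> (Inf L - \<kappa>\<^sup>2 / N) *\<^sub>R 1"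
  proof (rule bop_leI)
    fix x
    have "(\<kappa> * norm x)\<^sup>2 \<le> (norm (bop_apply P x))\<^sup>2"
      using \<kappa> by (intro power_mono) (auto simp: P_def)
    also have "\<dots> \<le> N * qform P x"
      by (rule norm_apply_le_qform [OF P PN N])
    finally have "\<kappa>\<^sup>2 / N * (norm x)\<^sup>2 \<le> qform P x"
      using N by (simp add: power_mult_distrib divide_simps mult.commute)
    then show "qform S x \<le> qform ((Inf L - \<kappa>\<^sup>2 / N) *\<^sub>R 1) x"
      by (simp add: P_def qform_simps algebra_simps)
  qed (use S in auto)
  then have "Inf L \<le> Inf L - \<kappa>\<^sup>2 / N"
    by (intro cInf_lower bdd) (simp add: L_def)
  moreover have "0 < \<kappa>\<^sup>2 / N" using \<kappa> N by simp
  ultimately show False by linarith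
qed

section \<open>Completeness and invertibility\<close>

instance complex_hilbert_space \<subseteq> banach ..

text \<open>The operators form a closed subspace of the space of bounded real-linear maps.\<close>

instance bop :: (complex_hilbert_space) banach
proof
  fix X :: "nat \<Rightarrow> 'a bop"
  assume X: "Cauchy X"
  define F where "F n = Blinfun (bop_apply (X n))" for n
  have F_apply: "blinfun_apply (F n) x = bop_apply (X n) x" for n x
    by (simp add: F_def bounded_linear_Blinfun_apply bounded_linear_bop)
  have F_dist: "dist (F i) (F j) = dist (X i) (X j)" for i j
  proof -
    have "blinfun_apply (F i - F j) = bop_apply (X i - X j)"
      by (simp add: fun_eq_iff blinfun.diff_left F_apply minus_bop.rep_eq)
    then show ?thesis
      by (simp add: dist_norm norm_blinfun.rep_eq norm_bop.rep_eq)
  qed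
  have "Cauchy F"
    using X by (simp add: Cauchy_def F_dist)
  then obtain L where L: "F \<longlonglongrightarrow> L"
    using Cauchy_convergent [of F] unfolding convergent_def by blast
  have L_apply: "(\<lambda>n. bop_apply (X n) x) \<longlonglongrightarrow> blinfun_apply L x" for x
    using blinfun.tendsto [OF L tendsto_const, of x] by (simp add: F_apply)
  have "blinfun_apply L (c *\<^sub>C x) = c *\<^sub>C blinfun_apply L x" for c x
  proof (rule LIMSEQ_unique [OF L_apply])
    have "bounded_linear (\<lambda>x::'a. c *\<^sub>C x)"
      by (rule bounded_linear_intro [where K = "cmod c"])
        (simp_all add: scaleC_add_right scaleC_scaleR_commute norm_scaleC mult.commute)
    from bounded_linear.tendsto [OF this L_apply]
    show "(\<lambda>n. bop_apply (X n) (c *\<^sub>C x)) \<longlonglongrightarrow> c *\<^sub>C blinfun_apply L x"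
      by (simp add: bop_apply_scaleC)
  qed
  then have Bop_L: "bop_apply (Bop (blinfun_apply L)) = blinfun_apply L"
    by (intro Bop_inverse) (simp add: blinfun.bounded_linear_right)
  have eq: "norm (X n - Bop (blinfun_apply L)) = norm (F n - L)" for n
  proof -
    have "blinfun_apply (F n - L) = bop_apply (X n - Bop (blinfun_apply L))"
      by (simp add: fun_eq_iff blinfun.diff_left F_apply minus_bop.rep_eq Bop_L)
    then show ?thesis
      by (simp add: norm_blinfun.rep_eq norm_bop.rep_eq)
  qed
  have "X \<longlonglongrightarrow> Bop (blinfun_apply L)"
    using L by (simp only: tendsto_iff dist_norm eq)
  then show "convergent X" by (auto simp: convergent_def)
qed

lemma inverse_op_unique: "S * T = 1 \<Longrightarrow> T * S = 1 \<Longrightarrow> inverse_op T = S"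
proof -
  assume S: "S * T = 1" "T * S = 1"
  have "R = S" if "R * T = 1" for R
  proof -
    have "R = R * (T * S)" by (simp add: S)
    also have "\<dots> = (R * T) * S" by (simp only: mult.assoc)
    finally show "R = S" by (simp add: that)
  qed
  with S show "inverse_op T = S"
    unfolding inverse_op_def by (intro the_equality conjI) blast+
qed

lemma invertible_opI: "S * T = 1 \<Longrightarrow> T * S' = 1 \<Longrightarrow> invertible_op T"
proof -
  assume S: "S * T = 1" "T * S' = 1"
  have "S = S * (T * S')" by (simp add: S)
  also have "\<dots> = (S * T) * S'" by (simp only: mult.assoc)
  finally have "S = S'" by (simp add: S)
  with S show "invertible_op T"
    unfolding invertible_op_def by auto
qed

text \<open>For \<open>c > 0\<close> small, \<open>1 - c T\<close> is a strict contraction, so \<open>R = (1 - c T) R + c\<close> has a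
  fixed point, which inverts \<open>T\<close> from the right; symmetrically from the left.\<close>

lemma invertible_of_ge:
  fixes T :: "'a::complex_hilbert_space bop"
  assumes T: "\<epsilon> *\<^sub>R 1 \<le> T" and "0 < \<epsilon>"
  shows "invertible_op T"
proof -
  define N where "N = norm T + \<epsilon>"
  have N: "N > 0" "\<epsilon> / N \<le> 1" using \<open>0 < \<epsilon>\<close> by (simp_all add: N_def add_nonneg_pos)
  have "T \<le> norm T *\<^sub>R 1" by (intro selfadj_le_norm selfadj_of_ge [OF T])
  also have "\<dots> \<le> N *\<^sub>R 1" by (rule scalar_bop_mono) (simp add: N_def less_imp_le \<open>0 < \<epsilon>\<close>)
  finally have TN: "T \<le> N *\<^sub>R 1" .
  define G where "G = 1 - (1 / N) *\<^sub>R T"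
  have "norm G \<le> 1 - \<epsilon> / N"
  proof (rule norm_le_of_bounds)
    show "G \<le> (1 - \<epsilon> / N) *\<^sub>R 1"
      using scaleR_left_mono [OF T, of "1 / N"] N by (simp add: G_def scaleR_diff_left)
    have "0 \<le> G"
      using scaleR_left_mono [OF TN, of "1 / N"] N by (simp add: G_def)
    moreover have "0 \<le> (1 - \<epsilon> / N) *\<^sub>R (1 :: 'a bop)"
      using N by (intro scaleR_nonneg_nonneg) auto
    ultimately show "- ((1 - \<epsilon> / N) *\<^sub>R 1) \<le> G"
      by (meson neg_le_0_iff_le order_trans)
  qed (use N in simp)
  moreover have "0 < \<epsilon> / N" using N \<open>0 < \<epsilon>\<close> by simp
  ultimately have G: "norm G < 1" by linarith
  have left: "dist (G * R + (1 / N) *\<^sub>R 1) (G * R' + (1 / N) *\<^sub>R 1) \<le> norm G * dist R R'"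
    and right: "dist (R * G + (1 / N) *\<^sub>R 1) (R' * G + (1 / N) *\<^sub>R 1) \<le> norm G * dist R R'" for R R'
    using norm_mult_ineq [of G "R - R'"] norm_mult_ineq [of "R - R'" G]
    by (simp_all add: dist_norm algebra_simps)
  obtain R where R: "G * R + (1 / N) *\<^sub>R 1 = R"
    using banach_fix_type [OF norm_ge_zero G, of "\<lambda>R. G * R + (1 / N) *\<^sub>R 1"] left by blast
  obtain R' where R': "R' * G + (1 / N) *\<^sub>R 1 = R'"
    using banach_fix_type [OF norm_ge_zero G, of "\<lambda>R. R * G + (1 / N) *\<^sub>R 1"] right by blast
  have "(1 / N) *\<^sub>R (T * R) = (1 / N) *\<^sub>R 1"
    using R by (simp add: G_def algebra_simps)
  moreover have "(1 / N) *\<^sub>R (R' * T) = (1 / N) *\<^sub>R 1"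
    using R' by (simp add: G_def algebra_simps)
  ultimately show ?thesis
    using N(1) by (intro invertible_opI [of R' T R]) simp_all
qed

lemma invertible_bounded_below:
  assumes "invertible_op T"
  shows "\<exists>\<kappa>>0. \<forall>x. \<kappa> * norm x \<le> norm (bop_apply T x)"
proof -
  obtain S where S: "S * T = 1"
    using assms by (auto simp: invertible_op_def)
  define N where "N = norm S + 1"
  have N: "N > 0" by (simp add: N_def add_nonneg_pos)
  have "1 / N * norm x \<le> norm (bop_apply T x)" for x
  proof -
    have "norm x = norm (bop_apply (S * T) x)"
      by (simp add: S one_bop.rep_eq)
    also have "\<dots> \<le> norm S * norm (bop_apply T x)"
      by (simp add: times_bop.rep_eq norm_bop_apply)
    also have "\<dots> \<le> N * norm (bop_apply T x)"
      by (intro mult_right_mono) (simp_all add: N_def)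
    finally show ?thesis using N by (simp add: field_simps)
  qed
  then show ?thesis
    using N by (intro exI [of _ "1 / N"]) simp
qed

section \<open>Polynomials of an operator and its spectrum\<close>

lemma scaleC_mult_left_bop: "(c *\<^sub>C S) * T = c *\<^sub>C (S * (T :: 'a::complex_inner_space bop))"
  by (rule bop_eqI) (simp add: bop_rep_eqs)

lemma scaleC_mult_right_bop: "S * (c *\<^sub>C T) = c *\<^sub>C (S * (T :: 'a::complex_inner_space bop))"
  by (rule bop_eqI) (simp add: bop_rep_eqs bop_apply_scaleC)

lemma scaleC_zero_left: "0 *\<^sub>C x = (0 :: 'a::complex_vector)"
  using scaleC_of_real [of 0 x] by simp

definition cpoly_op :: "complex poly \<Rightarrow> 'a::complex_inner_space bop \<Rightarrow> 'a bop" where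
  "cpoly_op q T = (\<Sum>i\<le>degree q. coeff q i *\<^sub>C T ^ i)"

lemma cpoly_op_0 [simp]: "cpoly_op 0 T = 0"
  by (simp add: cpoly_op_def scaleC_zero_left)

lemma cpoly_op_pCons: "cpoly_op (pCons a p) T = a *\<^sub>C 1 + T * cpoly_op p T"
proof (cases "p = 0")
  case True
  then show ?thesis
    by (simp add: cpoly_op_def scaleC_zero_left)
next
  case False
  then show ?thesis
    by (simp add: cpoly_op_def sum.atMost_Suc_shift sum_distrib_left scaleC_mult_right_bop
        del: sum.atMost_Suc)
qed

lemma cpoly_op_add: "cpoly_op (p + q) T = cpoly_op p T + cpoly_op q T"
  by (induction p q rule: poly_induct2) (simp_all add: cpoly_op_pCons scaleC_add_left algebra_simps)

lemma cpoly_op_smult: "cpoly_op (smult c p) T = c *\<^sub>C cpoly_op p T"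
  by (induction p)
    (simp_all add: cpoly_op_pCons scaleC_add_right scaleC_scaleC scaleC_mult_right_bop)

lemma cpoly_op_linear_factor:
  "cpoly_op ([:- z, 1:] * q) T = (T - z *\<^sub>C 1) * cpoly_op q T"
proof -
  have minus: "(- z) *\<^sub>C R = - (z *\<^sub>C R)" for R :: "'a bop"
    using scaleC_add_left [of "- z" z R]
    by (simp add: scaleC_zero_left eq_neg_iff_add_eq_0)
  have "[:- z, 1:] * q = smult (- z) q + pCons 0 q"
    by simp
  then have "cpoly_op ([:- z, 1:] * q) T = (- z) *\<^sub>C cpoly_op q T + T * cpoly_op q T"
    by (simp only: cpoly_op_add cpoly_op_smult cpoly_op_pCons scaleC_zero_left add_0_left)
  then show ?thesis
    by (simp add: minus scaleC_mult_left_bop left_diff_distrib)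
qed

lemma poly_op_0 [simp]: "poly_op 0 T = 0"
  by (simp add: poly_op_def)

lemma poly_op_pCons: "poly_op (pCons a p) T = a *\<^sub>R 1 + T * poly_op p T"
proof (cases "p = 0")
  case True
  then show ?thesis by (simp add: poly_op_def)
next
  case False
  then show ?thesis
    by (simp add: poly_op_def sum.atMost_Suc_shift sum_distrib_left del: sum.atMost_Suc)
qed

lemma poly_op_add: "poly_op (p + q) T = poly_op p T + poly_op q T"
  by (induction p q rule: poly_induct2) (simp_all add: poly_op_pCons scaleR_add_left algebra_simps)

lemma poly_op_smult: "poly_op (smult c p) T = c *\<^sub>R poly_op p T"
  by (induction p) (simp_all add: poly_op_pCons scaleR_add_right)

lemma poly_op_diff: "poly_op (p - q) T = poly_op p T - poly_op q T"
  using poly_op_add [of p "smult (- 1) q" T] poly_op_smult [of "- 1" q T] by simp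

lemma poly_op_mult: "poly_op (p * q) T = poly_op p T * poly_op q T"
  by (induction p)
    (simp_all add: poly_op_add poly_op_smult poly_op_pCons algebra_simps)

lemma cpoly_op_of_real: "cpoly_op (map_poly complex_of_real p) T = poly_op p T"
  by (induction p) (simp_all add: cpoly_op_pCons poly_op_pCons map_poly_pCons scaleC_of_real)

lemma selfadj_poly_op: "selfadj T \<Longrightarrow> selfadj (poly_op q T)"
  unfolding poly_op_def by (intro selfadj_sum selfadj_intros selfadj_power)

lemma invertible_op_mult:
  assumes "invertible_op S" "invertible_op T"
  shows "invertible_op (S * T)"
proof -
  obtain S' T' where inv: "S' * S = 1" "S * S' = 1" "T' * T = 1" "T * T' = 1"
    using assms by (auto simp: invertible_op_def)
  have "(T' * S') * (S * T) = T' * (S' * S) * T" "(S * T) * (T' * S') = S * (T * T') * S'"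
    by (simp_all only: mult.assoc)
  then show ?thesis
    using inv by (intro invertible_opI [of "T' * S'" _ "T' * S'"]) simp_all
qed

text \<open>One inclusion of the spectral mapping theorem: over \<open>\<complex>\<close> a polynomial splits into
  linear factors, and one of the factors \<open>T - z\<close> must fail to be invertible.\<close>

lemma root_in_spectrum:
  assumes "q \<noteq> 0" "\<not> invertible_op (cpoly_op q T)"
  shows "\<exists>z\<in>spectrum T. poly q z = 0"
  using assms
proof (induction "degree q" arbitrary: q)
  case 0
  then have "q = [:coeff q 0:]" "coeff q 0 \<noteq> 0"
    by (auto elim: degree_eq_zeroE)
  then obtain c where c: "q = [:c:]" "c \<noteq> 0" by blast
  have "invertible_op (cpoly_op q T)"
    by (rule invertible_opI [of "inverse c *\<^sub>C 1" _ "inverse c *\<^sub>C 1"])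
      (simp_all add: c cpoly_op_pCons scaleC_mult_left_bop scaleC_scaleC scaleC_of_real [of 1, simplified])
  with 0 show ?case by simp
next
  case (Suc n)
  have "\<not> constant (poly q)"
    using Suc.hyps by (simp add: constant_degree)
  then obtain z where z: "poly q z = 0"
    using fundamental_theorem_of_algebra by blast
  then obtain p where p: "q = [:- z, 1:] * p"
    by (auto simp: poly_eq_0_iff_dvd dvd_def)
  show ?case
  proof (cases "invertible_op (T - z *\<^sub>C 1)")
    case False
    then show ?thesis using z by (auto simp: spectrum_def)
  next
    case True
    have "p \<noteq> 0" using p Suc.prems by auto
    moreover from this have "degree p = n"
      using Suc.hyps unfolding p by (subst (asm) degree_mult_eq) auto
    moreover have "\<not> invertible_op (cpoly_op p T)"
      using Suc.prems True invertible_op_mult unfolding p cpoly_op_linear_factor by blast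
    ultimately show ?thesis
      using Suc.hyps(1) [of p] by (auto simp: p)
  qed
qed

definition real_spectrum :: "'a::complex_inner_space bop \<Rightarrow> real set" where
  "real_spectrum T = {t. complex_of_real t \<in> spectrum T}"

lemma real_spectrum_iff: "t \<in> real_spectrum T \<longleftrightarrow> \<not> invertible_op (T - t *\<^sub>R 1)"
  by (simp add: real_spectrum_def spectrum_def scaleC_of_real)

text \<open>With \<open>z = a + i b\<close> the product \<open>(T - z) (T - cnj z) = (T - a)\<^sup>2 + b\<^sup>2\<close> is at least \<open>b\<^sup>2\<close>, hence
  invertible when \<open>b \<noteq> 0\<close>; the two factors commute, so both are invertible.\<close>

lemma spectrum_selfadj_real:
  fixes T :: "'a::complex_hilbert_space bop"
  assumes T: "selfadj T" and z: "z \<in> spectrum T"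
  shows "z = complex_of_real (Re z)"
proof (rule ccontr)
  assume "z \<noteq> complex_of_real (Re z)"
  then have Im: "Im z \<noteq> 0" by (auto simp: complex_eq_iff)
  define Q where "Q = T - Re z *\<^sub>R 1"
  define J where "J = (\<i> * complex_of_real (Im z)) *\<^sub>C (1 :: 'a bop)"
  have J: "J * J = - ((Im z)\<^sup>2 *\<^sub>R 1)" "J * Q = Q * J"
  proof -
    have "J * J = complex_of_real (- ((Im z)\<^sup>2)) *\<^sub>C 1"
      by (simp add: J_def scaleC_mult_left_bop scaleC_scaleC power2_eq_square algebra_simps)
    then show "J * J = - ((Im z)\<^sup>2 *\<^sub>R 1)"
      by (simp only: scaleC_of_real scaleR_minus_left)
    show "J * Q = Q * J"
      by (simp add: J_def scaleC_mult_left_bop scaleC_mult_right_bop)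
  qed
  have "selfadj Q" using T by (auto simp: Q_def)
  then have "0 + (Im z)\<^sup>2 *\<^sub>R 1 \<le> Q * Q + (Im z)\<^sup>2 *\<^sub>R 1"
    by (intro add_right_mono square_nonneg)
  then have "invertible_op (Q * Q + (Im z)\<^sup>2 *\<^sub>R 1)"
    using Im by (intro invertible_of_ge [of "(Im z)\<^sup>2"]) simp_all
  then obtain R where R: "R * (Q * Q + (Im z)\<^sup>2 *\<^sub>R 1) = 1" "(Q * Q + (Im z)\<^sup>2 *\<^sub>R 1) * R = 1"
    by (auto simp: invertible_op_def)
  have "(Q + J) * (Q - J) = Q * Q + (Im z)\<^sup>2 *\<^sub>R 1" "(Q - J) * (Q + J) = Q * Q + (Im z)\<^sup>2 *\<^sub>R 1"
    by (simp_all add: algebra_simps J)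
  then have "R * (Q + J) * (Q - J) = 1" "(Q - J) * ((Q + J) * R) = 1"
    using R by (simp_all add: mult.assoc flip: mult.assoc [of "Q - J"])
  then have "invertible_op (Q - J)"
    by (rule invertible_opI)
  moreover have "Q - J = T - z *\<^sub>C 1"
  proof -
    have "z *\<^sub>C (1 :: 'a bop)
        = (complex_of_real (Re z) + \<i> * complex_of_real (Im z)) *\<^sub>C (1 :: 'a bop)"
      by (simp flip: complex_eq)
    then show ?thesis
      by (simp add: Q_def J_def scaleC_add_left scaleC_of_real algebra_simps)
  qed
  ultimately show False
    using z by (simp add: spectrum_def)
qed

text \<open>Scalar bounds confine the spectrum to the compact interval \<open>[m, M]\<close>, on which continuous functions
  can be approximated by polynomials.\<close>

definition bop_between :: "real \<Rightarrow> real \<Rightarrow> 'a::complex_inner_space bop \<Rightarrow> bool" where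
  "bop_between m M T \<longleftrightarrow> m *\<^sub>R 1 \<le> T \<and> T \<le> M *\<^sub>R 1"

lemma selfadj_between: "bop_between m M T \<Longrightarrow> selfadj T"
  by (auto simp: bop_between_def intro: selfadj_of_ge)

lemma invertible_op_uminus: "invertible_op (- T) \<Longrightarrow> invertible_op T"
  unfolding invertible_op_def
  by (metis minus_mult_minus minus_minus)

lemma real_spectrum_between:
  fixes T :: "'a::complex_hilbert_space bop"
  assumes "bop_between m M T"
  shows "real_spectrum T \<subseteq> {m..M}"
proof
  fix t assume "t \<in> real_spectrum T"
  then have t: "\<not> invertible_op (T - t *\<^sub>R 1)" by (simp add: real_spectrum_iff)
  have "\<not> t < m"
  proof
    assume "t < m"
    have "(m - t) *\<^sub>R 1 \<le> T - t *\<^sub>R 1"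
      using assms by (simp add: bop_between_def scaleR_diff_left)
    then have "invertible_op (T - t *\<^sub>R 1)"
      by (rule invertible_of_ge) (use \<open>t < m\<close> in simp)
    with t show False ..
  qed
  moreover have "\<not> M < t"
  proof
    assume "M < t"
    have "(t - M) *\<^sub>R 1 \<le> - (T - t *\<^sub>R 1)"
      using assms by (simp add: bop_between_def scaleR_diff_left)
    then have "invertible_op (- (T - t *\<^sub>R 1))"
      by (rule invertible_of_ge) (use \<open>M < t\<close> in simp)
    with t show False by (blast intro: invertible_op_uminus)
  qed
  ultimately show "t \<in> {m..M}" by simp
qed

text \<open>If the spectrum were empty, the descent could be continued below \<open>- \<parallel>T\<parallel>\<close>.\<close>

lemma real_spectrum_nonempty:
  fixes T :: "'a::complex_hilbert_space bop"
  assumes T: "selfadj T" and x: "(x :: 'a) \<noteq> 0"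
  shows "real_spectrum T \<noteq> {}"
proof
  assume empty: "real_spectrum T = {}"
  define \<mu> where "\<mu> = - norm T - 1"
  have "T \<le> \<mu> *\<^sub>R 1"
  proof (rule le_scalar_descent [OF T])
    fix \<beta>
    have "invertible_op (- (\<beta> *\<^sub>R 1 - T))"
      using empty real_spectrum_iff [of \<beta> T] by simp
    from invertible_bounded_below [OF invertible_op_uminus [OF this]]
    show "\<exists>\<kappa>>0. \<forall>x. \<kappa> * norm x \<le> norm (bop_apply (\<beta> *\<^sub>R 1 - T) x)" .
  qed
  then have "qform T x \<le> \<mu> * (norm x)\<^sup>2"
    using qform_mono by (fastforce simp: qform_simps)
  moreover have "- (norm T * (norm x)\<^sup>2) \<le> qform T x"
    using abs_qform_le [of T x] by linarith
  moreover have "\<mu> * (norm x)\<^sup>2 = - (norm T * (norm x)\<^sup>2) - (norm x)\<^sup>2"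
    by (simp add: \<mu>_def algebra_simps)
  moreover have "0 < (norm x)\<^sup>2" using x by simp
  ultimately show False by linarith
qed

text \<open>For \<open>\<beta> > 0\<close> the polynomial \<open>q + \<beta>\<close> has no zero on the spectrum, so \<open>q(T) + \<beta>\<close> is
  invertible and the descent applies to \<open>- q(T)\<close>.\<close>

lemma poly_op_nonneg:
  fixes T :: "'a::complex_hilbert_space bop"
  assumes T: "selfadj T" and nonneg: "\<And>t. t \<in> real_spectrum T \<Longrightarrow> 0 \<le> poly q t"
  shows "0 \<le> poly_op q T"
proof (cases "\<exists>x::'a. x \<noteq> 0")
  case False
  then have "poly_op q T = 0" by (intro bop_eqI) metis
  then show ?thesis by simp
next
  case True
  then obtain t\<^sub>0 where t0: "t\<^sub>0 \<in> real_spectrum T"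
    using real_spectrum_nonempty [OF T] by blast
  have "- poly_op q T \<le> 0 *\<^sub>R 1"
  proof (rule le_scalar_descent)
    show "selfadj (- poly_op q T)" using T by (intro selfadj_intros selfadj_poly_op)
    fix \<beta> :: real assume \<beta>: "0 < \<beta>"
    define p where "p = [:\<beta>:] + q"
    have p_pos: "0 < poly p t" if "t \<in> real_spectrum T" for t
      using nonneg [OF that] \<beta> by (simp add: p_def)
    have p_op: "poly_op p T = \<beta> *\<^sub>R 1 - - poly_op q T"
      by (simp add: p_def poly_op_add poly_op_pCons)
    have "invertible_op (poly_op p T)"
    proof (rule ccontr)
      assume "\<not> invertible_op (poly_op p T)"
      moreover have "map_poly complex_of_real p \<noteq> 0"
        using p_pos [OF t0] by (auto simp: map_poly_eq_0_iff)
      ultimately obtain z where z: "z \<in> spectrum T" "poly (map_poly complex_of_real p) z = 0"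
        using root_in_spectrum [of "map_poly complex_of_real p" T] by (auto simp: cpoly_op_of_real)
      have z_eq: "z = complex_of_real (Re z)"
        using spectrum_selfadj_real [OF T z(1)] .
      then have "Re z \<in> real_spectrum T"
        using z(1) by (simp add: real_spectrum_def)
      moreover have "poly (map_poly complex_of_real p) (complex_of_real t) = poly p t" for t
        by (induction p) (simp_all add: map_poly_pCons)
      then have "poly p (Re z) = 0"
        using z(2) z_eq by (metis of_real_eq_0_iff)
      ultimately show False using p_pos by fastforce
    qed
    then show "\<exists>\<kappa>>0. \<forall>x. \<kappa> * norm x \<le> norm (bop_apply (\<beta> *\<^sub>R 1 - - poly_op q T) x)"
      unfolding p_op by (rule invertible_bounded_below)
  qed
  then show ?thesis by simp
qed

text \<open>Apply positivity to the polynomial \<open>N\<^sup>2 - q\<^sup>2\<close>.\<close>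

lemma norm_poly_op_le:
  fixes T :: "'a::complex_hilbert_space bop"
  assumes T: "selfadj T" and bound: "\<And>t. t \<in> real_spectrum T \<Longrightarrow> \<bar>poly q t\<bar> \<le> N" and "0 \<le> N"
  shows "norm (poly_op q T) \<le> N"
proof (rule norm_le_of_square_le)
  have "0 \<le> poly_op ([:N\<^sup>2:] - q * q) T"
  proof (rule poly_op_nonneg [OF T])
    fix t assume "t \<in> real_spectrum T"
    from bound [OF this] show "0 \<le> poly ([:N\<^sup>2:] - q * q) t"
      using abs_le_square_iff [of "poly q t" N] \<open>0 \<le> N\<close> by (simp add: power2_eq_square)
  qed
  then show "poly_op q T * poly_op q T \<le> N\<^sup>2 *\<^sub>R 1"
    by (simp add: poly_op_diff poly_op_mult poly_op_pCons)
qed (use T \<open>0 \<le> N\<close> in \<open>auto intro: selfadj_poly_op\<close>)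

section \<open>The continuous functional calculus\<close>

text \<open>By the norm bound, any two sequences of polynomials approximating \<open>f\<close> on the spectrum give
  operators at distance tending to \<open>0\<close>. So the sequence is Cauchy and its limit is the unique one that
  the definition of the calculus asks for.\<close>

lemma func_calc_limit:
  fixes T :: "'a::complex_hilbert_space bop"
  assumes T: "selfadj T"
    and lim: "uniform_limit (real_spectrum T) (\<lambda>n. poly (q n)) f sequentially"
  shows "(\<lambda>n. poly_op (q n) T) \<longlonglongrightarrow> func_calc f T"
proof -
  have near: "\<exists>N. \<forall>i\<ge>N. \<forall>t\<in>real_spectrum T. \<bar>poly (q' i) t - f t\<bar> < \<epsilon> / 2"
    if "uniform_limit (real_spectrum T) (\<lambda>n. poly (q' n)) f sequentially" "0 < \<epsilon>"
    for q' :: "nat \<Rightarrow> real poly" and \<epsilon> :: real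
    using uniform_limitD [OF that(1), of "\<epsilon> / 2"] that(2)
    by (auto simp: eventually_sequentially dist_real_def)
  have close: "\<exists>N. \<forall>i\<ge>N. \<forall>j\<ge>N. norm (poly_op (q' i) T - poly_op (q j) T) \<le> \<epsilon>"
    if q': "uniform_limit (real_spectrum T) (\<lambda>n. poly (q' n)) f sequentially" and "0 < \<epsilon>"
    for q' :: "nat \<Rightarrow> real poly" and \<epsilon> :: real
  proof -
    obtain N\<^sub>1 where N1: "\<And>i t. i \<ge> N\<^sub>1 \<Longrightarrow> t \<in> real_spectrum T \<Longrightarrow> \<bar>poly (q' i) t - f t\<bar> < \<epsilon> / 2"
      using near [OF q' \<open>0 < \<epsilon>\<close>] by blast
    obtain N\<^sub>2 where N2: "\<And>i t. i \<ge> N\<^sub>2 \<Longrightarrow> t \<in> real_spectrum T \<Longrightarrow> \<bar>poly (q i) t - f t\<bar> < \<epsilon> / 2"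
      using near [OF lim \<open>0 < \<epsilon>\<close>] by blast
    have "norm (poly_op (q' i) T - poly_op (q j) T) \<le> \<epsilon>" if "i \<ge> N\<^sub>1" "j \<ge> N\<^sub>2" for i j
      unfolding poly_op_diff [symmetric]
    proof (rule norm_poly_op_le [OF T])
      fix t assume t: "t \<in> real_spectrum T"
      show "\<bar>poly (q' i - q j) t\<bar> \<le> \<epsilon>"
        using N1 [OF that(1) t] N2 [OF that(2) t] unfolding poly_diff by linarith
    qed (use \<open>0 < \<epsilon>\<close> in simp)
    then show ?thesis
      by (intro exI [of _ "max N\<^sub>1 N\<^sub>2"]) simp
  qed
  have "Cauchy (\<lambda>n. poly_op (q n) T)"
  proof (rule metric_CauchyI)
    fix \<epsilon> :: real assume "0 < \<epsilon>"
    then show "\<exists>N. \<forall>i\<ge>N. \<forall>j\<ge>N. dist (poly_op (q i) T) (poly_op (q j) T) < \<epsilon>"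
      using close [OF lim, of "\<epsilon> / 2"] unfolding dist_norm by fastforce
  qed
  then obtain L where L: "(\<lambda>n. poly_op (q n) T) \<longlonglongrightarrow> L"
    using Cauchy_convergent unfolding convergent_def by blast
  have L': "(\<lambda>n. poly_op (q' n) T) \<longlonglongrightarrow> L"
    if q': "uniform_limit (real_spectrum T) (\<lambda>n. poly (q' n)) f sequentially" for q'
  proof -
    have "(\<lambda>n. poly_op (q' n) T - poly_op (q n) T) \<longlonglongrightarrow> 0"
    proof (rule LIMSEQ_I)
      fix \<epsilon> :: real assume "0 < \<epsilon>"
      then obtain N where N: "\<forall>i\<ge>N. \<forall>j\<ge>N. norm (poly_op (q' i) T - poly_op (q j) T) \<le> \<epsilon> / 2"
        using close [OF q', of "\<epsilon> / 2"] by auto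
      have "norm (poly_op (q' i) T - poly_op (q i) T - 0) < \<epsilon>" if "i \<ge> N" for i
        using N [rule_format, OF that that] \<open>0 < \<epsilon>\<close> by simp
      then show "\<exists>N. \<forall>i\<ge>N. norm (poly_op (q' i) T - poly_op (q i) T - 0) < \<epsilon>" by blast
    qed
    from tendsto_add [OF this L] show ?thesis by simp
  qed
  have "func_calc f T = L"
    unfolding func_calc_def real_spectrum_def [symmetric]
  proof (rule the_equality)
    fix S assume "\<forall>q. uniform_limit (real_spectrum T) (\<lambda>n. poly (q n)) f sequentially \<longrightarrow>
      (\<lambda>n. poly_op (q n) T) \<longlonglongrightarrow> S"
    then have "(\<lambda>n. poly_op (q n) T) \<longlonglongrightarrow> S" using lim by blast
    then show "S = L" using L by (rule LIMSEQ_unique)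
  qed (use L' in blast)
  then show ?thesis using L by simp
qed

lemma func_calc_tendsto:
  fixes T :: "'a::complex_hilbert_space bop"
  assumes "bop_between m M T" "uniform_limit {m..M} (\<lambda>n. poly (q n)) f sequentially"
  shows "(\<lambda>n. poly_op (q n) T) \<longlonglongrightarrow> func_calc f T"
  using func_calc_limit [OF selfadj_between [OF assms(1)]]
    uniform_limit_on_subset [OF assms(2) real_spectrum_between [OF assms(1)]] by blast

text \<open>Weierstrass approximation from above; the one-sidedness makes the calculus monotone.\<close>

lemma poly_approx_above:
  fixes f :: "real \<Rightarrow> real"
  assumes "continuous_on {m..M} f"
  shows "\<exists>q. (\<forall>n. \<forall>t\<in>{m..M}. f t \<le> poly (q n) t)
    \<and> uniform_limit {m..M} (\<lambda>n. poly (q n)) f sequentially"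
proof -
  have "\<exists>q. \<forall>t\<in>{m..M}. f t \<le> poly q t \<and> poly q t \<le> f t + 2 / real (Suc n)" for n
  proof -
    obtain g where g: "real_polynomial_function g"
      "\<And>t. t \<in> {m..M} \<Longrightarrow> \<bar>f t - g t\<bar> < 1 / real (Suc n)"
      using Stone_Weierstrass_real_polynomial_function [OF _ assms, of "1 / real (Suc n)"] by auto
    obtain a k where ak: "g = (\<lambda>x. \<Sum>i\<le>k. a i * x ^ i)"
      using g(1) by (auto simp: real_polynomial_function_iff_sum)
    define q where "q = (\<Sum>i\<le>k. monom (a i) i) + [:1 / real (Suc n):]"
    have "poly q t = g t + 1 / real (Suc n)" for t
      by (simp add: q_def ak poly_sum poly_monom)
    moreover have "2 / real (Suc n) = 1 / real (Suc n) + 1 / real (Suc n)" by simp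
    ultimately have "f t \<le> poly q t \<and> poly q t \<le> f t + 2 / real (Suc n)" if "t \<in> {m..M}" for t
      using g(2) [OF that] unfolding abs_less_iff by (simp del: of_nat_Suc)
    then show ?thesis by blast
  qed
  then obtain q where q: "\<And>n t. t \<in> {m..M} \<Longrightarrow> f t \<le> poly (q n) t \<and> poly (q n) t \<le> f t + 2 / real (Suc n)"
    by metis
  have "uniform_limit {m..M} (\<lambda>n. poly (q n)) f sequentially"
  proof (rule uniform_limitI)
    fix \<epsilon> :: real assume "0 < \<epsilon>"
    have "(\<lambda>n. 2 / real (Suc n)) \<longlonglongrightarrow> 0"
      using tendsto_mult [OF tendsto_const [of 2] LIMSEQ_inverse_real_of_nat]
      by (simp add: divide_inverse)
    then have "\<forall>\<^sub>F n in sequentially. 2 / real (Suc n) < \<epsilon>"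
      using \<open>0 < \<epsilon>\<close> by (rule order_tendstoD)
    then show "\<forall>\<^sub>F n in sequentially. \<forall>t\<in>{m..M}. dist (poly (q n) t) (f t) < \<epsilon>"
    proof (rule eventually_mono)
      fix n assume n: "2 / real (Suc n) < \<epsilon>"
      show "\<forall>t\<in>{m..M}. dist (poly (q n) t) (f t) < \<epsilon>"
      proof
        fix t assume "t \<in> {m..M}"
        from q [OF this, of n] n show "dist (poly (q n) t) (f t) < \<epsilon>"
          unfolding dist_real_def by linarith
      qed
    qed
  qed
  then show ?thesis using q by blast
qed

lemma poly_approx:
  fixes f :: "real \<Rightarrow> real"
  assumes "continuous_on {m..M} f"
  obtains q where "uniform_limit {m..M} (\<lambda>n. poly (q n)) f sequentially"
  using poly_approx_above [OF assms] by blast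

context
  fixes m M :: real and T :: "'a::complex_hilbert_space bop"
  assumes T: "bop_between m M T"
begin

lemma func_calc_nonneg:
  assumes f: "continuous_on {m..M} f" and nonneg: "\<And>t. t \<in> {m..M} \<Longrightarrow> 0 \<le> f t"
  shows "0 \<le> func_calc f T"
proof -
  obtain q where q: "\<And>n t. t \<in> {m..M} \<Longrightarrow> f t \<le> poly (q n) t"
    "uniform_limit {m..M} (\<lambda>n. poly (q n)) f sequentially"
    using poly_approx_above [OF f] by blast
  show ?thesis
  proof (rule bop_nonneg_limit [OF func_calc_tendsto [OF T q(2)]])
    fix n
    show "0 \<le> poly_op (q n) T"
      using real_spectrum_between [OF T] nonneg q(1)
      by (intro poly_op_nonneg selfadj_between [OF T]) (meson order_trans subsetD)
  qed
qed

lemma func_calc_add: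
  assumes f: "continuous_on {m..M} f" and g: "continuous_on {m..M} g"
  shows "func_calc (\<lambda>t. f t + g t) T = func_calc f T + func_calc g T"
proof -
  obtain p where p: "uniform_limit {m..M} (\<lambda>n. poly (p n)) f sequentially"
    using poly_approx [OF f] .
  obtain q where q: "uniform_limit {m..M} (\<lambda>n. poly (q n)) g sequentially"
    using poly_approx [OF g] .
  have "(\<lambda>n. poly (p n + q n)) = (\<lambda>n t. poly (p n) t + poly (q n) t)"
    by (intro ext) simp
  then have "uniform_limit {m..M} (\<lambda>n. poly (p n + q n)) (\<lambda>t. f t + g t) sequentially"
    using uniform_limit_add [OF p q] by simp
  from func_calc_tendsto [OF T this]
  have "(\<lambda>n. poly_op (p n) T + poly_op (q n) T) \<longlonglongrightarrow> func_calc (\<lambda>t. f t + g t) T"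
    by (simp add: poly_op_add)
  then show ?thesis
    by (rule LIMSEQ_unique)
      (intro tendsto_add func_calc_tendsto [OF T p] func_calc_tendsto [OF T q])
qed

lemma func_calc_mult:
  assumes f: "continuous_on {m..M} f" and g: "continuous_on {m..M} g"
  shows "func_calc (\<lambda>t. f t * g t) T = func_calc f T * func_calc g T"
proof -
  obtain p where p: "uniform_limit {m..M} (\<lambda>n. poly (p n)) f sequentially"
    using poly_approx [OF f] .
  obtain q where q: "uniform_limit {m..M} (\<lambda>n. poly (q n)) g sequentially"
    using poly_approx [OF g] .
  have "bounded (f ` {m..M})" "bounded (g ` {m..M})"
    using f g by (auto intro!: compact_imp_bounded compact_continuous_image)
  moreover have "(\<lambda>n. poly (p n * q n)) = (\<lambda>n t. poly (p n) t * poly (q n) t)"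
    by (intro ext) simp
  ultimately have "uniform_limit {m..M} (\<lambda>n. poly (p n * q n)) (\<lambda>t. f t * g t) sequentially"
    using uniform_lim_mult [OF p q] by simp
  from func_calc_tendsto [OF T this]
  have "(\<lambda>n. poly_op (p n) T * poly_op (q n) T) \<longlonglongrightarrow> func_calc (\<lambda>t. f t * g t) T"
    by (simp add: poly_op_mult)
  then show ?thesis
    by (rule LIMSEQ_unique)
      (intro tendsto_mult func_calc_tendsto [OF T p] func_calc_tendsto [OF T q])
qed

lemma func_calc_poly: "func_calc (poly q) T = poly_op q T"
proof -
  have "(\<lambda>n::nat. poly_op q T) \<longlonglongrightarrow> func_calc (poly q) T"
    by (rule func_calc_tendsto [OF T]) (rule uniform_limit_const)
  then show ?thesis
    by (simp add: LIMSEQ_const_iff)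
qed

lemma func_calc_const: "func_calc (\<lambda>_. c) T = c *\<^sub>R 1"
proof -
  have "poly [:c:] = (\<lambda>_. c)" by (rule ext) simp
  then show ?thesis
    using func_calc_poly [of "[:c:]"] by (simp add: poly_op_pCons)
qed

lemma func_calc_id: "func_calc (\<lambda>t. t) T = T"
proof -
  have "poly [:0, 1:] = (\<lambda>t::real. t)" by (rule ext) simp
  then show ?thesis
    using func_calc_poly [of "[:0, 1:]"] by (simp add: poly_op_pCons)
qed

lemma func_calc_cmult:
  assumes "continuous_on {m..M} f"
  shows "func_calc (\<lambda>t. c * f t) T = c *\<^sub>R func_calc f T"
  using func_calc_mult [OF continuous_on_const assms, of c] by (simp add: func_calc_const)

lemma func_calc_diff:
  assumes f: "continuous_on {m..M} f" and g: "continuous_on {m..M} g"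
  shows "func_calc (\<lambda>t. f t - g t) T = func_calc f T - func_calc g T"
  using func_calc_add [OF f continuous_on_mult [OF continuous_on_const g], of "- 1"]
    func_calc_cmult [OF g, of "- 1"] by simp

lemma func_calc_mono:
  assumes f: "continuous_on {m..M} f" and g: "continuous_on {m..M} g"
    and le: "\<And>t. t \<in> {m..M} \<Longrightarrow> f t \<le> g t"
  shows "func_calc f T \<le> func_calc g T"
  using func_calc_nonneg [OF continuous_on_diff [OF g f]] le by (simp add: func_calc_diff [OF g f])

lemma func_calc_cong:
  assumes f: "continuous_on {m..M} f" and eq: "\<And>t. t \<in> {m..M} \<Longrightarrow> f t = g t"
  shows "func_calc f T = func_calc g T"
proof -
  have "continuous_on {m..M} g"
    using f eq by (rule continuous_on_eq)
  then show ?thesis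
    using f eq by (intro order_antisym func_calc_mono) simp_all
qed

lemma func_calc_between:
  assumes f: "continuous_on {m..M} f" and mem: "\<And>t. t \<in> {m..M} \<Longrightarrow> f t \<in> {a..b}"
  shows "bop_between a b (func_calc f T)"
  unfolding bop_between_def func_calc_const [symmetric]
  using f mem by (auto intro!: func_calc_mono)

lemma norm_func_calc_le:
  assumes f: "continuous_on {m..M} f" and bound: "\<And>t. t \<in> {m..M} \<Longrightarrow> \<bar>f t\<bar> \<le> N" and "0 \<le> N"
  shows "norm (func_calc f T) \<le> N"
proof -
  have "bop_between (- N) N (func_calc f T)"
  proof (rule func_calc_between [OF f])
    show "f t \<in> {- N..N}" if "t \<in> {m..M}" for t
      using bound [OF that] by (simp add: abs_le_iff)
  qed
  then show ?thesis
    using \<open>0 \<le> N\<close> by (intro norm_le_of_bounds) (auto simp: bop_between_def)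
qed

lemma func_calc_uniform_limit:
  assumes lim: "uniform_limit {m..M} f g sequentially"
    and f: "\<And>n. continuous_on {m..M} (f n)" and g: "continuous_on {m..M} g"
  shows "(\<lambda>n. func_calc (f n) T) \<longlonglongrightarrow> func_calc g T"
proof (rule metric_LIMSEQ_I)
  fix \<epsilon> :: real assume "0 < \<epsilon>"
  then obtain N where N: "\<And>n t. n \<ge> N \<Longrightarrow> t \<in> {m..M} \<Longrightarrow> dist (f n t) (g t) < \<epsilon> / 2"
    using uniform_limitD [OF lim, of "\<epsilon> / 2"] unfolding eventually_sequentially by (meson half_gt_zero)
  have "dist (func_calc (f n) T) (func_calc g T) < \<epsilon>" if "n \<ge> N" for n
  proof -
    have "norm (func_calc (\<lambda>t. f n t - g t) T) \<le> \<epsilon> / 2"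
      using N [OF that] \<open>0 < \<epsilon>\<close>
      by (intro norm_func_calc_le continuous_on_diff f g) (auto simp: dist_real_def intro: less_imp_le)
    then show ?thesis
      using \<open>0 < \<epsilon>\<close> by (simp add: func_calc_diff [OF f g] dist_norm)
  qed
  then show "\<exists>N. \<forall>n\<ge>N. dist (func_calc (f n) T) (func_calc g T) < \<epsilon>" by blast
qed

lemma func_calc_poly_compose:
  assumes g: "continuous_on {m..M} g"
  shows "poly_op q (func_calc g T) = func_calc (\<lambda>t. poly q (g t)) T"
proof (induction q)
  case 0
  then show ?case by (simp add: func_calc_const)
next
  case (pCons a q)
  have q: "continuous_on {m..M} (\<lambda>t. poly q (g t))"
    by (intro continuous_intros g)
  show ?case
    by (simp add: poly_op_pCons pCons.IH func_calc_add func_calc_mult func_calc_const g q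
        continuous_on_mult)
qed

lemma func_calc_compose:
  assumes g: "continuous_on {m..M} g" and mem: "\<And>t. t \<in> {m..M} \<Longrightarrow> g t \<in> {a..b}"
    and f: "continuous_on {a..b} f"
  shows "func_calc f (func_calc g T) = func_calc (\<lambda>t. f (g t)) T"
proof -
  obtain q where q: "uniform_limit {a..b} (\<lambda>n. poly (q n)) f sequentially"
    using poly_approx [OF f] .
  have "(\<lambda>n. poly_op (q n) (func_calc g T)) \<longlonglongrightarrow> func_calc f (func_calc g T)"
    by (rule func_calc_tendsto [OF func_calc_between [OF g mem] q])
  moreover have "(\<lambda>n. poly_op (q n) (func_calc g T)) \<longlonglongrightarrow> func_calc (\<lambda>t. f (g t)) T"
    unfolding func_calc_poly_compose [OF g]
  proof (rule func_calc_uniform_limit)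
    show "uniform_limit {m..M} (\<lambda>n t. poly (q n) (g t)) (\<lambda>t. f (g t)) sequentially"
      using uniform_limit_compose' [OF q] mem by blast
    show "continuous_on {m..M} (\<lambda>t. f (g t))"
      using continuous_on_compose2 [OF f g] mem by blast
  qed (intro continuous_intros g)
  ultimately show ?thesis by (rule LIMSEQ_unique)
qed

end

section \<open>Real powers of strictly positive operators\<close>

text \<open>For self-adjoint operators this amounts to being positive and invertible; it is the domain on
  which every real power is given by the functional calculus of a continuous function.\<close>

definition spos :: "'a::complex_inner_space bop \<Rightarrow> bool" where
  "spos T \<longleftrightarrow> (\<exists>m>0. m *\<^sub>R 1 \<le> T)"

lemma sposI: "0 < m \<Longrightarrow> m *\<^sub>R 1 \<le> T \<Longrightarrow> spos T"
  by (auto simp: spos_def)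

lemma spos_between: "0 < m \<Longrightarrow> bop_between m M T \<Longrightarrow> spos T"
  by (auto simp: spos_def bop_between_def)

lemma spos_mono: "spos S \<Longrightarrow> S \<le> T \<Longrightarrow> spos T"
  unfolding spos_def using order_trans by blast

lemma sposE:
  assumes "spos T"
  obtains m M where "0 < m" "bop_between m M T"
proof -
  obtain m where m: "0 < m" "m *\<^sub>R 1 \<le> T"
    using assms by (auto simp: spos_def)
  have "T \<le> norm T *\<^sub>R 1"
    by (rule selfadj_le_norm [OF selfadj_of_ge [OF m(2)]])
  with m show ?thesis
    using that [of m "norm T"] by (simp add: bop_between_def)
qed

lemma spos_selfadj: "spos T \<Longrightarrow> selfadj T"
  by (auto simp: spos_def intro: selfadj_of_ge)

lemma spos_nonneg: "spos T \<Longrightarrow> 0 \<le> T"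
proof (erule sposE)
  fix m M assume "0 < m" "bop_between m M T"
  then have "0 \<le> m *\<^sub>R (1 :: 'a bop)" "m *\<^sub>R 1 \<le> T"
    by (auto simp: bop_between_def intro: scaleR_nonneg_nonneg)
  then show "0 \<le> T" by (rule order_trans)
qed

lemma spos_scaleR: "spos T \<Longrightarrow> 0 < c \<Longrightarrow> spos (c *\<^sub>R T)"
proof (erule sposE)
  fix m M assume "0 < c" "0 < m" "bop_between m M T"
  then have "(c * m) *\<^sub>R 1 \<le> c *\<^sub>R T"
    using scaleR_left_mono [of "m *\<^sub>R 1" T c] by (simp add: bop_between_def)
  with \<open>0 < c\<close> \<open>0 < m\<close> show "spos (c *\<^sub>R T)" by (intro sposI [of "c * m"]) auto
qed

lemma continuous_on_powr_pos [continuous_intros]: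
  "0 < (m::real) \<Longrightarrow> continuous_on {m..M} (\<lambda>t. t powr a)"
  by (intro continuous_intros) auto

lemma powr_mem_interval:
  assumes "0 < m" "t \<in> {m..M}"
  shows "t powr a \<in> {min (m powr a) (M powr a)..max (m powr a) (M powr a :: real)}"
proof (cases "0 \<le> a")
  case True
  then have "m powr a \<le> t powr a" "t powr a \<le> M powr a"
    using assms by (auto intro!: powr_mono2)
  then show ?thesis by (simp add: min_le_iff_disj le_max_iff_disj)
next
  case False
  then have "t powr a \<le> m powr a" "M powr a \<le> t powr a"
    using assms by (auto intro!: powr_mono2')
  then show ?thesis by (simp add: min_le_iff_disj le_max_iff_disj)
qed

lemma op_powr_between:
  fixes T :: "'a::complex_hilbert_space bop"
  assumes "0 < m" "bop_between m M T"
  shows "bop_between (min (m powr a) (M powr a)) (max (m powr a) (M powr a)) (T powr\<^sub>o a)"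
  unfolding op_powr_def
  by (rule func_calc_between [OF assms(2)])
    (intro continuous_on_powr_pos powr_mem_interval assms(1); assumption)+

text \<open>On the zero space the inequality \<open>m \<le> T \<le> M\<close> says nothing about \<open>m\<close> and \<open>M\<close>, but there all
  operators coincide.\<close>

lemma between_imp_le_or_trivial:
  fixes T :: "'a::complex_inner_space bop"
  assumes "bop_between m M T"
  shows "m \<le> M \<or> (\<forall>S R :: 'a bop. S = R)"
proof (rule ccontr)
  assume "\<not> ?thesis"
  then obtain S R :: "'a bop" where "M < m" "S \<noteq> R" by auto
  then obtain x :: 'a where x: "x \<noteq> 0"
    by (metis bop_eqI bop_apply_linear(1))
  have "m *\<^sub>R 1 \<le> M *\<^sub>R (1 :: 'a bop)"
    using assms unfolding bop_between_def by (auto intro: order_trans)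
  then have "m * (norm x)\<^sup>2 \<le> M * (norm x)\<^sup>2"
    using qform_mono [of "m *\<^sub>R 1" "M *\<^sub>R 1" x] by (simp add: qform_simps)
  with x \<open>M < m\<close> show False by simp
qed

lemma spos_powr:
  fixes T :: "'a::complex_hilbert_space bop"
  assumes "spos T"
  shows "spos (T powr\<^sub>o a)"
proof -
  obtain m M where m: "0 < m" "bop_between m M T"
    using sposE [OF assms] .
  show ?thesis
  proof (cases "m \<le> M")
    case True
    then show ?thesis
      using spos_between [OF _ op_powr_between [OF m]] m by (simp add: min_def)
  next
    case False
    then have "T powr\<^sub>o a = 1" using between_imp_le_or_trivial [OF m(2)] by blast
    then show ?thesis by (auto intro: sposI [of 1])
  qed
qed

lemma selfadj_powr:
  fixes T :: "'a::complex_hilbert_space bop"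
  shows "spos T \<Longrightarrow> selfadj (T powr\<^sub>o a)"
  by (intro spos_selfadj spos_powr)

lemma op_powr_add:
  fixes T :: "'a::complex_hilbert_space bop"
  assumes "spos T"
  shows "T powr\<^sub>o a * T powr\<^sub>o b = T powr\<^sub>o (a + b)"
proof -
  obtain m M where m: "0 < m" "bop_between m M T"
    using sposE [OF assms] .
  then show ?thesis
    unfolding op_powr_def powr_add
    by (intro func_calc_mult [symmetric] continuous_on_powr_pos)
qed

lemma op_powr_zero [simp]:
  fixes T :: "'a::complex_hilbert_space bop"
  assumes "spos T"
  shows "T powr\<^sub>o 0 = 1"
proof -
  obtain m M where m: "0 < m" "bop_between m M T"
    using sposE [OF assms] .
  have "T powr\<^sub>o 0 = func_calc (\<lambda>_. 1) T"
    unfolding op_powr_def using m by (intro func_calc_cong [OF m(2)] continuous_on_powr_pos) auto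
  then show ?thesis by (simp add: func_calc_const [OF m(2)])
qed

lemma op_powr_one [simp]:
  fixes T :: "'a::complex_hilbert_space bop"
  assumes "spos T"
  shows "T powr\<^sub>o 1 = T"
proof -
  obtain m M where m: "0 < m" "bop_between m M T"
    using sposE [OF assms] .
  have "T powr\<^sub>o 1 = func_calc (\<lambda>t. t) T"
    unfolding op_powr_def using m by (intro func_calc_cong [OF m(2)] continuous_on_powr_pos) auto
  then show ?thesis by (simp add: func_calc_id [OF m(2)])
qed

lemma op_powr_cancel [simp]:
  fixes T :: "'a::complex_hilbert_space bop"
  assumes "spos T"
  shows "T powr\<^sub>o a * T powr\<^sub>o (- a) = 1" "T powr\<^sub>o (- a) * T powr\<^sub>o a = 1"
    "T powr\<^sub>o a * (T powr\<^sub>o (- a) * R) = R" "T powr\<^sub>o (- a) * (T powr\<^sub>o a * R) = R"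
  using assms by (simp_all add: op_powr_add flip: mult.assoc)

lemma inverse_op_eq_powr:
  fixes T :: "'a::complex_hilbert_space bop"
  assumes "spos T"
  shows "inverse_op T = T powr\<^sub>o (- 1)"
  using op_powr_cancel(1,2) [OF assms, of 1] assms by (intro inverse_op_unique) simp_all

lemma mult_inverse_op:
  fixes T :: "'a::complex_hilbert_space bop"
  assumes "spos T"
  shows "T * inverse_op T = 1" "inverse_op T * T = 1"
  using op_powr_cancel(1,2) [OF assms, of 1] assms by (simp_all add: inverse_op_eq_powr)

lemma spos_inverse_op:
  fixes T :: "'a::complex_hilbert_space bop"
  shows "spos T \<Longrightarrow> spos (inverse_op T)"
  by (simp add: inverse_op_eq_powr spos_powr)

lemma op_powr_powr:
  fixes T :: "'a::complex_hilbert_space bop"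
  assumes "spos T"
  shows "(T powr\<^sub>o a) powr\<^sub>o b = T powr\<^sub>o (a * b)"
proof -
  obtain m M where m: "0 < m" "bop_between m M T"
    using sposE [OF assms] .
  show ?thesis
  proof (cases "m \<le> M")
    case True
    define l where "l = min (m powr a) (M powr a)"
    have "0 < l" using True m by (simp add: l_def)
    have "(T powr\<^sub>o a) powr\<^sub>o b = func_calc (\<lambda>t. (t powr a) powr b) T"
      unfolding op_powr_def
    proof (rule func_calc_compose [OF m(2)])
      show "continuous_on {l..max (m powr a) (M powr a)} (\<lambda>t. t powr b)"
        using \<open>0 < l\<close> by (rule continuous_on_powr_pos)
      fix t assume "t \<in> {m..M}"
      then show "t powr a \<in> {l..max (m powr a) (M powr a)}"
        unfolding l_def by (rule powr_mem_interval [OF m(1)])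
    qed (use m(1) in \<open>rule continuous_on_powr_pos\<close>)
    then show ?thesis by (simp add: powr_powr op_powr_def)
  next
    case False
    then show ?thesis using between_imp_le_or_trivial [OF m(2)] by blast
  qed
qed

lemma op_powr_scaleR:
  fixes T :: "'a::complex_hilbert_space bop"
  assumes "spos T" "0 < c"
  shows "(c *\<^sub>R T) powr\<^sub>o a = c powr a *\<^sub>R T powr\<^sub>o a"
proof -
  obtain m M where m: "0 < m" "bop_between m M T"
    using sposE [OF assms(1)] .
  have "(c *\<^sub>R T) powr\<^sub>o a = func_calc (\<lambda>t. t powr a) (func_calc (\<lambda>t. c * t) T)"
    by (simp add: op_powr_def func_calc_cmult [OF m(2)] func_calc_id [OF m(2)])
  also have "\<dots> = func_calc (\<lambda>t. (c * t) powr a) T"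
  proof (rule func_calc_compose [OF m(2)])
    show "continuous_on {c * m..c * M} (\<lambda>t. t powr a)"
      using assms m by (intro continuous_on_powr_pos) simp
  qed (use assms in \<open>auto intro!: continuous_intros\<close>)
  also have "\<dots> = func_calc (\<lambda>t. c powr a * t powr a) T"
    using assms m
    by (intro func_calc_cong [OF m(2)] continuous_intros) (auto simp: powr_mult)
  also have "\<dots> = c powr a *\<^sub>R T powr\<^sub>o a"
    using m by (simp add: func_calc_cmult [OF m(2)] op_powr_def continuous_on_powr_pos)
  finally show ?thesis .
qed

lemma inverse_op_scalar_le:
  fixes T :: "'a::complex_hilbert_space bop"
  assumes "0 < m" "bop_between m M T"
  shows "bop_between (1 / M) (1 / m) (inverse_op T)"
proof (cases "m \<le> M")
  case True
  then show ?thesis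
    using op_powr_between [OF assms, of "- 1"] assms
    by (simp add: inverse_op_eq_powr spos_between powr_minus divide_inverse min_def max_def
        le_imp_inverse_le split: if_splits)
next
  case False
  then have "X \<le> Y" for X Y :: "'a bop"
    using between_imp_le_or_trivial [OF assms(2)] by (metis order_refl)
  then show ?thesis by (simp add: bop_between_def)
qed

text \<open>The inverse has the variational description
  \<open>\<langle>T\<^sup>-\<^sup>1 x, x\<rangle> = max\<^sub>u (2 Re \<langle>u, x\<rangle> - \<langle>T u, u\<rangle>)\<close>.\<close>

lemma qform_inverse_ge:
  fixes T :: "'a::complex_hilbert_space bop"
  assumes "spos T"
  shows "2 * rinner u x - qform T u \<le> qform (inverse_op T) x"
proof -
  define v where "v = bop_apply (inverse_op T) x"
  have v: "bop_apply T v = x"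
    by (simp add: v_def mult_inverse_op [OF assms] one_bop.rep_eq flip: bop_apply_mult)
  have "0 \<le> qform T (u - v)"
    using spos_nonneg [OF assms] by (simp add: bop_nonneg_iff)
  also have "\<dots> = qform T u - rinner (bop_apply T u) v - rinner x u + rinner x v"
    by (simp add: qform_def rinner_simps v)
  also have "rinner (bop_apply T u) v = rinner u x"
    by (simp add: selfadjD [OF spos_selfadj [OF assms]] v)
  finally show ?thesis
    by (simp add: qform_def rinner_commute [of v x] rinner_commute [of x u] flip: v_def)
qed

lemma qform_inverse_eq:
  fixes T :: "'a::complex_hilbert_space bop"
  assumes "spos T"
  defines "u x \<equiv> bop_apply (inverse_op T) x"
  shows "qform (inverse_op T) x = 2 * rinner (u x) x - qform T (u x)"
proof -
  have "bop_apply T (u x) = x"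
    by (simp add: u_def mult_inverse_op [OF assms(1)] one_bop.rep_eq flip: bop_apply_mult)
  then show ?thesis
    by (simp add: qform_def rinner_commute [of x] flip: u_def)
qed

lemma inverse_op_antimono:
  fixes S T :: "'a::complex_hilbert_space bop"
  assumes "spos S" "S \<le> T"
  shows "inverse_op T \<le> inverse_op S"
proof -
  have T: "spos T" using assms by (rule spos_mono)
  show ?thesis
  proof (rule bop_leI)
    fix x
    define u where "u = bop_apply (inverse_op T) x"
    have "qform (inverse_op T) x = 2 * rinner u x - qform T u"
      by (simp add: qform_inverse_eq [OF T] u_def)
    also have "\<dots> \<le> 2 * rinner u x - qform S u"
      using qform_mono [OF assms(2)] by simp
    also have "\<dots> \<le> qform (inverse_op S) x"
      by (rule qform_inverse_ge [OF assms(1)])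
    finally show "qform (inverse_op T) x \<le> qform (inverse_op S) x" .
  qed (auto intro!: spos_selfadj spos_inverse_op assms T)
qed

section \<open>Weighted geometric means\<close>

lemma powr_conj_powr:
  fixes T :: "'a::complex_hilbert_space bop"
  assumes "spos T"
  shows "T powr\<^sub>o a * T powr\<^sub>o a = T powr\<^sub>o (2 * a)"
  using assms by (simp add: op_powr_add)

lemma spos_conj_powr:
  fixes X Y :: "'a::complex_hilbert_space bop"
  assumes X: "spos X" and Y: "spos Y"
  shows "spos (X powr\<^sub>o a * Y * X powr\<^sub>o a)"
proof -
  obtain m where m: "0 < m" "m *\<^sub>R 1 \<le> Y"
    using Y by (auto simp: spos_def)
  have "X powr\<^sub>o a * (m *\<^sub>R 1) * X powr\<^sub>o a \<le> X powr\<^sub>o a * Y * X powr\<^sub>o a"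
    by (rule conj_mono [OF selfadj_powr [OF X] m(2)])
  then have "m *\<^sub>R X powr\<^sub>o (2 * a) \<le> X powr\<^sub>o a * Y * X powr\<^sub>o a"
    by (simp add: powr_conj_powr [OF X])
  then show ?thesis
    by (rule spos_mono [rotated]) (intro spos_scaleR spos_powr X m)
qed

text \<open>The operator of which the powers are taken in the geometric mean. In the commutative case it
  is the quotient \<open>Y / X\<close>.\<close>

definition geom_ratio :: "'a::complex_inner_space bop \<Rightarrow> 'a bop \<Rightarrow> 'a bop" where
  "geom_ratio X Y = X powr\<^sub>o (- 1 / 2) * Y * X powr\<^sub>o (- 1 / 2)"

lemma geom_mean_eq:
  "geom_mean \<nu> X Y = X powr\<^sub>o (1 / 2) * geom_ratio X Y powr\<^sub>o \<nu> * X powr\<^sub>o (1 / 2)"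
  by (simp add: geom_mean_def geom_ratio_def)

context
  fixes X Y :: "'a::complex_hilbert_space bop"
  assumes X: "spos X" and Y: "spos Y"
begin

lemma spos_geom_ratio: "spos (geom_ratio X Y)"
  unfolding geom_ratio_def by (rule spos_conj_powr [OF X Y])

lemma conj_geom_ratio: "X powr\<^sub>o (1 / 2) * geom_ratio X Y * X powr\<^sub>o (1 / 2) = Y"
  by (simp add: geom_ratio_def mult.assoc X)

lemma conj_half_one: "X powr\<^sub>o (1 / 2) * X powr\<^sub>o (1 / 2) = X"
  using powr_conj_powr [OF X, of "1 / 2"] X by simp

lemma spos_geom_mean: "spos (geom_mean \<nu> X Y)"
  unfolding geom_mean_eq by (intro spos_conj_powr X spos_powr spos_geom_ratio)

lemma inverse_geom_mean:
  "inverse_op (geom_mean \<nu> X Y) = geom_mean \<nu> (inverse_op X) (inverse_op Y)"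
proof -
  define D where "D = geom_ratio X Y"
  define D' where "D' = geom_ratio (inverse_op X) (inverse_op Y)"
  have D: "spos D" unfolding D_def by (rule spos_geom_ratio)
  have half: "inverse_op X powr\<^sub>o (1 / 2) = X powr\<^sub>o (- 1 / 2)"
    "inverse_op X powr\<^sub>o (- 1 / 2) = X powr\<^sub>o (1 / 2)"
    using X by (simp_all add: inverse_op_eq_powr op_powr_powr)
  have Y': "Y * (inverse_op Y * R) = R" "inverse_op Y * (Y * R) = R" for R
    by (simp_all add: mult_inverse_op [OF Y] flip: mult.assoc)
  \<comment> \<open>Inverting both arguments inverts the quotient.\<close>
  have "D' = X powr\<^sub>o (1 / 2) * inverse_op Y * X powr\<^sub>o (1 / 2)"
    by (simp only: D'_def geom_ratio_def half)
  then have "inverse_op D = D'"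
    by (intro inverse_op_unique) (simp_all add: D_def geom_ratio_def mult.assoc X Y')
  then have D': "D' powr\<^sub>o \<nu> = D powr\<^sub>o (- \<nu>)"
    using D by (simp add: inverse_op_eq_powr op_powr_powr flip: \<open>inverse_op D = D'\<close>)
  show ?thesis
    unfolding geom_mean_eq half D_def [symmetric] D'_def [symmetric] D'
    by (rule inverse_op_unique) (simp_all add: mult.assoc X D)
qed

text \<open>A scalar inequality on the spectrum of \<open>X\<^sup>-\<^sup>1\<^sup>/\<^sup>2 Y X\<^sup>-\<^sup>1\<^sup>/\<^sup>2\<close> becomes an inequality between
  operator means after conjugation with \<open>X\<^sup>1\<^sup>/\<^sup>2\<close>.\<close>

lemma geom_mean_le_transfer:
  assumes D: "bop_between a b (geom_ratio X Y)" "0 < a"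
    and scalar: "\<And>d. d \<in> {a..b} \<Longrightarrow>
      \<kappa> * d powr \<nu> + s * ((1 + d) / 2 - d powr (1 / 2)) \<le> (1 - \<nu>) + \<nu> * d"
  shows "\<kappa> *\<^sub>R geom_mean \<nu> X Y + s *\<^sub>R (arith_mean (1 / 2) X Y - geom_mean (1 / 2) X Y)
    \<le> arith_mean \<nu> X Y"
proof -
  define D where "D = geom_ratio X Y"
  define C where "C R = X powr\<^sub>o (1 / 2) * R * X powr\<^sub>o (1 / 2)" for R
  have C_lin: "C (R + S) = C R + C S" "C (R - S) = C R - C S" "C (c *\<^sub>R R) = c *\<^sub>R C R"
    "C 1 = X" "C D = Y" "C (D powr\<^sub>o c) = geom_mean c X Y" for R S c
    by (simp_all add: C_def D_def algebra_simps conj_half_one conj_geom_ratio geom_mean_eq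
        flip: mult.assoc)
  have cont: "continuous_on {a..b} (\<lambda>d. d powr c)" for c
    using D(2) by (rule continuous_on_powr_pos)
  have lin: "func_calc (\<lambda>d. c + e * d) D = c *\<^sub>R 1 + e *\<^sub>R D" for c e
    unfolding D_def using func_calc_add [OF D(1) continuous_on_const, of "\<lambda>d. e * d" c]
    by (simp add: func_calc_const [OF D(1)] func_calc_cmult [OF D(1)] func_calc_id [OF D(1)]
        continuous_intros)
  have pow: "func_calc (\<lambda>d. k * d powr c) D = k *\<^sub>R D powr\<^sub>o c" for k c
    unfolding D_def op_powr_def by (rule func_calc_cmult [OF D(1) cont])
  have gap: "func_calc (\<lambda>d. (1 / 2 + 1 / 2 * d) - d powr (1 / 2)) D
      = ((1 / 2) *\<^sub>R 1 + (1 / 2) *\<^sub>R D) - D powr\<^sub>o (1 / 2)"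
    unfolding lin [symmetric] unfolding D_def op_powr_def
    by (rule func_calc_diff [OF D(1)]) (intro continuous_intros cont)+
  have cont_gap: "continuous_on {a..b} (\<lambda>d. (1 / 2 + 1 / 2 * d) - d powr (1 / 2))"
    by (intro continuous_on_diff cont) (intro continuous_intros)
  have "func_calc (\<lambda>d. \<kappa> * d powr \<nu> + s * ((1 / 2 + 1 / 2 * d) - d powr (1 / 2))) D
      = func_calc (\<lambda>d. \<kappa> * d powr \<nu>) D
        + func_calc (\<lambda>d. s * ((1 / 2 + 1 / 2 * d) - d powr (1 / 2))) D"
    unfolding D_def
    by (rule func_calc_add [OF D(1)])
      (intro continuous_on_mult continuous_on_const cont cont_gap)+
  also have "func_calc (\<lambda>d. s * ((1 / 2 + 1 / 2 * d) - d powr (1 / 2))) D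
      = s *\<^sub>R func_calc (\<lambda>d. (1 / 2 + 1 / 2 * d) - d powr (1 / 2)) D"
    unfolding D_def by (rule func_calc_cmult [OF D(1) cont_gap])
  finally have lhs: "func_calc (\<lambda>d. \<kappa> * d powr \<nu> + s * ((1 / 2 + 1 / 2 * d) - d powr (1 / 2))) D
      = \<kappa> *\<^sub>R D powr\<^sub>o \<nu> + s *\<^sub>R (((1 / 2) *\<^sub>R 1 + (1 / 2) *\<^sub>R D) - D powr\<^sub>o (1 / 2))"
    unfolding pow gap .
  have "func_calc (\<lambda>d. \<kappa> * d powr \<nu> + s * ((1 / 2 + 1 / 2 * d) - d powr (1 / 2))) D
      \<le> func_calc (\<lambda>d. (1 - \<nu>) + \<nu> * d) D"
    unfolding D_def
  proof (rule func_calc_mono [OF D(1)])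
    show "continuous_on {a..b} (\<lambda>d. \<kappa> * d powr \<nu> + s * ((1 / 2 + 1 / 2 * d) - d powr (1 / 2)))"
      by (intro continuous_on_add continuous_on_mult continuous_on_const cont cont_gap)
    show "continuous_on {a..b} (\<lambda>d. (1 - \<nu>) + \<nu> * d)"
      by (intro continuous_intros)
    fix d assume "d \<in> {a..b}"
    from scalar [OF this]
    show "\<kappa> * d powr \<nu> + s * ((1 / 2 + 1 / 2 * d) - d powr (1 / 2)) \<le> (1 - \<nu>) + \<nu> * d"
      by (simp add: add_divide_distrib)
  qed
  then have "\<kappa> *\<^sub>R D powr\<^sub>o \<nu> + s *\<^sub>R (((1 / 2) *\<^sub>R 1 + (1 / 2) *\<^sub>R D) - D powr\<^sub>o (1 / 2))
      \<le> (1 - \<nu>) *\<^sub>R 1 + \<nu> *\<^sub>R D"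
    unfolding lhs lin .
  then have "C (\<kappa> *\<^sub>R D powr\<^sub>o \<nu> + s *\<^sub>R (((1 / 2) *\<^sub>R 1 + (1 / 2) *\<^sub>R D) - D powr\<^sub>o (1 / 2)))
      \<le> C ((1 - \<nu>) *\<^sub>R 1 + \<nu> *\<^sub>R D)"
    unfolding C_def by (rule conj_mono [OF selfadj_powr [OF X]])
  then show ?thesis
    by (simp add: C_lin arith_mean_def)
qed

end

section \<open>Positive unital maps on a commutative algebra\<close>

lemma Bernstein_approx:
  fixes f :: "real \<Rightarrow> real"
  assumes "m < M" "continuous_on {m..M} f" "0 < \<epsilon>"
  shows "\<exists>N. \<forall>n\<ge>N. \<forall>t\<in>{m..M}.
    \<bar>f t - (\<Sum>k\<le>n. f (m + (M - m) * (real k / real n)) * Bernstein n k ((t - m) / (M - m)))\<bar> < \<epsilon>"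
proof -
  have "continuous_on {0..1} (\<lambda>x. f (m + (M - m) * x))"
  proof (rule continuous_on_compose2 [OF assms(2)])
    show "(\<lambda>x. m + (M - m) * x) ` {0..1} \<subseteq> {m..M}"
    proof (rule image_subsetI)
      fix x :: real assume "x \<in> {0..1}"
      then have "(M - m) * x \<le> (M - m) * 1" "0 \<le> (M - m) * x"
        using assms(1) by (auto intro: mult_left_mono)
      then show "m + (M - m) * x \<in> {m..M}" by simp
    qed
  qed (intro continuous_intros)
  then obtain N where N: "\<forall>n x. N \<le> n \<and> x \<in> {0..1} \<longrightarrow>
      \<bar>f (m + (M - m) * x) - (\<Sum>k\<le>n. f (m + (M - m) * (k / n)) * Bernstein n k x)\<bar> < \<epsilon>"
    using Bernstein_Weierstrass [OF _ assms(3)] by blast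
  show ?thesis
  proof (intro exI allI impI ballI)
    fix n t assume n: "n \<ge> N" and t: "t \<in> {m..M}"
    have "(t - m) / (M - m) \<in> {0..1}" "m + (M - m) * ((t - m) / (M - m)) = t"
      using assms(1) t by auto
    then show "\<bar>f t - (\<Sum>k\<le>n. f (m + (M - m) * (real k / real n)) * Bernstein n k ((t - m) / (M - m)))\<bar> < \<epsilon>"
      using N [rule_format, of n "(t - m) / (M - m)"] n by (simp only: simp_thms)
  qed
qed

lemma func_calc_sum:
  fixes T :: "'a::complex_hilbert_space bop"
  assumes T: "bop_between m M T" and f: "\<And>i. i \<in> I \<Longrightarrow> continuous_on {m..M} (f i)" and "finite I"
  shows "func_calc (\<lambda>t. \<Sum>i\<in>I. f i t) T = (\<Sum>i\<in>I. func_calc (f i) T)"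
  using assms(3) f
proof (induction I rule: finite_induct)
  case empty
  then show ?case by (simp add: func_calc_const [OF T])
next
  case (insert i I)
  then show ?case
    by (simp add: func_calc_add [OF T] continuous_on_sum)
qed

context
  fixes \<Phi> :: "'h::complex_hilbert_space bop \<Rightarrow> 'k::complex_hilbert_space bop"
  assumes lin: "linear_op_map \<Phi>" and pos: "positive_op_map \<Phi>" and unital: "unital_op_map \<Phi>"
begin

lemma map_linear:
  "\<Phi> (X + Y) = \<Phi> X + \<Phi> Y" "\<Phi> (r *\<^sub>R X) = r *\<^sub>R \<Phi> X" "\<Phi> 0 = 0" "\<Phi> (X - Y) = \<Phi> X - \<Phi> Y"
proof -
  show add: "\<Phi> (X + Y) = \<Phi> X + \<Phi> Y" for X Y
    using lin by (simp add: linear_op_map_def)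
  show scale: "\<Phi> (r *\<^sub>R X) = r *\<^sub>R \<Phi> X" for r X
    using lin by (simp add: linear_op_map_def flip: scaleC_of_real)
  show "\<Phi> 0 = 0" using add [of 0 0] by simp
  show "\<Phi> (X - Y) = \<Phi> X - \<Phi> Y" using add [of "X - Y" Y] by simp
qed

lemma map_sum: "\<Phi> (sum f I) = (\<Sum>i\<in>I. \<Phi> (f i))"
  by (induction I rule: infinite_finite_induct) (simp_all add: map_linear)

lemma map_one: "\<Phi> 1 = 1"
  using unital by (simp add: unital_op_map_def)

lemma map_mono: "X \<le> Y \<Longrightarrow> \<Phi> X \<le> \<Phi> Y"
proof -
  assume "X \<le> Y"
  then have "0 \<le> \<Phi> (Y - X)" using pos by (simp add: positive_op_map_def)
  then show "\<Phi> X \<le> \<Phi> Y" by (simp add: map_linear)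
qed

lemma map_between: "bop_between m M T \<Longrightarrow> bop_between m M (\<Phi> T)"
  using map_mono [of "m *\<^sub>R 1" T] map_mono [of T "M *\<^sub>R 1"]
  by (simp add: bop_between_def map_linear map_one)

lemma map_spos: "spos T \<Longrightarrow> spos (\<Phi> T)"
  by (meson map_between sposE spos_between)

lemma norm_map_le_of_between: "bop_between (- N) N T \<Longrightarrow> 0 \<le> N \<Longrightarrow> norm (\<Phi> T) \<le> N"
  using map_between [of "- N" N T] by (intro norm_le_of_bounds) (simp_all add: bop_between_def)

lemma map_tendsto:
  assumes "T \<longlonglongrightarrow> S" "\<And>n. selfadj (T n)"
  shows "(\<lambda>n. \<Phi> (T n)) \<longlonglongrightarrow> \<Phi> S"
proof (rule metric_LIMSEQ_I)
  fix \<epsilon> :: real assume "0 < \<epsilon>"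
  then obtain N where N: "\<And>n. n \<ge> N \<Longrightarrow> norm (T n - S) < \<epsilon>"
    using LIMSEQ_D [OF assms(1)] by blast
  have "dist (\<Phi> (T n)) (\<Phi> S) < \<epsilon>" if "n \<ge> N" for n
  proof -
    have sa: "selfadj (T n - S)"
      using assms selfadj_limit by blast
    have "T n - S \<le> norm (T n - S) *\<^sub>R 1" "- (T n - S) \<le> norm (- (T n - S)) *\<^sub>R 1"
      using selfadj_le_norm [OF sa] selfadj_le_norm [OF selfadj_intros(5) [OF sa]] by simp_all
    then have "norm (\<Phi> (T n - S)) \<le> norm (T n - S)"
      unfolding norm_minus_cancel
      by (intro norm_map_le_of_between) (simp_all add: bop_between_def minus_le_iff)
    then show ?thesis
      using N [OF that] by (simp add: map_linear dist_norm)
  qed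
  then show "\<exists>N. \<forall>n\<ge>N. dist (\<Phi> (T n)) (\<Phi> S) < \<epsilon>" by blast
qed

lemma map_Bernstein_tendsto:
  assumes T: "bop_between m M T" and "m < M" and f: "continuous_on {m..M} f"
  shows "(\<lambda>n. \<Sum>k\<le>n. f (m + (M - m) * (real k / real n)) *\<^sub>R
      \<Phi> (func_calc (\<lambda>t. Bernstein n k ((t - m) / (M - m))) T)) \<longlonglongrightarrow> \<Phi> (func_calc f T)"
proof (rule metric_LIMSEQ_I)
  fix \<epsilon> :: real assume "0 < \<epsilon>"
  define B where "B n k = (\<lambda>t. Bernstein n k ((t - m) / (M - m)))" for n k
  have B: "continuous_on {m..M} (B n k)" for n k
    unfolding B_def Bernstein_def by (intro continuous_intros) (use \<open>m < M\<close> in auto)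
  define g where "g n = (\<lambda>t. \<Sum>k\<le>n. f (m + (M - m) * (real k / real n)) * B n k t)" for n
  have g: "continuous_on {m..M} (g n)" for n
    unfolding g_def by (intro continuous_intros B)
  have sum_eq: "\<Phi> (func_calc (g n) T)
      = (\<Sum>k\<le>n. f (m + (M - m) * (real k / real n)) *\<^sub>R \<Phi> (func_calc (B n k) T))" for n
    unfolding g_def
    by (subst func_calc_sum [OF T])
      (auto intro!: continuous_intros B simp: func_calc_cmult [OF T B] map_sum map_linear)
  obtain N where N: "\<And>n t. n \<ge> N \<Longrightarrow> t \<in> {m..M} \<Longrightarrow> \<bar>f t - g n t\<bar> < \<epsilon> / 2"
    using Bernstein_approx [OF \<open>m < M\<close> f half_gt_zero [OF \<open>0 < \<epsilon>\<close>]] unfolding g_def B_def by blast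
  have "dist (\<Phi> (func_calc (g n) T)) (\<Phi> (func_calc f T)) < \<epsilon>" if "n \<ge> N" for n
  proof -
    have "bop_between (- (\<epsilon> / 2)) (\<epsilon> / 2) (func_calc (\<lambda>t. g n t - f t) T)"
    proof (rule func_calc_between [OF T continuous_on_diff [OF g f]])
      fix t assume "t \<in> {m..M}"
      from N [OF that this] show "g n t - f t \<in> {- (\<epsilon> / 2)..\<epsilon> / 2}"
        unfolding atLeastAtMost_iff by linarith
    qed
    then have "norm (\<Phi> (func_calc (\<lambda>t. g n t - f t) T)) \<le> \<epsilon> / 2"
      by (rule norm_map_le_of_between) (use \<open>0 < \<epsilon>\<close> in simp)
    then show ?thesis
      using \<open>0 < \<epsilon>\<close> by (simp add: func_calc_diff [OF T g f] map_linear dist_norm)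
  qed
  then show "\<exists>N. \<forall>n\<ge>N. dist (\<Sum>k\<le>n. f (m + (M - m) * (real k / real n)) *\<^sub>R
      \<Phi> (func_calc (\<lambda>t. Bernstein n k ((t - m) / (M - m))) T)) (\<Phi> (func_calc f T)) < \<epsilon>"
    unfolding sum_eq B_def by blast
qed

text \<open>On the commutative algebra generated by \<open>T\<close> a positive map is automatically completely
  positive. Bernstein operators replace the spectral resolution: they approximate \<open>f(T)\<close> by
  \<open>\<Sum>\<^sub>k f(t\<^sub>k) B\<^sub>k\<close> with \<open>B\<^sub>k \<ge> 0\<close> not depending on \<open>f\<close>, and the form of the approximants is
  \<open>\<Sum>\<^sub>k \<langle>\<Phi>(B\<^sub>k) v\<^sub>k, v\<^sub>k\<rangle>\<close> with \<open>v\<^sub>k = p(t\<^sub>k) u + q(t\<^sub>k) w\<close>.\<close>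

lemma map_two_positive:
  assumes T: "bop_between m M T" and "m < M"
    and p: "continuous_on {m..M} p" and q: "continuous_on {m..M} q"
  shows "0 \<le> qform (\<Phi> (func_calc (\<lambda>t. p t * p t) T)) u
    + 2 * rinner (bop_apply (\<Phi> (func_calc (\<lambda>t. p t * q t) T)) u) w
    + qform (\<Phi> (func_calc (\<lambda>t. q t * q t) T)) w"
proof -
  define B where "B n k = \<Phi> (func_calc (\<lambda>t. Bernstein n k ((t - m) / (M - m))) T)" for n k
  have B_nonneg: "0 \<le> B n k" for n k
  proof -
    have "0 \<le> func_calc (\<lambda>t. Bernstein n k ((t - m) / (M - m))) T"
    proof (rule func_calc_nonneg [OF T])
      show "continuous_on {m..M} (\<lambda>t. Bernstein n k ((t - m) / (M - m)))"
        unfolding Bernstein_def by (intro continuous_intros) (use \<open>m < M\<close> in auto)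
      show "0 \<le> Bernstein n k ((t - m) / (M - m))" if "t \<in> {m..M}" for t
        using that \<open>m < M\<close> by (intro Bernstein_nonneg) auto
    qed
    then show ?thesis
      using map_mono map_linear(3) unfolding B_def by metis
  qed
  define S where "S f n = (\<Sum>k\<le>n. f (m + (M - m) * (real k / real n)) *\<^sub>R B n k)"
    for f :: "real \<Rightarrow> real" and n
  have S: "S f \<longlonglongrightarrow> \<Phi> (func_calc f T)" if "continuous_on {m..M} f" for f
    using map_Bernstein_tendsto [OF T \<open>m < M\<close> that] unfolding S_def B_def .
  have "0 \<le> qform (S (\<lambda>t. p t * p t) n) u + 2 * rinner (bop_apply (S (\<lambda>t. p t * q t) n) u) w
      + qform (S (\<lambda>t. q t * q t) n) w" for n
  proof -
    define t where "t k = m + (M - m) * (real k / real n)" for k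
    have apply_sum: "bop_apply (sum F I) x = (\<Sum>i\<in>I. bop_apply (F i) x)"
      for F :: "nat \<Rightarrow> 'k bop" and I x
      by (induction I rule: infinite_finite_induct) (simp_all add: bop_rep_eqs)
    have term_eq: "qform (B n k) (p (t k) *\<^sub>R u + q (t k) *\<^sub>R w)
        = p (t k) * p (t k) * qform (B n k) u + 2 * (p (t k) * q (t k) * rinner (bop_apply (B n k) u) w)
          + q (t k) * q (t k) * qform (B n k) w" for k
    proof -
      have "rinner (bop_apply (B n k) w) u = rinner (bop_apply (B n k) u) w"
        using selfadjD [OF selfadj_of_nonneg [OF B_nonneg]] rinner_commute by metis
      then show ?thesis
        by (simp add: qform_def rinner_simps algebra_simps)
    qed
    have "0 \<le> (\<Sum>k\<le>n. qform (B n k) (p (t k) *\<^sub>R u + q (t k) *\<^sub>R w))"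
      using B_nonneg by (intro sum_nonneg) (simp add: bop_nonneg_iff)
    also have "\<dots> = qform (S (\<lambda>t. p t * p t) n) u + 2 * rinner (bop_apply (S (\<lambda>t. p t * q t) n) u) w
      + qform (S (\<lambda>t. q t * q t) n) w"
      unfolding term_eq
      by (simp add: S_def qform_sum qform_simps apply_sum rinner_sum_left scaleR_bop.rep_eq
          rinner_scaleR_left sum.distrib sum_distrib_left t_def)
    finally show ?thesis .
  qed
  moreover have "(\<lambda>n. qform (S (\<lambda>t. p t * p t) n) u + 2 * rinner (bop_apply (S (\<lambda>t. p t * q t) n) u) w
      + qform (S (\<lambda>t. q t * q t) n) w)
    \<longlonglongrightarrow> qform (\<Phi> (func_calc (\<lambda>t. p t * p t) T)) u
    + 2 * rinner (bop_apply (\<Phi> (func_calc (\<lambda>t. p t * q t) T)) u) w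
    + qform (\<Phi> (func_calc (\<lambda>t. q t * q t) T)) w"
    by (intro tendsto_add tendsto_mult tendsto_const qform_tendsto rinner_apply_tendsto S
        continuous_on_mult p q)
  ultimately show ?thesis
    by (intro LIMSEQ_le_const) auto
qed

text \<open>The case \<open>p(t) = t\<^bsup>a/2\<^esup>\<close>, \<open>q(t) = t\<^bsup>b/2\<^esup>\<close>.\<close>

lemma map_two_positive_powr:
  assumes "spos T"
  shows "0 \<le> qform (\<Phi> (T powr\<^sub>o a)) u
    + 2 * rinner (bop_apply (\<Phi> (T powr\<^sub>o ((a + b) / 2))) u) w + qform (\<Phi> (T powr\<^sub>o b)) w"
proof -
  obtain m M where m: "0 < m" "bop_between m M T"
    using sposE [OF assms] .
  \<comment> \<open>The Bernstein polynomials need an interval of positive length.\<close>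
  define M' where "M' = max M (m + 1)"
  have "T \<le> M' *\<^sub>R 1"
    using m(2) scalar_bop_mono [of M M'] unfolding bop_between_def M'_def
    by (meson max.cobounded1 order_trans)
  then have m': "bop_between m M' T" "m < M'"
    using m(2) by (simp_all add: bop_between_def M'_def)
  show ?thesis
    using map_two_positive [OF m' continuous_on_powr_pos [OF m(1)] continuous_on_powr_pos [OF m(1)],
        of "a / 2" u "b / 2" w]
    by (simp add: op_powr_def add_divide_distrib flip: powr_add)
qed

text \<open>Choi's inequality. The exponents \<open>1\<close> and \<open>-1\<close> with \<open>w = - x\<close> say that \<open>\<langle>\<Phi>(T\<^sup>-\<^sup>1) x, x\<rangle>\<close> is at least
  \<open>2 Re \<langle>u, x\<rangle> - \<langle>\<Phi>(T) u, u\<rangle>\<close> for every \<open>u\<close>, and \<open>u = \<Phi>(T)\<^sup>-\<^sup>1 x\<close> attains the variational formula for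
  \<open>\<langle>\<Phi>(T)\<^sup>-\<^sup>1 x, x\<rangle>\<close>.\<close>

lemma inverse_map_le_map_inverse:
  assumes T: "spos T"
  shows "inverse_op (\<Phi> T) \<le> \<Phi> (inverse_op T)"
proof (rule bop_leI)
  fix x
  define u where "u = bop_apply (inverse_op (\<Phi> T)) x"
  have "0 \<le> qform (\<Phi> T) u + 2 * rinner u (- x) + qform (\<Phi> (inverse_op T)) (- x)"
    using map_two_positive_powr [OF T, of 1 u "- 1" "- x"] T
    by (simp add: inverse_op_eq_powr map_one one_bop.rep_eq)
  moreover have "qform (inverse_op (\<Phi> T)) x = 2 * rinner u x - qform (\<Phi> T) u"
    by (simp add: qform_inverse_eq map_spos T u_def)
  ultimately show "qform (inverse_op (\<Phi> T)) x \<le> qform (\<Phi> (inverse_op T)) x"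
    by (simp add: rinner_simps) (simp add: qform_def rinner_simps)
qed (auto intro!: spos_selfadj spos_inverse_op map_spos T)

end

section \<open>Ando's inequality for geometric means\<close>

text \<open>The hypothesis says that \<open>E\<^sup>-\<^sup>b\<^sup>/\<^sup>2 R E\<^sup>-\<^sup>a\<^sup>/\<^sup>2\<close> has real part at most \<open>1\<close>. This operator is
  similar to the self-adjoint \<open>R' = E\<^sup>-\<^sup>c\<^sup>/\<^sup>2 R E\<^sup>-\<^sup>c\<^sup>/\<^sup>2\<close> where \<open>c = (a + b)/2\<close>, so the top of the spectrum
  of \<open>R'\<close>, an approximate eigenvalue, is at most \<open>1\<close> as well.\<close>

lemma le_powr_of_two_positive:
  fixes E R :: "'a::complex_hilbert_space bop"
  assumes E: "spos E" and R: "selfadj R"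
    and form: "\<And>u w. 0 \<le> qform (E powr\<^sub>o a) u + 2 * rinner (bop_apply R u) w + qform (E powr\<^sub>o b) w"
  shows "R \<le> E powr\<^sub>o ((a + b) / 2)"
proof -
  define c where "c = (a + b) / 2"
  define d where "d = (a - b) / 4"
  define R' where "R' = E powr\<^sub>o (- (c / 2)) * R * E powr\<^sub>o (- (c / 2))"
  have R': "selfadj R'"
    unfolding R'_def by (intro selfadj_conj selfadj_powr E R)
  define H where "H = E powr\<^sub>o d"
  have "invertible_op H"
    unfolding H_def using E by (intro invertible_opI [of "E powr\<^sub>o (- d)" _ "E powr\<^sub>o (- d)"]) simp_all
  then obtain \<eta> where \<eta>: "\<eta> > 0" "\<And>x. \<eta> * norm x \<le> norm (bop_apply H x)"
    using invertible_bounded_below by blast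
  have half: "qform (E powr\<^sub>o e) (bop_apply (E powr\<^sub>o (- (e / 2))) y) = (norm y)\<^sup>2" for e y
  proof -
    have "E powr\<^sub>o (- (e / 2)) * E powr\<^sub>o e * E powr\<^sub>o (- (e / 2)) = 1"
      using E by (simp add: op_powr_add)
    then show ?thesis
      using qform_conj [OF selfadj_powr [OF E], of "- (e / 2)" "E powr\<^sub>o e" y] by (simp add: qform_simps)
  qed
  have key: "rinner (bop_apply (H * R') x) (bop_apply H x) \<le> (norm (bop_apply H x))\<^sup>2" for x
  proof -
    define y where "y = bop_apply H x"
    define u where "u = bop_apply (E powr\<^sub>o (- (a / 2))) y"
    define w where "w = bop_apply (E powr\<^sub>o (- (b / 2))) (- y)"
    have u_eq: "u = bop_apply (E powr\<^sub>o (- (c / 2))) x"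
    proof -
      have "- (a / 2) + d = - (c / 2)" by (simp add: c_def d_def field_simps)
      then have "E powr\<^sub>o (- (a / 2)) * H = E powr\<^sub>o (- (c / 2))"
        by (simp only: H_def op_powr_add [OF E])
      then show ?thesis by (simp add: u_def y_def flip: bop_apply_mult)
    qed
    have "rinner (bop_apply R u) w = - rinner (bop_apply (E powr\<^sub>o (- (b / 2)) * R) u) y"
      by (simp add: w_def rinner_simps bop_apply_mult selfadjD [OF selfadj_powr [OF E]])
    also have "bop_apply (E powr\<^sub>o (- (b / 2)) * R) u = bop_apply (H * R') x"
    proof -
      have "d + - (c / 2) = - (b / 2)" by (simp add: c_def d_def field_simps)
      then have "H * E powr\<^sub>o (- (c / 2)) = E powr\<^sub>o (- (b / 2))"
        by (simp only: H_def op_powr_add [OF E])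
      then have "E powr\<^sub>o (- (b / 2)) * R * E powr\<^sub>o (- (c / 2)) = H * R'"
        by (simp add: R'_def flip: mult.assoc)
      then show ?thesis
        by (simp add: u_eq flip: bop_apply_mult)
    qed
    finally have "rinner (bop_apply R u) w = - rinner (bop_apply (H * R') x) y" .
    moreover have "qform (E powr\<^sub>o a) u = (norm y)\<^sup>2" "qform (E powr\<^sub>o b) w = (norm y)\<^sup>2"
      unfolding u_def w_def half by simp_all
    ultimately show ?thesis
      using form [of u w] by (simp add: y_def)
  qed
  have "R' \<le> 1 *\<^sub>R 1"
  proof (rule le_scalar_descent [OF R'])
    fix \<beta> :: real assume "1 < \<beta>"
    define P where "P = \<beta> *\<^sub>R 1 - R'"
    have "(\<beta> - 1) * \<eta> / (norm H + 1) * norm x \<le> norm (bop_apply P x)" for x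
    proof (cases "x = 0")
      case False
      define y where "y = bop_apply H x"
      have "0 < norm y"
        using \<eta>(2) [of x] \<eta>(1) False unfolding y_def
        by (metis less_le_trans mult_pos_pos zero_less_norm_iff)
      have "(\<beta> - 1) * (norm y)\<^sup>2 \<le> rinner (bop_apply (H * P) x) y"
        using key [of x]
        by (simp add: P_def bop_rep_eqs rinner_simps rinner_self y_def algebra_simps)
      also have "\<dots> \<le> norm (bop_apply (H * P) x) * norm y"
        by (rule rinner_le_norm)
      also have "\<dots> \<le> ((norm H + 1) * norm (bop_apply P x)) * norm y"
      proof (rule mult_right_mono)
        have "norm (bop_apply (H * P) x) \<le> norm H * norm (bop_apply P x)"
          by (simp add: bop_apply_mult norm_bop_apply)
        then show "norm (bop_apply (H * P) x) \<le> (norm H + 1) * norm (bop_apply P x)"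
          using norm_ge_zero [of "bop_apply P x"] unfolding distrib_right by linarith
      qed simp
      finally have "(\<beta> - 1) * norm y \<le> (norm H + 1) * norm (bop_apply P x)"
        using \<open>0 < norm y\<close> by (simp add: power2_eq_square mult.assoc [symmetric])
      moreover have "(\<beta> - 1) * (\<eta> * norm x) \<le> (\<beta> - 1) * norm y"
        using \<eta>(2) [of x] \<open>1 < \<beta>\<close> by (intro mult_left_mono) (simp_all add: y_def)
      ultimately have "(\<beta> - 1) * (\<eta> * norm x) \<le> (norm H + 1) * norm (bop_apply P x)"
        by linarith
      moreover have "0 < norm H + 1" by (simp add: add_nonneg_pos)
      ultimately show ?thesis
        by (simp add: field_simps)
    qed simp
    moreover have "0 < (\<beta> - 1) * \<eta> / (norm H + 1)"
      using \<open>1 < \<beta>\<close> \<eta>(1) by (simp add: add_nonneg_pos)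
    ultimately show "\<exists>\<kappa>>0. \<forall>x. \<kappa> * norm x \<le> norm (bop_apply (\<beta> *\<^sub>R 1 - R') x)"
      unfolding P_def by blast
  qed
  then have "E powr\<^sub>o (c / 2) * R' * E powr\<^sub>o (c / 2) \<le> E powr\<^sub>o (c / 2) * (1 *\<^sub>R 1) * E powr\<^sub>o (c / 2)"
    by (rule conj_mono [OF selfadj_powr [OF E]])
  moreover have "E powr\<^sub>o (c / 2) * R' * E powr\<^sub>o (c / 2) = R"
    using E by (simp add: R'_def mult.assoc)
  ultimately show ?thesis
    using E by (simp add: op_powr_add c_def)
qed

text \<open>On a compact interval of positive reals \<open>t powr a\<close> is uniformly continuous in \<open>(a, t)\<close>.\<close>

lemma op_powr_tendsto:
  fixes T :: "'a::complex_hilbert_space bop"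
  assumes T: "spos T" and lim: "a \<longlonglongrightarrow> l" and a: "\<And>n. a n \<in> {0..1}"
  shows "(\<lambda>n. T powr\<^sub>o a n) \<longlonglongrightarrow> T powr\<^sub>o l"
proof -
  obtain m M where m: "0 < m" "bop_between m M T"
    using sposE [OF T] .
  have l: "l \<in> {0..1}"
    using closed_sequentially [OF closed_atLeastAtMost _ lim] a by blast
  have "continuous_on ({0..1} \<times> {m..M}) (\<lambda>z. snd z powr fst z)"
    using m(1) by (intro continuous_intros) auto
  then have unif: "uniformly_continuous_on ({0..1} \<times> {m..M}) (\<lambda>z. snd z powr fst z)"
    by (intro compact_uniformly_continuous compact_Times compact_Icc)
  have "uniform_limit {m..M} (\<lambda>n t. t powr a n) (\<lambda>t. t powr l) sequentially"
  proof (rule uniform_limitI)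
    fix \<epsilon> :: real assume "0 < \<epsilon>"
    then obtain \<delta> where \<delta>: "0 < \<delta>" "\<And>z z'. z \<in> {0..1} \<times> {m..M} \<Longrightarrow> z' \<in> {0..1} \<times> {m..M} \<Longrightarrow>
        dist z' z < \<delta> \<Longrightarrow> dist (snd z' powr fst z') (snd z powr fst z) < \<epsilon>"
      using unif unfolding uniformly_continuous_on_def by metis
    have "\<forall>\<^sub>F n in sequentially. dist (a n) l < \<delta>"
      using lim \<delta>(1) by (rule tendstoD)
    then show "\<forall>\<^sub>F n in sequentially. \<forall>t\<in>{m..M}. dist (t powr a n) (t powr l) < \<epsilon>"
    proof (rule eventually_mono)
      fix n assume n: "dist (a n) l < \<delta>"
      show "\<forall>t\<in>{m..M}. dist (t powr a n) (t powr l) < \<epsilon>"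
      proof
        fix t assume "t \<in> {m..M}"
        then show "dist (t powr a n) (t powr l) < \<epsilon>"
          using \<delta>(2) [of "(l, t)" "(a n, t)"] l a [of n] n by (simp add: dist_Pair_Pair)
      qed
    qed
  qed
  then show ?thesis
    unfolding op_powr_def
    by (rule func_calc_uniform_limit [OF m(2)]) (intro continuous_on_powr_pos m(1))+
qed

text \<open>Otherwise the points of \<open>S\<close> closest to \<open>x\<close> on either side have a midpoint in \<open>S\<close> that is
  closer.\<close>

lemma closed_midpoint_eq_Icc:
  fixes S :: "real set"
  assumes "closed S" "0 \<in> S" "1 \<in> S" and mid: "\<And>a b. a \<in> S \<Longrightarrow> b \<in> S \<Longrightarrow> (a + b) / 2 \<in> S"
    and x: "x \<in> {0..1}"
  shows "x \<in> S"
proof -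
  define a where "a = Sup (S \<inter> {..x})"
  define b where "b = Inf (S \<inter> {x..})"
  have bdd: "bdd_above (S \<inter> {..x})" "bdd_below (S \<inter> {x..})" by auto
  have "a \<in> S \<inter> {..x}"
    unfolding a_def using assms x bdd by (intro closed_contains_Sup closed_Int) auto
  moreover have "b \<in> S \<inter> {x..}"
    unfolding b_def using assms x bdd by (intro closed_contains_Inf closed_Int) auto
  ultimately have ab: "a \<in> S" "b \<in> S" "a \<le> x" "x \<le> b" by auto
  then have "(a + b) / 2 \<in> S" using mid by blast
  show ?thesis
  proof (cases "(a + b) / 2 \<le> x")
    case True
    then have "(a + b) / 2 \<le> a"
      unfolding a_def [symmetric] using \<open>(a + b) / 2 \<in> S\<close> bdd
      by (subst (2) a_def) (intro cSup_upper, auto)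
    then have "b \<le> a" by simp
    then show ?thesis using ab by (metis order.trans order_antisym)
  next
    case False
    then have "b \<le> (a + b) / 2"
      using \<open>(a + b) / 2 \<in> S\<close> bdd by (subst b_def) (intro cInf_lower, auto)
    then have "b \<le> a" by simp
    then show ?thesis using ab by (metis order.trans order_antisym)
  qed
qed

context
  fixes \<Phi> :: "'h::complex_hilbert_space bop \<Rightarrow> 'k::complex_hilbert_space bop"
  assumes lin: "linear_op_map \<Phi>" and pos: "positive_op_map \<Phi>" and unital: "unital_op_map \<Phi>"
begin

text \<open>The exponents for which the inequality holds include \<open>0\<close> and \<open>1\<close>, form a closed set, and
  are stable under midpoints.\<close>

lemma map_powr_le_powr_map:
  assumes D: "spos D" and \<nu>: "\<nu> \<in> {0..1}"
  shows "\<Phi> (D powr\<^sub>o \<nu>) \<le> \<Phi> D powr\<^sub>o \<nu>"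
proof -
  note E = map_spos [OF lin pos unital D]
  define S where "S = {a \<in> {0..1}. \<Phi> (D powr\<^sub>o a) \<le> \<Phi> D powr\<^sub>o a}"
  have "\<nu> \<in> S"
  proof (rule closed_midpoint_eq_Icc)
    show "0 \<in> S" "1 \<in> S"
      using D E by (simp_all add: S_def map_one [OF lin pos unital])
    show "(a + b) / 2 \<in> S" if "a \<in> S" "b \<in> S" for a b
    proof -
      have le: "\<Phi> (D powr\<^sub>o a) \<le> \<Phi> D powr\<^sub>o a" "\<Phi> (D powr\<^sub>o b) \<le> \<Phi> D powr\<^sub>o b"
        using that by (simp_all add: S_def)
      have "\<Phi> (D powr\<^sub>o ((a + b) / 2)) \<le> \<Phi> D powr\<^sub>o ((a + b) / 2)"
      proof (rule le_powr_of_two_positive [OF E])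
        show "selfadj (\<Phi> (D powr\<^sub>o ((a + b) / 2)))"
          by (intro spos_selfadj map_spos [OF lin pos unital] spos_powr D)
        fix u w
        show "0 \<le> qform (\<Phi> D powr\<^sub>o a) u + 2 * rinner (bop_apply (\<Phi> (D powr\<^sub>o ((a + b) / 2))) u) w
            + qform (\<Phi> D powr\<^sub>o b) w"
          using map_two_positive_powr [OF lin pos unital D, of a u b w]
            qform_mono [OF le(1), of u] qform_mono [OF le(2), of w] by linarith
      qed
      then show ?thesis using that by (simp add: S_def)
    qed
    show "closed S"
    proof (unfold closed_sequential_limits, intro allI impI, elim conjE)
      fix a l assume a: "\<forall>n. a n \<in> S" and lim: "a \<longlonglongrightarrow> l"
      have a': "a n \<in> {0..1}" for n using a by (auto simp: S_def)
      have "(\<lambda>n. \<Phi> D powr\<^sub>o a n - \<Phi> (D powr\<^sub>o a n)) \<longlonglongrightarrow> \<Phi> D powr\<^sub>o l - \<Phi> (D powr\<^sub>o l)"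
        by (intro tendsto_diff map_tendsto [OF lin pos unital] op_powr_tendsto lim a' selfadj_powr E D)
      then have "0 \<le> \<Phi> D powr\<^sub>o l - \<Phi> (D powr\<^sub>o l)"
        by (rule bop_nonneg_limit) (use a in \<open>simp add: S_def\<close>)
      moreover have "l \<in> {0..1}"
        using closed_sequentially [OF closed_atLeastAtMost _ lim] a' by blast
      ultimately show "l \<in> S" by (simp add: S_def)
    qed
  qed (rule \<nu>)
  then show ?thesis by (simp add: S_def)
qed

end

text \<open>Normalising \<open>\<Phi>\<close> by \<open>A\<close> and \<open>\<Phi>(A)\<close> reduces the inequality to \<open>\<Psi>(D\<^sup>\<nu>) \<le> \<Psi>(D)\<^sup>\<nu>\<close> for
  \<open>D = A\<^sup>-\<^sup>1\<^sup>/\<^sup>2 B A\<^sup>-\<^sup>1\<^sup>/\<^sup>2\<close>.\<close>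

lemma map_geom_mean_le:
  fixes \<Phi> :: "'h::complex_hilbert_space bop \<Rightarrow> 'k::complex_hilbert_space bop"
  assumes lin: "linear_op_map \<Phi>" and pos: "positive_op_map \<Phi>" and unital: "unital_op_map \<Phi>"
    and A: "spos A" and B: "spos B" and \<nu>: "\<nu> \<in> {0..1}"
  shows "\<Phi> (geom_mean \<nu> A B) \<le> geom_mean \<nu> (\<Phi> A) (\<Phi> B)"
proof -
  note A' = map_spos [OF lin pos unital A]
  define S where "S = A powr\<^sub>o (1 / 2)"
  define V where "V = \<Phi> A powr\<^sub>o (1 / 2)"
  define W where "W = \<Phi> A powr\<^sub>o (- (1 / 2))"
  have W: "selfadj W" unfolding W_def by (rule selfadj_powr [OF A'])
  have V: "selfadj V" unfolding V_def by (rule selfadj_powr [OF A'])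
  have S: "selfadj S" unfolding S_def by (rule selfadj_powr [OF A])
  have VW: "V * W = 1" "W * V = 1" "V * (W * R) = R" "W * (V * R) = R" for R
    using A' by (simp_all add: V_def W_def)
  have SS: "S * S = A"
    unfolding S_def by (rule conj_half_one [OF A B])
  have VV: "V * V = \<Phi> A"
    unfolding V_def by (rule conj_half_one [OF A' A'])
  \<comment> \<open>The normalisation of \<open>\<Phi>\<close> that sends \<open>A\<^sup>1\<^sup>/\<^sup>2 X A\<^sup>1\<^sup>/\<^sup>2\<close> to \<open>\<Phi>(A)\<^sup>1\<^sup>/\<^sup>2 \<Psi>(X) \<Phi>(A)\<^sup>1\<^sup>/\<^sup>2\<close>.\<close>
  define \<Psi> where "\<Psi> X = W * \<Phi> (S * X * S) * W" for X
  have \<Psi>: "linear_op_map \<Psi>" "positive_op_map \<Psi>" "unital_op_map \<Psi>"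
  proof -
    have "\<Phi> (c *\<^sub>C X) = c *\<^sub>C \<Phi> X" for c X
      using lin by (simp add: linear_op_map_def)
    then show "linear_op_map \<Psi>"
      by (simp add: linear_op_map_def \<Psi>_def algebra_simps map_linear [OF lin pos unital]
          scaleC_mult_left_bop scaleC_mult_right_bop)
    show "positive_op_map \<Psi>"
      unfolding positive_op_map_def
    proof (intro allI impI)
      fix X :: "'h bop" assume "0 \<le> X"
      from conj_mono [OF S this] have "0 \<le> S * X * S" by simp
      then have "0 \<le> \<Phi> (S * X * S)" using pos by (simp add: positive_op_map_def)
      from conj_mono [OF W this] show "0 \<le> \<Psi> X" by (simp add: \<Psi>_def)
    qed
    show "unital_op_map \<Psi>"
      by (simp add: unital_op_map_def \<Psi>_def SS mult.assoc VW flip: VV)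
  qed
  have \<Phi>_eq: "\<Phi> (S * X * S) = V * \<Psi> X * V" for X
    by (simp add: \<Psi>_def mult.assoc VW)
  define D where "D = geom_ratio A B"
  have D: "spos D" unfolding D_def by (rule spos_geom_ratio [OF A B])
  have "S * D * S = B"
    unfolding S_def D_def by (rule conj_geom_ratio [OF A B])
  then have \<Psi>D: "\<Psi> D = geom_ratio (\<Phi> A) (\<Phi> B)"
    by (simp add: \<Psi>_def geom_ratio_def W_def)
  have "\<Phi> (geom_mean \<nu> A B) = V * \<Psi> (D powr\<^sub>o \<nu>) * V"
    unfolding geom_mean_eq S_def [symmetric] D_def [symmetric] by (rule \<Phi>_eq)
  also have "\<dots> \<le> V * \<Psi> D powr\<^sub>o \<nu> * V"
    by (rule conj_mono [OF V map_powr_le_powr_map [OF \<Psi> D \<nu>]])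
  also have "\<dots> = geom_mean \<nu> (\<Phi> A) (\<Phi> B)"
    by (simp add: geom_mean_eq V_def \<Psi>D)
  finally show ?thesis .
qed

section \<open>Scalar inequalities\<close>

lemma kantorovich_mult: "0 < x \<Longrightarrow> kantorovich x * x = ((1 + x) / 2)\<^sup>2"
  by (simp add: kantorovich_def power2_eq_square)

lemma kantorovich_eq: "0 < x \<Longrightarrow> kantorovich x = (x + 1 / x + 2) / 4"
  by (simp add: kantorovich_def power2_eq_square field_simps)

lemma kantorovich_inverse: "0 < x \<Longrightarrow> kantorovich (1 / x) = kantorovich x"
  by (simp add: kantorovich_eq)

lemma kantorovich_mono:
  assumes "1 \<le> x" "x \<le> y"
  shows "kantorovich x \<le> kantorovich y"
proof -
  have "0 \<le> (y - x) * (x * y - 1)"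
    using assms mult_mono [of 1 x 1 y] by simp
  also have "\<dots> = x * y * ((y + 1 / y) - (x + 1 / x))"
    using assms by (simp add: field_simps)
  finally have "0 \<le> x * y * ((y + 1 / y) - (x + 1 / x))" .
  moreover have "0 < x * y" using assms by simp
  ultimately have "0 \<le> (y + 1 / y) - (x + 1 / x)"
    unfolding zero_le_mult_iff by linarith
  then show ?thesis
    using assms by (simp add: kantorovich_eq)
qed

lemma kantorovich_ge_1: "0 < x \<Longrightarrow> 1 \<le> kantorovich x"
proof -
  assume "0 < x"
  have "4 * x \<le> (1 + x)\<^sup>2"
    using zero_le_power2 [of "x - 1"] by (simp add: power2_eq_square algebra_simps)
  with \<open>0 < x\<close> show ?thesis by (simp add: kantorovich_def)
qed

text \<open>The refined Young inequality of Zuo, Shi and Fujii: split off the midpoint \<open>(1 + x)/2\<close>, whose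
  square is \<open>K(x) x\<close>, before applying the weighted arithmetic-geometric mean inequality.\<close>

lemma Young_kantorovich:
  fixes x :: real
  assumes x: "0 < x" and \<mu>: "0 \<le> \<mu>" "\<mu> \<le> 1"
  shows "kantorovich x powr min \<mu> (1 - \<mu>) * x powr \<mu> \<le> (1 - \<mu>) + \<mu> * x"
proof -
  define z where "z = (1 + x) / 2"
  have z: "0 < z" using x by (simp add: z_def)
  have K: "0 < kantorovich x" using kantorovich_ge_1 [OF x] by simp
  have z_powr: "z powr (2 * a) = kantorovich x powr a * x powr a" for a
  proof -
    have "z powr (2 * a) = (z powr 2) powr a" by (simp add: powr_powr)
    also have "z powr 2 = kantorovich x * x"
      using z kantorovich_mult [OF x] by (simp add: z_def)
    finally show ?thesis using K x by (simp add: powr_mult)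
  qed
  show ?thesis
  proof (cases "\<mu> \<le> 1 / 2")
    case True
    have "1 powr (1 - 2 * \<mu>) * z powr (2 * \<mu>) \<le> (1 - 2 * \<mu>) * 1 + 2 * \<mu> * z"
      using True \<mu> z by (intro Youngs_inequality_0) auto
    moreover have "2 * \<mu> * z = \<mu> + \<mu> * x" by (simp add: z_def field_simps)
    ultimately show ?thesis
      using True by (simp add: z_powr min_def)
  next
    case False
    have "x powr (2 * \<mu> - 1) * z powr (2 * (1 - \<mu>)) \<le> (2 * \<mu> - 1) * x + 2 * (1 - \<mu>) * z"
      using False \<mu> x z by (intro Youngs_inequality_0) auto
    moreover have "x powr (2 * \<mu> - 1) * z powr (2 * (1 - \<mu>)) = kantorovich x powr (1 - \<mu>) * x powr \<mu>"
      unfolding z_powr using x by (simp add: algebra_simps flip: powr_add)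
    moreover have "2 * (1 - \<mu>) * z = (1 - \<mu>) + x - \<mu> * x" by (simp add: z_def field_simps)
    moreover have "(2 * \<mu> - 1) * x = 2 * (\<mu> * x) - x" by (simp add: algebra_simps)
    moreover have "min \<mu> (1 - \<mu>) = 1 - \<mu>" using False by simp
    ultimately show ?thesis by simp
  qed
qed

text \<open>Substituting \<open>x = \<surd>d\<close> with weight \<open>2\<nu>\<close> (or \<open>2\<nu> - 1\<close>) gives the refinement by the difference of
  the unweighted means.\<close>

lemma Young_kantorovich_sqrt:
  fixes d :: real
  assumes d: "0 < d" and \<nu>: "0 \<le> \<nu>" "\<nu> \<le> 1"
  defines "r \<equiv> min \<nu> (1 - \<nu>)"
  shows "kantorovich (sqrt d) powr min (2 * r) (1 - 2 * r) * d powr \<nu>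
      + 2 * r * ((1 + d) / 2 - d powr (1 / 2)) \<le> (1 - \<nu>) + \<nu> * d"
proof -
  define x where "x = sqrt d"
  have x: "0 < x" "x * x = d" "d powr (1 / 2) = x"
    using d by (simp_all add: x_def powr_half_sqrt)
  have d_powr: "d powr a = x powr (2 * a)" for a
  proof -
    have "d powr a = (x powr 2) powr a" using x by (simp add: power2_eq_square)
    then show ?thesis by (simp add: powr_powr)
  qed
  show ?thesis
  proof (cases "\<nu> \<le> 1 / 2")
    case True
    then have "kantorovich x powr min (2 * \<nu>) (1 - 2 * \<nu>) * x powr (2 * \<nu>) \<le> (1 - 2 * \<nu>) + 2 * \<nu> * x"
      using \<nu> x by (intro Young_kantorovich) auto
    moreover have "r = \<nu>" using True by (simp add: r_def)
    moreover have "2 * \<nu> * ((1 + d) / 2 - x) = \<nu> + \<nu> * d - 2 * \<nu> * x"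
      by (simp add: field_simps)
    ultimately show ?thesis
      unfolding x(3) unfolding d_powr x_def [symmetric] by simp
  next
    case False
    define \<mu> where "\<mu> = 2 * \<nu> - 1"
    have "kantorovich x powr min \<mu> (1 - \<mu>) * x powr \<mu> \<le> (1 - \<mu>) + \<mu> * x"
      using False \<nu> x by (intro Young_kantorovich) (auto simp: \<mu>_def)
    then have "x * (kantorovich x powr min \<mu> (1 - \<mu>) * x powr \<mu>) \<le> x * ((1 - \<mu>) + \<mu> * x)"
      using x by (intro mult_left_mono) auto
    moreover have "x * x powr \<mu> = x powr (2 * \<nu>)"
      using x powr_add [of x 1 \<mu>] by (simp add: \<mu>_def)
    moreover have "r = 1 - \<nu>" "min (2 * r) (1 - 2 * r) = min \<mu> (1 - \<mu>)"
      using False by (auto simp: r_def \<mu>_def)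
    moreover have "x * ((1 - \<mu>) + \<mu> * x) = (1 - \<nu>) + \<nu> * d - 2 * (1 - \<nu>) * ((1 + d) / 2 - x)"
      by (simp add: \<mu>_def field_simps flip: x(2))
    moreover have "x * (kantorovich x powr min \<mu> (1 - \<mu>) * x powr \<mu>)
        = kantorovich x powr min \<mu> (1 - \<mu>) * (x * x powr \<mu>)"
      by (simp only: ac_simps)
    ultimately show ?thesis
      unfolding x(3) unfolding d_powr x_def [symmetric] by simp
  qed
qed

text \<open>\<open>K\<close> is increasing on \<open>[1, \<infinity>)\<close> and invariant under inversion, so \<open>K(\<surd>h) \<le> K(\<surd>d)\<close>.\<close>

lemma Young_kantorovich_separated:
  fixes d :: real
  assumes "0 < d" "0 \<le> \<nu>" "\<nu> \<le> 1" "1 \<le> h" and sep: "h \<le> d \<or> d \<le> 1 / h"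
  defines "r \<equiv> min \<nu> (1 - \<nu>)"
  shows "kantorovich (sqrt h) powr min (2 * r) (1 - 2 * r) * d powr \<nu>
      + 2 * r * ((1 + d) / 2 - d powr (1 / 2)) \<le> (1 - \<nu>) + \<nu> * d"
proof -
  have h: "1 \<le> sqrt h" using assms by simp
  have "kantorovich (sqrt h) \<le> kantorovich (sqrt d)"
    using sep
  proof
    assume "h \<le> d"
    then show ?thesis using h by (intro kantorovich_mono) auto
  next
    assume "d \<le> 1 / h"
    then have "sqrt h \<le> 1 / sqrt d"
      using assms by (simp add: real_sqrt_divide [symmetric] field_simps del: real_sqrt_divide)
        (metis mult.commute real_sqrt_le_1_iff real_sqrt_mult)
    then have "kantorovich (sqrt h) \<le> kantorovich (1 / sqrt d)"
      using h by (intro kantorovich_mono) auto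
    then show ?thesis using assms by (simp add: kantorovich_inverse)
  qed
  moreover have "0 \<le> min (2 * r) (1 - 2 * r)" using assms by (auto simp: r_def min_def)
  ultimately have "kantorovich (sqrt h) powr min (2 * r) (1 - 2 * r) * d powr \<nu>
      \<le> kantorovich (sqrt d) powr min (2 * r) (1 - 2 * r) * d powr \<nu>"
    using kantorovich_ge_1 [of "sqrt h"] h by (intro mult_right_mono powr_mono2) auto
  with Young_kantorovich_sqrt [OF assms(1-3)] show ?thesis
    unfolding r_def by linarith
qed

text \<open>A convex function lies below its chord at \<open>\<tau>\<close> and at the reflected point \<open>M + m - \<tau>\<close>.\<close>

lemma powr_sum_endpoints:
  fixes \<tau> :: real
  assumes "0 < m" "\<tau> \<in> {m..M}" "1 \<le> \<alpha>"
  shows "\<tau> powr \<alpha> + (M + m - \<tau>) powr \<alpha> \<le> M powr \<alpha> + m powr \<alpha>"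
proof (cases "m = M")
  case False
  have conv: "convex_on {m..M} (\<lambda>x. x powr \<alpha>)"
    using assms by (intro convex_on_subset [OF powr_convex]) auto
  define k where "k = (M powr \<alpha> - m powr \<alpha>) / (M - m)"
  have "\<tau> powr \<alpha> \<le> k * (\<tau> - m) + m powr \<alpha>"
    unfolding k_def by (rule convex_onD_Icc' [OF conv assms(2)])
  moreover have "(M + m - \<tau>) powr \<alpha> \<le> k * ((M + m - \<tau>) - m) + m powr \<alpha>"
    unfolding k_def by (rule convex_onD_Icc' [OF conv]) (use assms in auto)
  moreover have "k * (\<tau> - m) + k * ((M + m - \<tau>) - m) = k * (M - m)"
    by (simp add: algebra_simps)
  moreover have "k * (M - m) = M powr \<alpha> - m powr \<alpha>"
    using False assms by (simp add: k_def)
  ultimately show ?thesis by linarith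
qed (use assms in simp)

text \<open>The tangent to \<open>s \<mapsto> s powr (\<alpha>/2)\<close> at \<open>s\<^sub>0 = K \<tau>\<^sup>2\<close>, evaluated at \<open>s = t\<^sup>2\<close>, combined with the chord bound
  \<open>t\<^sup>2 \<le> (M + m) t - M m\<close> and the Kantorovich inequality \<open>(M + m) \<tau> - M m \<le> K \<tau>\<^sup>2\<close>.\<close>

lemma powr_le_affine:
  fixes \<tau> :: real
  assumes m: "0 < m" and \<tau>: "\<tau> \<in> {m..M}" and \<alpha>: "0 \<le> \<alpha>" "\<alpha> \<le> 2"
  defines "K \<equiv> kantorovich (M / m)"
  shows "\<exists>k\<ge>0. \<forall>t\<in>{m..M}. t powr \<alpha> \<le> K powr (\<alpha> / 2) * \<tau> powr \<alpha> + k * (t - \<tau>)"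
proof -
  have M: "0 < M" and \<tau>_pos: "0 < \<tau>" using m \<tau> by auto
  have K: "0 < K" using kantorovich_ge_1 [of "M / m"] m M by (simp add: K_def)
  have K_eq: "K = (M + m)\<^sup>2 / (4 * M * m)"
    using m M by (simp add: K_def kantorovich_def power2_eq_square field_simps)
  define s where "s = K * \<tau>\<^sup>2"
  have s: "0 < s" using K \<tau>_pos by (simp add: s_def)
  have s_powr: "s powr (\<alpha> / 2) = K powr (\<alpha> / 2) * \<tau> powr \<alpha>"
  proof -
    have "(\<tau>\<^sup>2) powr (\<alpha> / 2) = (\<tau> powr 2) powr (\<alpha> / 2)" using \<tau>_pos by simp
    also have "\<dots> = \<tau> powr \<alpha>" by (simp add: powr_powr)
    finally show ?thesis using K \<tau>_pos by (simp add: s_def powr_mult)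
  qed
  have le_s: "(M + m) * \<tau> - M * m \<le> s"
  proof -
    have "4 * M * m * ((M + m) * \<tau> - M * m) \<le> ((M + m) * \<tau>)\<^sup>2"
      using zero_le_power2 [of "(M + m) * \<tau> - 2 * M * m"]
      by (simp add: power2_eq_square algebra_simps)
    also have "\<dots> = 4 * M * m * s"
      using m M by (simp add: s_def K_eq power_mult_distrib)
    finally show ?thesis using m M by simp
  qed
  define k where "k = \<alpha> / 2 * s powr (\<alpha> / 2 - 1) * (M + m)"
  have "t powr \<alpha> \<le> K powr (\<alpha> / 2) * \<tau> powr \<alpha> + k * (t - \<tau>)" if t: "t \<in> {m..M}" for t
  proof -
    have t_pos: "0 < t" using t m by auto
    have t2: "(t\<^sup>2) powr (\<alpha> / 2) = t powr \<alpha>"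
    proof -
      have "(t\<^sup>2) powr (\<alpha> / 2) = (t powr 2) powr (\<alpha> / 2)" using t_pos by simp
      then show ?thesis by (simp add: powr_powr)
    qed
    have "0 \<le> (M - t) * (t - m)" using t by simp
    then have "t\<^sup>2 - s \<le> (M + m) * (t - \<tau>)"
      using le_s by (simp add: power2_eq_square algebra_simps)
    then have "\<alpha> / 2 * s powr (\<alpha> / 2 - 1) * (t\<^sup>2 - s) \<le> k * (t - \<tau>)"
      unfolding k_def mult.assoc [of _ "M + m"]
      using \<alpha> by (intro mult_left_mono) auto
    moreover have "t powr \<alpha> \<le> s powr (\<alpha> / 2) + \<alpha> / 2 * s powr (\<alpha> / 2 - 1) * (t\<^sup>2 - s)"
    proof -
      have "(t\<^sup>2) powr (\<alpha> / 2) * s powr (1 - \<alpha> / 2) \<le> \<alpha> / 2 * t\<^sup>2 + (1 - \<alpha> / 2) * s"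
        using \<alpha> t_pos s by (intro Youngs_inequality_0) auto
      then have "s powr (\<alpha> / 2 - 1) * (t powr \<alpha> * s powr (1 - \<alpha> / 2))
          \<le> s powr (\<alpha> / 2 - 1) * (\<alpha> / 2 * t\<^sup>2 + (1 - \<alpha> / 2) * s)"
        unfolding t2 by (intro mult_left_mono) auto
      moreover have "s powr (\<alpha> / 2 - 1) * (t powr \<alpha> * s powr (1 - \<alpha> / 2)) = t powr \<alpha>"
      proof -
        have "s powr (\<alpha> / 2 - 1) * s powr (1 - \<alpha> / 2) = 1"
          using s by (simp flip: powr_add)
        then show ?thesis by (simp add: mult.left_commute)
      qed
      moreover have "s powr (\<alpha> / 2 - 1) * s = s powr (\<alpha> / 2)"
        using s powr_add [of s "\<alpha> / 2 - 1" 1] by simp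
      moreover have "g * (\<alpha> / 2 * t\<^sup>2 + (1 - \<alpha> / 2) * s) = g * s + \<alpha> / 2 * g * (t\<^sup>2 - s)" for g
        by (simp add: field_simps)
      ultimately show ?thesis by simp
    qed
    ultimately show ?thesis unfolding s_powr by linarith
  qed
  moreover have "0 \<le> k" using \<alpha> m M by (simp add: k_def)
  ultimately show ?thesis by blast
qed

section \<open>The Bhatia-Kittaneh inequality\<close>

text \<open>Pair \<open>w = U x + V y\<close> with itself and use the Cauchy-Schwarz inequality for the forms of \<open>U\<close>
  and \<open>V\<close>; the terms \<open>\<langle>U w, w\<rangle> + \<langle>V w, w\<rangle> \<le> \<parallel>w\<parallel>\<^sup>2\<close> are absorbed on the left. (The row \<open>(U\<^sup>1\<^sup>/\<^sup>2, V\<^sup>1\<^sup>/\<^sup>2)\<close> is a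
  contraction.)\<close>

lemma norm_add_apply_le:
  assumes U: "0 \<le> U" and V: "0 \<le> V" and sum: "U + V \<le> 1"
  shows "(norm (bop_apply U x + bop_apply V y))\<^sup>2 \<le> qform U x + qform V y"
proof -
  define w where "w = bop_apply U x + bop_apply V y"
  have cs: "2 * rinner (bop_apply S z) w \<le> qform S z + qform S w" if S: "0 \<le> S" for S z
  proof -
    have "rinner (bop_apply S w) z = rinner (bop_apply S z) w"
      using selfadjD [OF selfadj_of_nonneg [OF S]] rinner_commute by metis
    then have "qform S (z - w) = qform S z + qform S w - 2 * rinner (bop_apply S z) w"
      by (simp add: qform_def rinner_simps)
    moreover have "0 \<le> qform S (z - w)" using S by (simp add: bop_nonneg_iff)
    ultimately show ?thesis by linarith
  qed
  have "2 * (norm w)\<^sup>2 = 2 * rinner (bop_apply U x) w + 2 * rinner (bop_apply V y) w"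
    by (simp add: w_def rinner_self [symmetric] rinner_simps)
  moreover have "qform U w + qform V w \<le> (norm w)\<^sup>2"
    using qform_mono [OF sum, of w] by (simp add: qform_simps)
  ultimately show ?thesis
    using cs [OF U, of x] cs [OF V, of y] unfolding w_def by linarith
qed

text \<open>Suppose \<open>\<lambda> = \<parallel>U V\<parallel>\<close> is attained: \<open>U V g = \<lambda> f\<close> and \<open>V U f = \<lambda> g\<close>. The previous lemma, applied to \<open>V g\<close>
  and \<open>U f\<close>, gives \<open>\<lambda>\<^sup>2 \<parallel>f + g\<parallel>\<^sup>2 \<le> \<lambda> Re \<langle>(U + V) f, g\<rangle>\<close>, while polarisation gives
  \<open>4 Re \<langle>(U + V) f, g\<rangle> \<le> \<parallel>f + g\<parallel>\<^sup>2\<close>; hence \<open>4 \<lambda> \<le> 1\<close>. In general \<open>\<lambda>\<^sup>2\<close> is an approximate eigenvalue of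
  \<open>V U\<^sup>2 V\<close>, and the error \<open>e = V U f - \<lambda> g\<close> is controlled by the descent.\<close>

lemma Bhatia_Kittaneh:
  fixes U V :: "'a::complex_hilbert_space bop"
  assumes U: "0 \<le> U" and V: "0 \<le> V" and sum: "U + V \<le> 1"
  shows "norm (U * V) \<le> 1 / 4"
proof -
  have sU: "selfadj U" and sV: "selfadj V"
    using U V by (auto intro: selfadj_of_nonneg)
  have "U \<le> U + V" using V by simp
  also note sum
  finally have "U \<le> 1" .
  then have U_norm: "(norm (bop_apply U x))\<^sup>2 \<le> qform U x" for x
    using norm_apply_le_qform [OF U, of 1 x] by simp
  have U_contr: "norm (bop_apply U x) \<le> norm x" for x
  proof (rule power2_le_imp_le)
    show "(norm (bop_apply U x))\<^sup>2 \<le> (norm x)\<^sup>2"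
      using U_norm [of x] qform_mono [OF \<open>U \<le> 1\<close>, of x] unfolding qform_simps by linarith
  qed simp
  define G where "G = V * (U * U) * V"
  have sG: "selfadj G"
    unfolding G_def by (intro selfadj_conj selfadj_mult sU sV refl)
  have qG: "qform G x = (norm (bop_apply (U * V) x))\<^sup>2" for x
    by (simp add: G_def qform_conj sV qform_square sU bop_apply_mult)
  have "G \<le> (1 / 16) *\<^sub>R 1"
  proof (rule le_scalar_descent [OF sG])
    fix \<beta> :: real assume \<beta>: "1 / 16 < \<beta>" and G\<beta>: "G \<le> \<beta> *\<^sub>R 1"
    \<comment> \<open>\<open>l\<close> plays the role of \<open>\<lambda>\<close>.\<close>
    define l where "l = sqrt \<beta>"
    have l2: "l * l = \<beta>" using \<beta> by (simp add: l_def)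
    have l: "1 / 4 < l"
      using \<beta> real_sqrt_less_mono [of "1 / 16" \<beta>] by (simp add: l_def real_sqrt_divide)
    define P where "P = \<beta> *\<^sub>R 1 - G"
    define Q where "Q = (4 * l + 1) + (4 * l - 1) * (l + 1)"
    have Q: "0 < Q" using l by (simp add: Q_def add_pos_nonneg)
    have "(4 * l - 1) * \<beta> * l / Q * norm g \<le> norm (bop_apply P g)" for g
    proof (cases "g = 0")
      case False
      define f where "f = (1 / l) *\<^sub>R bop_apply (U * V) g"
      define e where "e = bop_apply (V * U) f - l *\<^sub>R g"
      have f: "bop_apply U (bop_apply V g) = l *\<^sub>R f"
        using l by (simp add: f_def bop_apply_mult)
      have e: "bop_apply V (bop_apply U f) = l *\<^sub>R g + e"
        by (simp add: e_def bop_apply_mult)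
      have Pe: "bop_apply P g = - (l *\<^sub>R e)"
        using l by (simp add: P_def e_def f_def G_def bop_rep_eqs scaleR_diff_right l2)
      have norm_f: "norm f \<le> norm g"
      proof (rule power2_le_imp_le)
        have "\<beta> * (norm f)\<^sup>2 = qform G g"
          using l by (simp add: qG f_def power_divide l2 [symmetric] power2_eq_square)
        also have "\<dots> \<le> \<beta> * (norm g)\<^sup>2"
          using qform_mono [OF G\<beta>, of g] by (simp add: qform_simps)
        finally show "(norm f)\<^sup>2 \<le> (norm g)\<^sup>2" using \<beta> by simp
      qed simp
      define \<sigma> where "\<sigma> = rinner (bop_apply (U + V) f) g"
      have err: "\<bar>rinner e (bop_apply U f)\<bar> \<le> norm e * norm g"
        using abs_rinner_le_norm [of e "bop_apply U f"] U_contr [of f] norm_f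
        by (meson mult_left_mono norm_ge_zero order_trans)
      have forms: "qform U (bop_apply V g) + qform V (bop_apply U f) = l * \<sigma> + rinner e (bop_apply U f)"
      proof -
        have "rinner f (bop_apply V g) = rinner (bop_apply V f) g"
          by (simp add: selfadjD [OF sV])
        moreover have "rinner g (bop_apply U f) = rinner (bop_apply U f) g"
          by (rule rinner_commute)
        ultimately show ?thesis
          by (simp add: qform_def f e rinner_simps \<sigma>_def bop_rep_eqs algebra_simps)
      qed
      \<comment> \<open>Up to multiples of \<open>\<parallel>e\<parallel>\<close>, polarisation and the previous lemma force \<open>\<sigma> \<le> 0\<close> when \<open>4 l > 1\<close>.\<close>
      have "norm (f + g) \<le> 2 * norm g"
        using norm_triangle_ineq [of f g] norm_f by linarith
      have four_\<sigma>: "4 * \<sigma> \<le> (norm (f + g))\<^sup>2"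
      proof -
        have "rinner (bop_apply (U + V) g) f = \<sigma>"
          unfolding \<sigma>_def using selfadjD [of "U + V"] sU sV rinner_commute
          by (metis selfadj_intros(3))
        then have "qform (U + V) (f + g) - qform (U + V) (f - g) = 4 * \<sigma>"
          by (simp add: qform_def rinner_simps \<sigma>_def)
        moreover have "0 \<le> qform (U + V) (f - g)"
          using U V by (simp add: bop_nonneg_iff qform_simps)
        moreover have "qform (U + V) (f + g) \<le> (norm (f + g))\<^sup>2"
          using qform_mono [OF sum, of "f + g"] by (simp add: qform_simps)
        ultimately show ?thesis by linarith
      qed
      have "(norm (l *\<^sub>R (f + g) + e))\<^sup>2 \<le> l * \<sigma> + rinner e (bop_apply U f)"
        using norm_add_apply_le [OF U V sum, of "bop_apply V g" "bop_apply U f"]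
        unfolding forms by (simp add: f e scaleR_add_right add.assoc)
      moreover have "(norm (l *\<^sub>R (f + g) + e))\<^sup>2
          = \<beta> * (norm (f + g))\<^sup>2 + 2 * l * rinner (f + g) e + (norm e)\<^sup>2"
        unfolding rinner_self [symmetric] l2 [symmetric]
        by (simp add: rinner_simps rinner_commute [of e f] rinner_commute [of e g] algebra_simps)
      moreover have "- (2 * norm g * norm e) \<le> rinner (f + g) e"
      proof -
        have "\<bar>rinner (f + g) e\<bar> \<le> norm (f + g) * norm e" by (rule abs_rinner_le_norm)
        also have "\<dots> \<le> 2 * norm g * norm e"
          using \<open>norm (f + g) \<le> 2 * norm g\<close> by (rule mult_right_mono) simp
        finally show ?thesis by linarith
      qed
      then have "2 * l * - (2 * norm g * norm e) \<le> 2 * l * rinner (f + g) e"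
        using l by (intro mult_left_mono) auto
      moreover have "\<beta> * (4 * \<sigma>) \<le> \<beta> * (norm (f + g))\<^sup>2"
        using four_\<sigma> \<beta> by (intro mult_left_mono) auto
      moreover have "0 \<le> (norm e)\<^sup>2" by simp
      ultimately have "\<beta> * (4 * \<sigma>) + 2 * l * - (2 * norm g * norm e) \<le> l * \<sigma> + norm e * norm g"
        using err by linarith
      then have upper: "(4 * l - 1) * (l * \<sigma>) \<le> (4 * l + 1) * (norm e * norm g)"
        unfolding l2 [symmetric] by (simp add: algebra_simps)
      \<comment> \<open>On the other hand \<open>l \<sigma>\<close> is nearly as large as \<open>\<parallel>U V g\<parallel>\<^sup>2\<close>, which is nearly \<open>\<beta> \<parallel>g\<parallel>\<^sup>2\<close>.\<close>
      have "qform G g \<le> qform U (bop_apply V g)"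
        unfolding qG bop_apply_mult by (rule U_norm)
      moreover have "0 \<le> qform V (bop_apply U f)"
        using V by (simp add: bop_nonneg_iff)
      ultimately have "qform G g \<le> l * \<sigma> + norm e * norm g"
        using forms err by linarith
      moreover have "qform G g = \<beta> * (norm g)\<^sup>2 - qform P g"
        by (simp add: P_def qform_simps)
      moreover have "qform P g \<le> l * (norm e * norm g)"
      proof -
        have "qform P g = l * rinner (- e) g"
          by (simp add: qform_def Pe rinner_simps)
        also have "\<dots> \<le> l * (norm e * norm g)"
          using rinner_le_norm [of "- e" g] l by (intro mult_left_mono) auto
        finally show ?thesis .
      qed
      ultimately have lower: "\<beta> * (norm g)\<^sup>2 - (l + 1) * (norm e * norm g) \<le> l * \<sigma>"
        by (simp add: algebra_simps)
      have "(4 * l - 1) * (\<beta> * (norm g)\<^sup>2 - (l + 1) * (norm e * norm g)) \<le> (4 * l - 1) * (l * \<sigma>)"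
        using lower l by (intro mult_left_mono) auto
      also note upper
      finally have "((4 * l - 1) * \<beta> * norm g) * norm g \<le> (Q * norm e) * norm g"
        by (simp add: Q_def power2_eq_square algebra_simps)
      then have "(4 * l - 1) * \<beta> * norm g \<le> Q * norm e"
        using False by simp
      then have "(4 * l - 1) * \<beta> * norm g * l \<le> Q * norm e * l"
        using l by (intro mult_right_mono) auto
      moreover have "norm (bop_apply P g) = l * norm e"
        using l by (simp add: Pe)
      ultimately show ?thesis
        using Q by (simp add: field_simps)
    qed simp
    moreover have "0 < (4 * l - 1) * \<beta> * l / Q"
      using l \<beta> Q by simp
    ultimately show "\<exists>\<kappa>>0. \<forall>x. \<kappa> * norm x \<le> norm (bop_apply (\<beta> *\<^sub>R 1 - G) x)"
      unfolding P_def by blast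
  qed
  show ?thesis
  proof (rule norm_bop_le)
    fix x
    have "(norm (bop_apply (U * V) x))\<^sup>2 \<le> (1 / 4 * norm x)\<^sup>2"
      using qform_mono [OF \<open>G \<le> (1 / 16) *\<^sub>R 1\<close>, of x]
      by (simp add: qG qform_simps power_mult_distrib power_divide)
    then show "norm (bop_apply (U * V) x) \<le> 1 / 4 * norm x"
      by (rule power2_le_imp_le) simp
  qed simp
qed

section \<open>Powers of two operators with bounded sum\<close>

lemma qform_scaleR: "qform T (c *\<^sub>R x) = c\<^sup>2 * qform T x"
  by (simp add: qform_def rinner_simps power2_eq_square)

text \<open>For a unit vector \<open>x\<close> and \<open>\<tau> = \<langle>T x, x\<rangle>\<close> the affine bound from \<open>powr_le_affine\<close> bounds
  \<open>\<langle>T\<^sup>\<alpha> x, x\<rangle>\<close> by a multiple of \<open>\<tau>\<^sup>\<alpha>\<close>, because the affine part has expectation \<open>0\<close>. Larger \<open>\<tau>\<close> are admitted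
  since its slope is nonnegative.\<close>

lemma qform_powr_le:
  fixes T :: "'a::complex_hilbert_space bop"
  assumes m: "0 < m" and T: "bop_between m M T" and \<alpha>: "0 \<le> \<alpha>" "\<alpha> \<le> 2"
    and x: "norm x = 1" and \<tau>: "qform T x \<le> \<tau>" "\<tau> \<in> {m..M}"
  shows "qform (T powr\<^sub>o \<alpha>) x \<le> kantorovich (M / m) powr (\<alpha> / 2) * \<tau> powr \<alpha>"
proof -
  define C where "C = kantorovich (M / m) powr (\<alpha> / 2) * \<tau> powr \<alpha>"
  obtain k where k: "0 \<le> k" "\<And>t. t \<in> {m..M} \<Longrightarrow> t powr \<alpha> \<le> C + k * (t - \<tau>)"
    using powr_le_affine [OF m \<tau>(2) \<alpha>] unfolding C_def by blast
  have "func_calc (\<lambda>t. t powr \<alpha>) T \<le> func_calc (\<lambda>t. (C - k * \<tau>) + k * t) T"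
  proof (rule func_calc_mono [OF T continuous_on_powr_pos [OF m]])
    show "continuous_on {m..M} (\<lambda>t. (C - k * \<tau>) + k * t)" by (intro continuous_intros)
    show "t powr \<alpha> \<le> (C - k * \<tau>) + k * t" if "t \<in> {m..M}" for t
      using k(2) [OF that] by (simp add: algebra_simps)
  qed
  also have "\<dots> = (C - k * \<tau>) *\<^sub>R 1 + k *\<^sub>R T"
    using func_calc_add [OF T continuous_on_const, of "\<lambda>t. k * t" "C - k * \<tau>"]
    by (simp add: func_calc_const [OF T] func_calc_cmult [OF T] func_calc_id [OF T] continuous_intros)
  finally have "qform (T powr\<^sub>o \<alpha>) x \<le> qform ((C - k * \<tau>) *\<^sub>R 1 + k *\<^sub>R T) x"
    unfolding op_powr_def by (rule qform_mono)
  also have "\<dots> = C + k * (qform T x - \<tau>)"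
    by (simp add: qform_simps x algebra_simps)
  also have "\<dots> \<le> C"
    using k(1) \<tau>(1) by (simp add: mult_nonneg_nonpos)
  finally show ?thesis unfolding C_def .
qed

text \<open>For a unit vector and \<open>\<tau> = \<langle>X x, x\<rangle>\<close> the expectation of \<open>Z\<close> is at most \<open>M + m - \<tau>\<close>, which reduces
  the claim to the scalar inequality \<open>powr_sum_endpoints\<close>.\<close>

lemma powr_add_powr_le:
  fixes X Z :: "'a::complex_hilbert_space bop"
  assumes m: "0 < m" and X: "bop_between m M X" and Z: "bop_between m M Z"
    and sum: "X + Z \<le> (M + m) *\<^sub>R 1" and \<alpha>: "1 \<le> \<alpha>" "\<alpha> \<le> 2"
  shows "X powr\<^sub>o \<alpha> + Z powr\<^sub>o \<alpha> \<le> (kantorovich (M / m) powr (\<alpha> / 2) * (M powr \<alpha> + m powr \<alpha>)) *\<^sub>R 1"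
proof (rule bop_leI)
  define K where "K = kantorovich (M / m) powr (\<alpha> / 2)"
  have unit: "qform (X powr\<^sub>o \<alpha> + Z powr\<^sub>o \<alpha>) x \<le> K * (M powr \<alpha> + m powr \<alpha>)" if x: "norm x = 1" for x
  proof -
    define \<tau> where "\<tau> = qform X x"
    have "m \<le> \<tau>" "\<tau> \<le> M"
      using X qform_mono [of "m *\<^sub>R 1" X x] qform_mono [of X "M *\<^sub>R 1" x]
      by (simp_all add: bop_between_def qform_simps x \<tau>_def)
    then have \<tau>: "\<tau> \<in> {m..M}" "M + m - \<tau> \<in> {m..M}" by auto
    have "qform Z x \<le> M + m - \<tau>"
      using qform_mono [OF sum, of x] by (simp add: qform_simps x \<tau>_def)
    then have "qform (Z powr\<^sub>o \<alpha>) x \<le> K * (M + m - \<tau>) powr \<alpha>"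
      unfolding K_def using \<alpha> by (intro qform_powr_le [OF m Z _ _ x _ \<tau>(2)]) auto
    moreover have "qform (X powr\<^sub>o \<alpha>) x \<le> K * \<tau> powr \<alpha>"
      unfolding K_def using \<alpha> by (intro qform_powr_le [OF m X _ _ x _ \<tau>(1)]) (auto simp: \<tau>_def)
    ultimately have "qform (X powr\<^sub>o \<alpha> + Z powr\<^sub>o \<alpha>) x \<le> K * (\<tau> powr \<alpha> + (M + m - \<tau>) powr \<alpha>)"
      by (simp add: qform_simps distrib_left)
    also have "\<dots> \<le> K * (M powr \<alpha> + m powr \<alpha>)"
      by (intro mult_left_mono powr_sum_endpoints m \<tau>(1) \<alpha>(1)) (simp add: K_def)
    finally show ?thesis .
  qed
  fix x
  show "qform (X powr\<^sub>o \<alpha> + Z powr\<^sub>o \<alpha>) x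
      \<le> qform ((kantorovich (M / m) powr (\<alpha> / 2) * (M powr \<alpha> + m powr \<alpha>)) *\<^sub>R 1) x"
  proof (cases "x = 0")
    case False
    then have "qform (X powr\<^sub>o \<alpha> + Z powr\<^sub>o \<alpha>) ((1 / norm x) *\<^sub>R x) \<le> K * (M powr \<alpha> + m powr \<alpha>)"
      by (intro unit) simp
    then show ?thesis
      using False by (simp add: qform_scaleR qform_simps K_def power_divide divide_simps)
  qed (simp add: qform_def)
next
  show "selfadj (X powr\<^sub>o \<alpha> + Z powr\<^sub>o \<alpha>)"
    using spos_between [OF m X] spos_between [OF m Z] by (intro selfadj_intros selfadj_powr)
qed auto

lemma op_powr_le_scaled:
  fixes X :: "'a::complex_hilbert_space bop"
  assumes m: "0 < m" and X: "bop_between m M X" and \<alpha>: "0 \<le> \<alpha>" and t: "1 \<le> t" and \<rho>: "M powr \<alpha> \<le> \<rho>"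
  shows "X powr\<^sub>o (\<alpha> * t) \<le> \<rho> powr (t - 1) *\<^sub>R X powr\<^sub>o \<alpha>"
proof -
  have "X powr\<^sub>o (\<alpha> * t) \<le> func_calc (\<lambda>x. \<rho> powr (t - 1) * x powr \<alpha>) X"
    unfolding op_powr_def
  proof (rule func_calc_mono [OF X continuous_on_powr_pos [OF m]])
    show "continuous_on {m..M} (\<lambda>x. \<rho> powr (t - 1) * x powr \<alpha>)"
      by (intro continuous_on_mult continuous_on_const continuous_on_powr_pos m)
    fix x assume x: "x \<in> {m..M}"
    then have "x powr \<alpha> \<le> \<rho>"
      using m \<alpha> \<rho> powr_mono2 [of \<alpha> x M] by auto
    then have "(x powr \<alpha>) powr (t - 1) * x powr \<alpha> \<le> \<rho> powr (t - 1) * x powr \<alpha>"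
      using t by (intro mult_right_mono powr_mono2) auto
    also have "(x powr \<alpha>) powr (t - 1) * x powr \<alpha> = x powr (\<alpha> * t)"
      by (simp add: powr_powr algebra_simps flip: powr_add)
    finally show "x powr (\<alpha> * t) \<le> \<rho> powr (t - 1) * x powr \<alpha>" .
  qed
  then show ?thesis
    by (simp add: func_calc_cmult [OF X continuous_on_powr_pos [OF m]] op_powr_def)
qed

text \<open>Since \<open>X\<^sup>\<alpha> / \<rho>\<close> and \<open>Z\<^sup>\<alpha> / \<rho>\<close> have sum at most \<open>1\<close>, so do their powers with exponent \<open>q / \<alpha> \<ge> 1\<close>, to which
  the Bhatia-Kittaneh inequality applies.\<close>

lemma norm_powr_mult_powr_le:
  fixes X Z :: "'a::complex_hilbert_space bop"
  assumes m: "0 < m" "m \<le> M" and X: "bop_between m M X" and Z: "bop_between m M Z"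
    and sum: "X + Z \<le> (M + m) *\<^sub>R 1" and \<alpha>: "1 \<le> \<alpha>" "\<alpha> \<le> 2" and q: "\<alpha> \<le> q"
  defines "\<rho> \<equiv> kantorovich (M / m) powr (\<alpha> / 2) * (M powr \<alpha> + m powr \<alpha>)"
  shows "norm (X powr\<^sub>o q * Z powr\<^sub>o q) \<le> \<rho> powr (2 * q / \<alpha>) / 4"
proof -
  define t where "t = q / \<alpha>"
  have t: "1 \<le> t" "\<alpha> * t = q" using \<alpha> q by (simp_all add: t_def)
  have "1 \<le> kantorovich (M / m) powr (\<alpha> / 2)"
    using kantorovich_ge_1 [of "M / m"] m \<alpha> by (intro ge_one_powr_ge_zero) auto
  then have \<rho>: "M powr \<alpha> \<le> \<rho>" "0 < \<rho>"
    using mult_mono [of 1 "kantorovich (M / m) powr (\<alpha> / 2)" "M powr \<alpha>" "M powr \<alpha> + m powr \<alpha>"] m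
    unfolding \<rho>_def by (auto intro!: mult_pos_pos add_pos_pos)
  have sX: "spos X" and sZ: "spos Z" using X Z m(1) by (auto intro: spos_between)
  define U where "U = \<rho> powr (- t) *\<^sub>R X powr\<^sub>o q"
  define V where "V = \<rho> powr (- t) *\<^sub>R Z powr\<^sub>o q"
  have "X powr\<^sub>o q + Z powr\<^sub>o q \<le> \<rho> powr (t - 1) *\<^sub>R X powr\<^sub>o \<alpha> + \<rho> powr (t - 1) *\<^sub>R Z powr\<^sub>o \<alpha>"
    unfolding t(2) [symmetric] using \<alpha>
    by (intro add_mono op_powr_le_scaled [OF m(1) X _ t(1) \<rho>(1)]
        op_powr_le_scaled [OF m(1) Z _ t(1) \<rho>(1)]) auto
  also have "\<dots> \<le> \<rho> powr (t - 1) *\<^sub>R (\<rho> *\<^sub>R 1)"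
    unfolding scaleR_add_right [symmetric] \<rho>_def
    by (intro scaleR_left_mono powr_add_powr_le m(1) X Z sum \<alpha>) simp
  also have "\<dots> = \<rho> powr t *\<^sub>R 1"
    using \<rho>(2) powr_add [of \<rho> "t - 1" 1] by simp
  finally have "\<rho> powr (- t) *\<^sub>R (X powr\<^sub>o q + Z powr\<^sub>o q) \<le> \<rho> powr (- t) *\<^sub>R (\<rho> powr t *\<^sub>R 1)"
    by (rule scaleR_left_mono) simp
  also have "\<dots> = 1"
    using \<rho>(2) by (simp flip: powr_add)
  finally have "U + V \<le> 1"
    by (simp add: U_def V_def scaleR_add_right)
  moreover have "0 \<le> U" "0 \<le> V"
    unfolding U_def V_def
    by (rule scaleR_nonneg_nonneg; simp add: spos_nonneg spos_powr sX sZ)+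
  ultimately have "norm (U * V) \<le> 1 / 4"
    by (intro Bhatia_Kittaneh)
  moreover have "U * V = \<rho> powr (- (2 * t)) *\<^sub>R (X powr\<^sub>o q * Z powr\<^sub>o q)"
    by (simp add: U_def V_def flip: powr_add)
  ultimately have "\<rho> powr (- (2 * t)) * norm (X powr\<^sub>o q * Z powr\<^sub>o q) \<le> 1 / 4"
    by simp
  then have "\<rho> powr (2 * t) * (\<rho> powr (- (2 * t)) * norm (X powr\<^sub>o q * Z powr\<^sub>o q)) \<le> \<rho> powr (2 * t) * (1 / 4)"
    by (rule mult_left_mono) simp
  moreover have "\<rho> powr (2 * t) * \<rho> powr (- (2 * t)) = 1"
    using \<rho>(2) by (simp flip: powr_add)
  ultimately show ?thesis
    by (simp add: t_def mult.assoc [symmetric])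
qed

lemma powr_le_of_norm_le:
  fixes X Z :: "'a::complex_hilbert_space bop"
  assumes X: "spos X" and Z: "spos Z" and norm: "norm (X powr\<^sub>o q * Z powr\<^sub>o q) \<le> N"
  shows "X powr\<^sub>o (2 * q) \<le> N\<^sup>2 *\<^sub>R Z powr\<^sub>o (- (2 * q))"
proof (rule bop_leI)
  fix x
  \<comment> \<open>Substitute \<open>x = Z\<^sup>q w\<close>.\<close>
  define w where "w = bop_apply (Z powr\<^sub>o (- q)) x"
  have x: "x = bop_apply (Z powr\<^sub>o q) w"
    using Z by (simp add: w_def one_bop.rep_eq flip: bop_apply_mult)
  have "qform (X powr\<^sub>o (2 * q)) x = (norm (bop_apply (X powr\<^sub>o q) x))\<^sup>2"
    unfolding powr_conj_powr [OF X, symmetric] by (rule qform_square [OF selfadj_powr [OF X]])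
  also have "bop_apply (X powr\<^sub>o q) x = bop_apply (X powr\<^sub>o q * Z powr\<^sub>o q) w"
    by (subst x) (simp add: bop_apply_mult)
  also have "(norm \<dots>)\<^sup>2 \<le> (N * norm w)\<^sup>2"
  proof (rule power_mono)
    show "norm (bop_apply (X powr\<^sub>o q * Z powr\<^sub>o q) w) \<le> N * norm w"
      by (rule order_trans [OF norm_bop_apply mult_right_mono [OF norm norm_ge_zero]])
  qed simp
  also have "\<dots> = N\<^sup>2 * qform (Z powr\<^sub>o (- q) * Z powr\<^sub>o (- q)) x"
    unfolding qform_square [OF selfadj_powr [OF Z]] w_def by (rule power_mult_distrib)
  also have "Z powr\<^sub>o (- q) * Z powr\<^sub>o (- q) = Z powr\<^sub>o (- (2 * q))"
    by (simp add: powr_conj_powr [OF Z])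
  finally show "qform (X powr\<^sub>o (2 * q)) x \<le> qform (N\<^sup>2 *\<^sub>R Z powr\<^sub>o (- (2 * q))) x"
    by (simp add: qform_simps)
qed (auto intro!: selfadj_powr X Z)

text \<open>The passage from a bound on \<open>X + M m \<kappa> Y\<^sup>-\<^sup>1\<close> to \<open>X\<^sup>p \<le> C Y\<^sup>p\<close>. Both \<open>X\<close> and \<open>Z = M m \<kappa> Y\<^sup>-\<^sup>1\<close> lie between
  \<open>m\<close> and \<open>M\<close>: each is at least \<open>m\<close> and their sum is at most \<open>M + m\<close>.\<close>

lemma powr_le_of_add_inverse_le:
  fixes X Y :: "'a::complex_hilbert_space bop"
  assumes m: "0 < m" "m \<le> M" and X: "m *\<^sub>R 1 \<le> X" and Y: "spos Y" "Y \<le> M *\<^sub>R 1" and \<kappa>: "1 \<le> \<kappa>"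
    and sum: "X + (M * m * \<kappa>) *\<^sub>R inverse_op Y \<le> (M + m) *\<^sub>R 1"
    and \<alpha>: "1 \<le> \<alpha>" "\<alpha> \<le> 2" and p: "2 * \<alpha> \<le> p"
  defines "\<rho> \<equiv> kantorovich (M / m) powr (\<alpha> / 2) * (M powr \<alpha> + m powr \<alpha>)"
  shows "X powr\<^sub>o p \<le> (\<rho> powr (2 * p / \<alpha>) / 16 * (M * m * \<kappa>) powr (- p)) *\<^sub>R Y powr\<^sub>o p"
proof -
  define c where "c = M * m * \<kappa>"
  have c: "0 < c" using m \<kappa> by (simp add: c_def)
  define Z where "Z = c *\<^sub>R inverse_op Y"
  have sZ: "spos Z"
    unfolding Z_def by (intro spos_scaleR spos_inverse_op Y c)
  have "spos X" using m X by (intro sposI [of m])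
  have mZ: "m *\<^sub>R 1 \<le> Z"
  proof -
    obtain l where l: "0 < l" "l *\<^sub>R 1 \<le> Y" using Y(1) by (auto simp: spos_def)
    have "(1 / M) *\<^sub>R 1 \<le> inverse_op Y"
      using inverse_op_scalar_le [of l M Y] l Y(2) by (simp add: bop_between_def)
    then have "c *\<^sub>R ((1 / M) *\<^sub>R 1) \<le> Z"
      unfolding Z_def using c by (intro scaleR_left_mono) auto
    moreover have "c * (1 / M) = m * \<kappa>" using m by (simp add: c_def)
    ultimately have "(m * \<kappa>) *\<^sub>R 1 \<le> Z" by simp
    moreover have "m *\<^sub>R 1 \<le> (m * \<kappa>) *\<^sub>R (1 :: 'a bop)"
      using m \<kappa> by (intro scalar_bop_mono) simp
    ultimately show ?thesis by (rule order_trans [rotated])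
  qed
  have sum': "X + Z \<le> (M + m) *\<^sub>R 1"
    using sum by (simp add: Z_def c_def)
  have "X + m *\<^sub>R 1 \<le> (M + m) *\<^sub>R 1"
    using add_left_mono [OF mZ] sum' by (rule order_trans)
  then have XM: "X \<le> M *\<^sub>R 1"
    by (simp add: scaleR_add_left)
  have "m *\<^sub>R 1 + Z \<le> (M + m) *\<^sub>R 1"
    using add_right_mono [OF X] sum' by (rule order_trans)
  then have ZM: "Z \<le> M *\<^sub>R 1"
    by (simp add: scaleR_add_left add.commute [of "M *\<^sub>R 1"])
  have "norm (X powr\<^sub>o (p / 2) * Z powr\<^sub>o (p / 2)) \<le> \<rho> powr (p / \<alpha>) / 4"
    using norm_powr_mult_powr_le [of m M X Z \<alpha> "p / 2"] X XM mZ ZM m sum' \<alpha> p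
    by (simp add: bop_between_def \<rho>_def)
  from powr_le_of_norm_le [OF \<open>spos X\<close> sZ this]
  have "X powr\<^sub>o p \<le> (\<rho> powr (p / \<alpha>) / 4)\<^sup>2 *\<^sub>R Z powr\<^sub>o (- p)"
    by simp
  also have "Z powr\<^sub>o (- p) = c powr (- p) *\<^sub>R Y powr\<^sub>o p"
    unfolding Z_def using c Y(1)
    by (simp add: op_powr_scaleR spos_inverse_op inverse_op_eq_powr op_powr_powr spos_powr)
  also have "(\<rho> powr (p / \<alpha>) / 4)\<^sup>2 = \<rho> powr (2 * p / \<alpha>) / 16"
    by (simp add: power2_eq_square flip: powr_add)
  finally show ?thesis by (simp add: c_def)
qed

section \<open>Kantorovich inequalities for positive unital maps\<close>

lemma geom_mean_le_arith_mean:
  fixes X Y :: "'a::complex_hilbert_space bop"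
  assumes X: "spos X" and Y: "spos Y" and \<nu>: "0 \<le> \<nu>" "\<nu> \<le> 1"
  shows "geom_mean \<nu> X Y \<le> arith_mean \<nu> X Y"
proof -
  obtain a b where "0 < a" "bop_between a b (geom_ratio X Y)"
    using sposE [OF spos_geom_ratio [OF X Y]] .
  moreover have "1 * d powr \<nu> + 0 * ((1 + d) / 2 - d powr (1 / 2)) \<le> (1 - \<nu>) + \<nu> * d"
    if "d \<in> {a..b}" for d
    using Youngs_inequality_0 [of "1 - \<nu>" \<nu> 1 d] that \<nu> \<open>0 < a\<close> by simp
  ultimately show ?thesis
    using geom_mean_le_transfer [OF X Y, of a b 1 \<nu> 0] by simp
qed

lemma arith_mean_le_scalar:
  assumes "X \<le> M *\<^sub>R 1" "Y \<le> M *\<^sub>R 1" "0 \<le> \<nu>" "\<nu> \<le> 1"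
  shows "arith_mean \<nu> X Y \<le> M *\<^sub>R (1 :: 'a::complex_inner_space bop)"
proof -
  have "arith_mean \<nu> X Y \<le> (1 - \<nu>) *\<^sub>R (M *\<^sub>R 1) + \<nu> *\<^sub>R (M *\<^sub>R 1)"
    unfolding arith_mean_def using assms by (intro add_mono scaleR_left_mono) auto
  then show ?thesis by (simp flip: scaleR_add_left) (simp add: algebra_simps)
qed

lemma scalar_le_arith_mean:
  assumes "m *\<^sub>R 1 \<le> X" "m *\<^sub>R 1 \<le> Y" "0 \<le> \<nu>" "\<nu> \<le> 1"
  shows "m *\<^sub>R (1 :: 'a::complex_inner_space bop) \<le> arith_mean \<nu> X Y"
proof -
  have "(1 - \<nu>) *\<^sub>R (m *\<^sub>R 1) + \<nu> *\<^sub>R (m *\<^sub>R 1) \<le> arith_mean \<nu> X Y"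
    unfolding arith_mean_def using assms by (intro add_mono scaleR_left_mono) auto
  then show ?thesis by (simp flip: scaleR_add_left) (simp add: algebra_simps)
qed

lemma add_scaled_inverse_le:
  fixes T :: "'a::complex_hilbert_space bop"
  assumes m: "0 < m" and T: "bop_between m M T"
  shows "T + (M * m) *\<^sub>R inverse_op T \<le> (M + m) *\<^sub>R 1"
proof -
  have "func_calc (\<lambda>t. t + (M * m) * t powr (- 1)) T \<le> func_calc (\<lambda>_. M + m) T"
  proof (rule func_calc_mono [OF T])
    fix t assume t: "t \<in> {m..M}"
    then have "0 \<le> (M - t) * (t - m)" by simp
    then show "t + (M * m) * t powr (- 1) \<le> M + m"
      using t m by (simp add: powr_minus field_simps)
  qed (intro continuous_intros; use m in auto)+
  also have "func_calc (\<lambda>t. t + (M * m) * t powr (- 1)) T = T + (M * m) *\<^sub>R T powr\<^sub>o (- 1)"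
    using func_calc_add [OF T continuous_on_id
        continuous_on_mult [OF continuous_on_const continuous_on_powr_pos [OF m]], of "M * m" "- 1"]
    by (simp only: op_powr_def func_calc_id [OF T] func_calc_cmult [OF T continuous_on_powr_pos [OF m]])
  finally show ?thesis
    by (simp add: func_calc_const [OF T] inverse_op_eq_powr [OF spos_between [OF m T]])
qed

lemma geom_ratio_inverse_between:
  fixes A B :: "'a::complex_hilbert_space bop"
  assumes m: "0 < m\<^sub>1" "0 < m\<^sub>2" "m\<^sub>2 \<le> M\<^sub>2" and A: "bop_between m\<^sub>1 M\<^sub>1 A" and B: "bop_between m\<^sub>2 M\<^sub>2 B"
  shows "bop_between (m\<^sub>1 / M\<^sub>2) (M\<^sub>1 / m\<^sub>2) (geom_ratio (inverse_op A) (inverse_op B))"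
proof -
  have sA: "spos A" using m(1) A by (rule spos_between)
  define S where "S = A powr\<^sub>o (1 / 2)"
  have S: "selfadj S" unfolding S_def by (rule selfadj_powr [OF sA])
  have SS: "S * S = A" unfolding S_def by (rule conj_half_one [OF sA sA])
  have ratio: "geom_ratio (inverse_op A) (inverse_op B) = S * inverse_op B * S"
    using sA by (simp add: geom_ratio_def S_def inverse_op_eq_powr op_powr_powr)
  have B': "(1 / M\<^sub>2) *\<^sub>R 1 \<le> inverse_op B" "inverse_op B \<le> (1 / m\<^sub>2) *\<^sub>R 1"
    using inverse_op_scalar_le [OF m(2) B] by (simp_all add: bop_between_def)
  have "(m\<^sub>1 / M\<^sub>2) *\<^sub>R 1 = (1 / M\<^sub>2) *\<^sub>R (m\<^sub>1 *\<^sub>R (1 :: 'a bop))" by simp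
  also have "\<dots> \<le> (1 / M\<^sub>2) *\<^sub>R A"
    using A m by (intro scaleR_left_mono) (auto simp: bop_between_def)
  also have "\<dots> \<le> S * inverse_op B * S"
    using conj_mono [OF S B'(1)] by (simp add: SS)
  finally have lower: "(m\<^sub>1 / M\<^sub>2) *\<^sub>R 1 \<le> S * inverse_op B * S" .
  have "S * inverse_op B * S \<le> (1 / m\<^sub>2) *\<^sub>R A"
    using conj_mono [OF S B'(2)] by (simp add: SS)
  also have "\<dots> \<le> (1 / m\<^sub>2) *\<^sub>R (M\<^sub>1 *\<^sub>R 1)"
    using A m by (intro scaleR_left_mono) (auto simp: bop_between_def)
  finally show ?thesis
    using lower by (simp add: bop_between_def ratio)
qed

text \<open>Written in this way, the constant is the bound \<open>\<rho>\<^bsup>2p/\<alpha>\<^esup> / 16\<close> times the factor \<open>(M m \<kappa>)\<^sup>-\<^sup>p\<close> that comes from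
  \<open>Z\<^sup>-\<^sup>p = (M m \<kappa>)\<^sup>-\<^sup>p Y\<^sup>p\<close>.\<close>

lemma kantorovich_constant_eq:
  fixes m M k K s r\<^sub>1 \<alpha> p :: real
  assumes "0 < m" "0 < M" "1 \<le> k" "0 < \<alpha>"
  shows "(k powr (- (r\<^sub>1 * \<alpha> / 2)) * K * s) powr (2 * p / \<alpha>) / (16 * M powr p * m powr p)
    = (K * s) powr (2 * p / \<alpha>) / 16 * (M * m * k powr r\<^sub>1) powr (- p)"
proof -
  have "(k powr (- (r\<^sub>1 * \<alpha> / 2))) powr (2 * p / \<alpha>) = k powr (- (r\<^sub>1 * p))"
    using assms by (simp add: powr_powr)
  moreover have "(k powr (- (r\<^sub>1 * \<alpha> / 2)) * (K * s)) powr (2 * p / \<alpha>)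
      = (k powr (- (r\<^sub>1 * \<alpha> / 2))) powr (2 * p / \<alpha>) * (K * s) powr (2 * p / \<alpha>)"
    by (rule powr_mult)
  ultimately have "(k powr (- (r\<^sub>1 * \<alpha> / 2)) * K * s) powr (2 * p / \<alpha>)
      = k powr (- (r\<^sub>1 * p)) * (K * s) powr (2 * p / \<alpha>)"
    by (simp only: mult.assoc)
  moreover have "(M * m * k powr r\<^sub>1) powr (- p) = k powr (- (r\<^sub>1 * p)) / (M powr p * m powr p)"
    using assms by (simp add: powr_mult powr_powr powr_minus divide_inverse)
  ultimately show ?thesis
    by (simp only: times_divide_times_eq) (simp only: ac_simps)
qed

theorem theorem2p11:
  fixes A B :: "'h::complex_hilbert_space bop"
    and \<Phi> :: "'h bop \<Rightarrow> 'k::complex_hilbert_space bop"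
    and m m' M M' \<alpha> p \<nu> r r\<^sub>1 h h' :: real
  assumes "0 \<le> A" and "0 \<le> B"
    and "0 < m" and "0 < m'" and "0 < M" and "0 < M'"
    and "(m *\<^sub>R 1 \<le> B \<and> B \<le> m' *\<^sub>R 1 \<and> m' < M' \<and> M' *\<^sub>R 1 \<le> A \<and> A \<le> M *\<^sub>R 1) \<or>
         (m *\<^sub>R 1 \<le> A \<and> A \<le> m' *\<^sub>R 1 \<and> m' < M' \<and> M' *\<^sub>R 1 \<le> B \<and> B \<le> M *\<^sub>R 1)"
    and "1 \<le> \<alpha>" and "\<alpha> \<le> 2" and "2 * \<alpha> \<le> p"
    and "linear_op_map \<Phi>" and "positive_op_map \<Phi>" and "unital_op_map \<Phi>"
    and "0 \<le> \<nu>" and "\<nu> \<le> 1"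
    and "r = min \<nu> (1 - \<nu>)" and "r\<^sub>1 = min (2 * r) (1 - 2 * r)"
    and "h = M / m" and "h' = M' / m'"
  shows
    "(\<Phi> (arith_mean \<nu> A B + (2 * r * M * m) *\<^sub>R
          (arith_mean (1/2) (inverse_op A) (inverse_op B)
             - geom_mean (1/2) (inverse_op A) (inverse_op B)))) powr\<^sub>o p
       \<le> ((kantorovich (sqrt h') powr (- (r\<^sub>1 * \<alpha> / 2)) * kantorovich h powr (\<alpha> / 2)
             * (M powr \<alpha> + m powr \<alpha>)) powr (2 * p / \<alpha>) / (16 * M powr p * m powr p))
          *\<^sub>R (\<Phi> (geom_mean \<nu> A B)) powr\<^sub>o p
     \<and>
     (\<Phi> (arith_mean \<nu> A B + (2 * r * M * m) *\<^sub>R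
          (arith_mean (1/2) (inverse_op A) (inverse_op B)
             - geom_mean (1/2) (inverse_op A) (inverse_op B)))) powr\<^sub>o p
       \<le> ((kantorovich (sqrt h') powr (- (r\<^sub>1 * \<alpha> / 2)) * kantorovich h powr (\<alpha> / 2)
             * (M powr \<alpha> + m powr \<alpha>)) powr (2 * p / \<alpha>) / (16 * M powr p * m powr p))
          *\<^sub>R (geom_mean \<nu> (\<Phi> A) (\<Phi> B)) powr\<^sub>o p"
proof (cases "\<forall>S R :: 'k bop. S = R")
  case True
  \<comment> \<open>The zero space has to be treated separately: there \<open>m \<le> m'\<close> and \<open>M' \<le> M\<close> do not follow from the
    operator bounds.\<close>
  have "S \<le> R" for S R :: "'k bop"
    using True order_refl by metis
  then show ?thesis by blast
next
  case False
  note map = assms(11-13)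
  have nontrivial: "\<not> (\<forall>S R :: 'h bop. S = R)"
  proof
    assume "\<forall>S R :: 'h bop. S = R"
    then have "(1 :: 'h bop) = 0" by blast
    then have "(1 :: 'k bop) = 0"
      using map_one [OF map] map_linear(3) [OF map] by metis
    then have "S = 0" for S :: "'k bop" by (metis mult.right_neutral mult_zero_right)
    then show False using False by metis
  qed
  have m: "0 < m" "0 < m'" "0 < M" "0 < M'" using assms by auto
  have \<nu>: "0 \<le> \<nu>" "\<nu> \<le> 1" using assms by auto
  have ord: "m \<le> m'" "m' < M'" "M' \<le> M"
    using assms(7) between_imp_le_or_trivial [of m m' B] between_imp_le_or_trivial [of m m' A] between_imp_le_or_trivial [of M' M A]
      between_imp_le_or_trivial [of M' M B] nontrivial by (auto simp: bop_between_def)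
  have r: "0 \<le> r" using assms by simp
  have r1: "0 \<le> r\<^sub>1" using assms(14-17) by (auto simp: min_def)
  have h': "1 \<le> h'" using ord m by (simp add: assms)
  have scalars: "m *\<^sub>R 1 \<le> m' *\<^sub>R (1 :: 'h bop)" "m *\<^sub>R 1 \<le> M' *\<^sub>R (1 :: 'h bop)"
    "m' *\<^sub>R 1 \<le> M *\<^sub>R (1 :: 'h bop)" "M' *\<^sub>R 1 \<le> M *\<^sub>R (1 :: 'h bop)"
    using ord by (auto intro: scalar_bop_mono)
  have A: "bop_between m M A" and B: "bop_between m M B"
    using assms(7) scalars unfolding bop_between_def by (meson order_trans)+
  have sA: "spos A" and sB: "spos B" using A B m by (auto intro: spos_between)
  define X where "X = inverse_op A"
  define Y where "Y = inverse_op B"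
  have sX: "spos X" and sY: "spos Y" unfolding X_def Y_def by (auto intro: spos_inverse_op sA sB)
  define \<kappa> where "\<kappa> = kantorovich (sqrt h') powr r\<^sub>1"
  have K': "1 \<le> kantorovich (sqrt h')" using h' by (intro kantorovich_ge_1) simp
  then have \<kappa>: "1 \<le> \<kappa>" using r1 unfolding \<kappa>_def by (intro ge_one_powr_ge_zero)

  \<comment> \<open>The gap between the two spectra keeps \<open>X\<^sup>-\<^sup>1\<^sup>/\<^sup>2 Y X\<^sup>-\<^sup>1\<^sup>/\<^sup>2\<close> on one side of the interval \<open>(1/h', h')\<close>.\<close>
  obtain a b where ab: "0 < a" "bop_between a b (geom_ratio X Y)"
    and sep: "\<And>d. d \<in> {a..b} \<Longrightarrow> h' \<le> d \<or> d \<le> 1 / h'"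
    using assms(7)
  proof
    assume "m *\<^sub>R 1 \<le> B \<and> B \<le> m' *\<^sub>R 1 \<and> m' < M' \<and> M' *\<^sub>R 1 \<le> A \<and> A \<le> M *\<^sub>R 1"
    then have "bop_between (M' / m') (M / m) (geom_ratio X Y)"
      unfolding X_def Y_def using m ord
      by (intro geom_ratio_inverse_between) (auto simp: bop_between_def)
    then show thesis using m by (intro that [of "M' / m'" "M / m"]) (auto simp: assms)
  next
    assume "m *\<^sub>R 1 \<le> A \<and> A \<le> m' *\<^sub>R 1 \<and> m' < M' \<and> M' *\<^sub>R 1 \<le> B \<and> B \<le> M *\<^sub>R 1"
    then have "bop_between (m / M) (m' / M') (geom_ratio X Y)"
      unfolding X_def Y_def using m ord
      by (intro geom_ratio_inverse_between) (auto simp: bop_between_def)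
    then show thesis using m by (intro that [of "m / M" "m' / M'"]) (auto simp: assms)
  qed
  define E where "E = arith_mean (1 / 2) X Y - geom_mean (1 / 2) X Y"
  have Young: "\<kappa> *\<^sub>R geom_mean \<nu> X Y + (2 * r) *\<^sub>R E \<le> arith_mean \<nu> X Y"
    unfolding E_def
  proof (rule geom_mean_le_transfer [OF sX sY ab(2,1)])
    fix d assume d: "d \<in> {a..b}"
    then show "\<kappa> * d powr \<nu> + 2 * r * ((1 + d) / 2 - d powr (1 / 2)) \<le> (1 - \<nu>) + \<nu> * d"
      unfolding \<kappa>_def assms(16,17) using ab(1) \<nu> h' sep [OF d]
      by (intro Young_kantorovich_separated) auto
  qed
  have E: "0 \<le> E"
    unfolding E_def using geom_mean_le_arith_mean [OF sX sY, of "1 / 2"] by simp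

  define G where "G = geom_mean \<nu> A B"
  have sG: "spos G" unfolding G_def by (rule spos_geom_mean [OF sA sB])
  have inv_G: "inverse_op G = geom_mean \<nu> X Y"
    unfolding G_def X_def Y_def by (rule inverse_geom_mean [OF sA sB])
  define L where "L = arith_mean \<nu> A B + (2 * r * M * m) *\<^sub>R E"
  have key: "L + (M * m * \<kappa>) *\<^sub>R inverse_op G \<le> (M + m) *\<^sub>R 1"
  proof -
    have "L + (M * m * \<kappa>) *\<^sub>R inverse_op G
        = arith_mean \<nu> A B + (M * m) *\<^sub>R (\<kappa> *\<^sub>R geom_mean \<nu> X Y + (2 * r) *\<^sub>R E)"
      by (simp add: L_def inv_G algebra_simps)
    also have "\<dots> \<le> arith_mean \<nu> A B + (M * m) *\<^sub>R arith_mean \<nu> X Y"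
      using Young m by (intro add_left_mono scaleR_left_mono) auto
    also have "\<dots> = arith_mean \<nu> (A + (M * m) *\<^sub>R X) (B + (M * m) *\<^sub>R Y)"
      by (simp add: arith_mean_def algebra_simps)
    also have "\<dots> \<le> (M + m) *\<^sub>R 1"
      unfolding X_def Y_def
      by (intro arith_mean_le_scalar add_scaled_inverse_le m A B \<nu>)
    finally show ?thesis .
  qed
  have "m *\<^sub>R 1 + 0 \<le> L"
    unfolding L_def
  proof (rule add_mono)
    show "m *\<^sub>R 1 \<le> arith_mean \<nu> A B"
      using A B \<nu> by (intro scalar_le_arith_mean) (auto simp: bop_between_def)
    show "0 \<le> (2 * r * M * m) *\<^sub>R E"
      using r m E by (intro scaleR_nonneg_nonneg) auto
  qed
  then have \<Phi>L: "m *\<^sub>R 1 \<le> \<Phi> L"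
    using map_mono [OF map, of "m *\<^sub>R 1" L] by (simp add: map_linear [OF map] map_one [OF map])

  \<comment> \<open>Both choices of \<open>W\<close>, namely \<open>\<Phi> G\<close> and the mean of \<open>\<Phi> A\<close> and \<open>\<Phi> B\<close>, satisfy these hypotheses.\<close>
  have conclude: "\<Phi> L powr\<^sub>o p
      \<le> ((kantorovich (sqrt h') powr (- (r\<^sub>1 * \<alpha> / 2)) * kantorovich h powr (\<alpha> / 2)
             * (M powr \<alpha> + m powr \<alpha>)) powr (2 * p / \<alpha>) / (16 * M powr p * m powr p)) *\<^sub>R W powr\<^sub>o p"
    if W: "\<Phi> G \<le> W" "W \<le> M *\<^sub>R 1" for W
  proof -
    note s\<Phi>G = map_spos [OF map sG]
    have sW: "spos W" using s\<Phi>G W(1) by (rule spos_mono)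
    have "inverse_op W \<le> inverse_op (\<Phi> G)"
      using s\<Phi>G W(1) by (rule inverse_op_antimono)
    also have "\<dots> \<le> \<Phi> (inverse_op G)"
      by (rule inverse_map_le_map_inverse [OF map sG])
    finally have "\<Phi> L + (M * m * \<kappa>) *\<^sub>R inverse_op W \<le> \<Phi> L + (M * m * \<kappa>) *\<^sub>R \<Phi> (inverse_op G)"
      using m \<kappa> by (intro add_left_mono scaleR_left_mono) auto
    also have "\<dots> \<le> (M + m) *\<^sub>R 1"
      using map_mono [OF map key] by (simp add: map_linear [OF map] map_one [OF map])
    finally have "\<Phi> L powr\<^sub>o p \<le> ((kantorovich (M / m) powr (\<alpha> / 2) * (M powr \<alpha> + m powr \<alpha>)) powr (2 * p / \<alpha>)
        / 16 * (M * m * \<kappa>) powr (- p)) *\<^sub>R W powr\<^sub>o p"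
      using m ord assms(8-10)
      by (intro powr_le_of_add_inverse_le \<Phi>L sW W(2) \<kappa>) auto
    then show ?thesis
      using kantorovich_constant_eq [OF m(1,3) K', of \<alpha> r\<^sub>1 "kantorovich (M / m) powr (\<alpha> / 2)"
          "M powr \<alpha> + m powr \<alpha>" p] assms(8)
      unfolding \<kappa>_def assms(18) by (simp only:)
  qed
  have "G \<le> M *\<^sub>R 1"
  proof -
    have "G \<le> arith_mean \<nu> A B"
      unfolding G_def by (rule geom_mean_le_arith_mean [OF sA sB \<nu>])
    also have "\<dots> \<le> M *\<^sub>R 1"
      using A B \<nu> by (intro arith_mean_le_scalar) (auto simp: bop_between_def)
    finally show ?thesis .
  qed
  then have "\<Phi> G \<le> M *\<^sub>R 1"
    using map_mono [OF map, of G "M *\<^sub>R 1"] by (simp add: map_linear [OF map] map_one [OF map])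
  moreover have "geom_mean \<nu> (\<Phi> A) (\<Phi> B) \<le> M *\<^sub>R 1"
  proof -
    have "geom_mean \<nu> (\<Phi> A) (\<Phi> B) \<le> arith_mean \<nu> (\<Phi> A) (\<Phi> B)"
      by (intro geom_mean_le_arith_mean map_spos [OF map] sA sB \<nu>)
    also have "\<dots> \<le> M *\<^sub>R 1"
      using map_between [OF map A] map_between [OF map B] \<nu>
      by (intro arith_mean_le_scalar) (auto simp: bop_between_def)
    finally show ?thesis .
  qed
  moreover have "\<Phi> G \<le> geom_mean \<nu> (\<Phi> A) (\<Phi> B)"
    unfolding G_def using \<nu> by (intro map_geom_mean_le map sA sB) auto
  ultimately show ?thesis
    using conclude [of "\<Phi> G"] conclude [of "geom_mean \<nu> (\<Phi> A) (\<Phi> B)"]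
    unfolding L_def E_def X_def Y_def G_def by simp
qed

end
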